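(* Let $J$ and $f$ satisfy the standing assumptions in the context. Assume $\mu_0<0$ and that there exists $\phi\in C_{per}(\mathbb{R}^N)$, $\phi>0$, satisfying $J*\phi-\phi+f_u(x,0)\phi+\mu_0\phi=0$ in $\mathbb{R}^N$. Let $e\in\mathbb{R}^N$ be a unit vector and let $c_e^*>0$ be the minimal speed of pulsating fronts in the direction $e$, i.e. the number such that the equation $\partial_t u=J*u-u+f(x,u)$ ($t\in\mathbb{R}$, $x\in\mathbb{R}^N$) has a pulsating front solution $u(x,t)=\psi(x\cdot e+ct,x)$ connecting $0$ and $p$ with effective speed $c$ if $c\ge c_e^*$ and has none if $c<c_e^*$. Then $$c_e^*=\inf_{\lambda>0}\left(\frac{-\mu_\lambda}{\lambda}\right),$$ where $\mu_\lambda$ is the periodic principal eigenvalue of $$J_\lambda*\phi-\phi+f_u(x,0)\phi+\mu\phi=0\quad\text{in }\mathbb{R}^N,\qquad J_\lambda(x):=J(x)e^{\lambda x\cdot e}.$$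
   Context: Standing assumptions. $J:\mathbb{R}^N\to\mathbb{R}$ is smooth, $J\ge 0$, $\int_{\mathbb{R}^N}J=1$, $J(0)>0$, $J$ is symmetric ($J(-x)=J(x)$) and its support is contained in the unit ball. $f:\mathbb{R}^N\times[0,\infty)\to\mathbb{R}$ is $[0,1]^N$-periodic in $x$ (i.e. $f(x+k,u)=f(x,u)$ for $k\in\mathbb{Z}^N$), $f\in C^3(\mathbb{R}^N\times[0,\infty))$, $f(\cdot,0)\equiv0$, $u\mapsto f(x,u)/u$ is decreasing on $(0,+\infty)$, and there is $M>0$ with $f(x,u)\le0$ for all $u\ge M$ and all $x$. $C_{per}(\mathbb{R}^N)$ is the space of continuous $[0,1]^N$-periodic functions on $\mathbb{R}^N$, convolution is in the $x$ variable, $f_u=\partial f/\partial u$, and $$\mu_0=\sup\{\mu\in\mathbb{R}\mid \exists\,\phi\in C_{per}(\mathbb{R}^N),\ \phi>0,\ J*\phi-\phi+f_u(x,0)\phi+\mu\phi\le0\}.$$ The periodic principal eigenvalue $\mu_\lambda$ is the (unique) $\mu\in\mathbb{R}$ for which the displayed eigenvalue problem has a solution $\phi\in C_{per}(\mathbb{R}^N)$, $\phi>0$; it exists for every $\lambda$ under the assumptions of the claim. When $\mu_0<0$, $p$ denotes the unique positive continuous periodic solution of $J*p-p+f(x,p)=0$ in $\mathbb{R}^N$. A pulsating front with direction $e$ and effective speed $c\in\mathbb{R}$ connecting $0$ and $p$ is an entire solution (for all $t\in\mathbb{R}$, $x\in\mathbb{R}^N$) of the evolution equation of the form $u(x,t)=\psi(x\cdot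 e+ct,x)$, where $\psi(s,x)$ is $[0,1]^N$-periodic in $x$ and $\lim_{s\to-\infty}\psi(s,x)=0$, $\lim_{s\to+\infty}\psi(s,x)=p(x)$, both uniformly in $x$. *)

theory Defs
  imports "HOL-Analysis.Analysis"
begin

text \<open>
  On a set such as \<open>UNIV \<times> {0..}\<close>, which is convex with nonempty interior, derivatives
  within the set are unique, so the definition below is \<open>C\<^sup>k\<close> regularity up to the boundary.
\<close>

primrec Ck_on :: "nat \<Rightarrow> 'a::euclidean_space set \<Rightarrow> ('a \<Rightarrow> real) \<Rightarrow> bool" where
  "Ck_on 0 S g \<longleftrightarrow> continuous_on S g"
| "Ck_on (Suc k) S g \<longleftrightarrow>
    (\<exists>g'. (\<forall>x\<in>S. (g has_derivative g' x) (at x within S)) \<and> (\<forall>v. Ck_on k S (\<lambda>x. g' x v)))"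

definition smooth :: "('a::euclidean_space \<Rightarrow> real) \<Rightarrow> bool" where
  "smooth g \<longleftrightarrow> (\<forall>k. Ck_on k UNIV g)"

definition periodic :: "(real ^ 'n \<Rightarrow> 'b) \<Rightarrow> bool" where
  "periodic g \<longleftrightarrow> (\<forall>x k. (\<forall>i. k $ i \<in> \<int>) \<longrightarrow> g (x + k) = g x)"

definition C_per :: "(real ^ 'n \<Rightarrow> real) set" where
  "C_per = {\<phi>. continuous_on UNIV \<phi> \<and> periodic \<phi>}"

definition conv :: "(real ^ 'n \<Rightarrow> real) \<Rightarrow> (real ^ 'n \<Rightarrow> real) \<Rightarrow> real ^ 'n \<Rightarrow> real" where
  "conv K v x = (LINT y|lborel. K (x - y) * v y)"

definition kernel_assms :: "(real ^ 'n \<Rightarrow> real) \<Rightarrow> bool" where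
  "kernel_assms J \<longleftrightarrow>
     smooth J \<and> (\<forall>x. 0 \<le> J x) \<and> (LINT x|lborel. J x) = 1 \<and> 0 < J 0 \<and>
     (\<forall>x. J (- x) = J x) \<and> closure {x. J x \<noteq> 0} \<subseteq> cball 0 1"

text \<open>
  The nonlinearity lives on \<open>UNIV \<times> {0..}\<close>; the values of \<open>f x u\<close> for \<open>u < 0\<close> are
  irrelevant and never constrained.
\<close>

definition reaction_assms :: "(real ^ 'n \<Rightarrow> real \<Rightarrow> real) \<Rightarrow> bool" where
  "reaction_assms f \<longleftrightarrow>
     (\<forall>u\<ge>0. periodic (\<lambda>x. f x u)) \<and>
     Ck_on 3 (UNIV \<times> {0..}) (\<lambda>(x, u). f x u) \<and>
     (\<forall>x. f x 0 = 0) \<and>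
     (\<forall>x. strict_antimono_on {0<..} (\<lambda>u. f x u / u)) \<and>
     (\<exists>M>0. \<forall>x. \<forall>u\<ge>M. f x u \<le> 0)"

text \<open>The \<open>u\<close>-derivative is taken within \<open>{0..}\<close>, hence one-sided at \<open>u = 0\<close>.\<close>

definition f_u :: "(real ^ 'n \<Rightarrow> real \<Rightarrow> real) \<Rightarrow> real ^ 'n \<Rightarrow> real \<Rightarrow> real" where
  "f_u f x u = vector_derivative (f x) (at u within {0..})"

definition mu0 :: "(real ^ 'n \<Rightarrow> real) \<Rightarrow> (real ^ 'n \<Rightarrow> real \<Rightarrow> real) \<Rightarrow> real" where
  "mu0 J f = Sup {\<mu>. \<exists>\<phi>\<in>C_per. (\<forall>x. 0 < \<phi> x) \<and>
     (\<forall>x. conv J \<phi> x - \<phi> x + f_u f x 0 * \<phi> x + \<mu> * \<phi> x \<le> 0)}"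

definition periodic_eigenpair ::
    "(real ^ 'n \<Rightarrow> real) \<Rightarrow> (real ^ 'n \<Rightarrow> real \<Rightarrow> real) \<Rightarrow> real \<Rightarrow> (real ^ 'n \<Rightarrow> real) \<Rightarrow> bool" where
  "periodic_eigenpair K f \<mu> \<phi> \<longleftrightarrow> \<phi> \<in> C_per \<and> (\<forall>x. 0 < \<phi> x) \<and>
     (\<forall>x. conv K \<phi> x - \<phi> x + f_u f x 0 * \<phi> x + \<mu> * \<phi> x = 0)"

definition principal_eigenvalue ::
    "(real ^ 'n \<Rightarrow> real) \<Rightarrow> (real ^ 'n \<Rightarrow> real \<Rightarrow> real) \<Rightarrow> real" where
  "principal_eigenvalue K f = (THE \<mu>. \<exists>\<phi>. periodic_eigenpair K f \<mu> \<phi>)"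

definition tilted_kernel ::
    "(real ^ 'n \<Rightarrow> real) \<Rightarrow> real ^ 'n \<Rightarrow> real \<Rightarrow> real ^ 'n \<Rightarrow> real" where
  "tilted_kernel J e l x = J x * exp (l * (x \<bullet> e))"

definition stationary_state ::
    "(real ^ 'n \<Rightarrow> real) \<Rightarrow> (real ^ 'n \<Rightarrow> real \<Rightarrow> real) \<Rightarrow> real ^ 'n \<Rightarrow> real" where
  "stationary_state J f = (THE p. p \<in> C_per \<and> (\<forall>x. 0 < p x) \<and>
     (\<forall>x. conv J p x - p x + f x (p x) = 0))"

text \<open>
  Solutions are nonnegative because \<open>f\<close> is only given for \<open>u \<ge> 0\<close>. Integrability is required
  so that the convolution is a genuine integral: the Bochner integral of a non-integrable
  function is \<open>0\<close> by convention.
\<close>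

definition entire_solution ::
    "(real ^ 'n \<Rightarrow> real) \<Rightarrow> (real ^ 'n \<Rightarrow> real \<Rightarrow> real) \<Rightarrow> (real ^ 'n \<Rightarrow> real \<Rightarrow> real) \<Rightarrow> bool" where
  "entire_solution J f u \<longleftrightarrow>
     (\<forall>x t. 0 \<le> u x t \<and>
        integrable lborel (\<lambda>y. J (x - y) * u y t) \<and>
        ((\<lambda>\<tau>. u x \<tau>) has_real_derivative
           conv J (\<lambda>y. u y t) x - u x t + f x (u x t)) (at t))"

definition pulsating_front ::
    "(real ^ 'n \<Rightarrow> real) \<Rightarrow> (real ^ 'n \<Rightarrow> real \<Rightarrow> real) \<Rightarrow> real ^ 'n \<Rightarrow> real \<Rightarrow>
     (real ^ 'n \<Rightarrow> real \<Rightarrow> real) \<Rightarrow> bool" where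
  "pulsating_front J f e c u \<longleftrightarrow> entire_solution J f u \<and>
     (\<exists>\<psi>. (\<forall>x t. u x t = \<psi> (x \<bullet> e + c * t) x) \<and>
          (\<forall>s. periodic (\<psi> s)) \<and>
          uniform_limit UNIV \<psi> (\<lambda>x. 0) at_bot \<and>
          uniform_limit UNIV \<psi> (stationary_state J f) at_top)"

definition minimal_speed ::
    "(real ^ 'n \<Rightarrow> real) \<Rightarrow> (real ^ 'n \<Rightarrow> real \<Rightarrow> real) \<Rightarrow> real ^ 'n \<Rightarrow> real \<Rightarrow> bool" where
  "minimal_speed J f e cstar \<longleftrightarrow>
     (\<forall>c\<ge>cstar. \<exists>u. pulsating_front J f e c u) \<and>
     (\<forall>c<cstar. \<not> (\<exists>u. pulsating_front J f e c u))"

end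

theory Submission
  imports Defs "HOL-Complex_Analysis.Great_Picard"
begin

text \<open>
  Let \<open>\<nu>(\<lambda>) = -\<mu>\<^sub>\<lambda>\<close> and \<open>a = f\<^sub>u(\<cdot>, 0) - 1\<close>,
  so that \<open>J\<^sub>\<lambda> * \<phi> = (\<nu>(\<lambda>) - a) \<phi>\<close>. A positive eigenfunction
  for \<open>\<lambda> = 0\<close> forces \<open>\<nu>(0) > max a\<close>, and because \<open>J\<close> is even
  the arithmetic-geometric mean inequality gives \<open>\<nu>(\<lambda>) \<ge> \<nu>(0)\<close>; above
  \<open>max a\<close> the eigenvalue problem is one for a compact positive operator, so eigenfunctions exist
  for all \<open>\<lambda>\<close>. Moreover \<open>\<nu>\<close> is even, by duality, and continuous.

  If \<open>\<nu>(\<lambda>\<^sub>1) < c \<lambda>\<^sub>1\<close> for some \<open>\<lambda>\<^sub>1 >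
  0\<close>, there are \<open>\<lambda> < \<lambda>' \<le> 2 \<lambda>\<close> with \<open>\<nu>(\<lambda>) = c
  \<lambda>\<close> and \<open>\<nu>(\<lambda>') < c \<lambda>'\<close>. Then \<open>min
  (e\<^bsup>\<lambda>s\<^esup> \<phi>\<^sub>\<lambda>) p\<close> is a supersolution and
  \<open>e\<^bsup>\<lambda>s\<^esup> \<phi>\<^sub>\<lambda> - A e\<^bsup>\<lambda>'s\<^esup>
  \<phi>\<^sub>\<lambda>\<^sub>'\<close> a subsolution, and monotone iteration of the mild form of the equation
  yields a front of speed \<open>c\<close>.

  Conversely, let \<open>\<psi>\<close> be the profile of a front of speed \<open>c > 0\<close>. Far to the left
  it is a positive supersolution of the linearized equation, and so is the geometric mean of its translates in
  \<open>s\<close>, by Jensen's inequality. A translation in \<open>s\<close> multiplies this mean by almost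
  exactly an exponential \<open>e\<^bsup>\<lambda>s\<^esup>\<close>, so it is nearly a supersolution of the
  eigenvalue problem, whence \<open>\<nu>(\<lambda>) \<le> c \<lambda> + O(\<epsilon>)\<close>. As there is no
  regularization in time, the Harnack inequality needed here may fail for \<open>\<psi>\<close> itself but holds
  for \<open>J * \<psi>\<close>, to which the argument is applied.
\<close>

subsection \<open>Periodic functions\<close>

text \<open>The equation has no smoothing effect, so limits of iterates are a priori only
  measurable. Comparison arguments therefore never use a touching point: they take the best constant
  in an inequality \<open>\<kappa> * h \<le> g\<close> and improve it by a fixed amount, a
  contradiction. Nonlocal eigenvalue problems may lack eigenfunctions, since multiplication by a is
  not compact; the gap above max a, which \<nu>(\<lambda>) \<ge> \<nu>(0) carries over to every
  tilt, allows division by \<nu> - a. Integration over a period cell is replaced by integrals over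
  large balls, whose boundary layer is of lower order. In the coordinate s = x.e + ct an exponential
  e^(\<lambda>s) meets the kernel tilted by -\<lambda>; the evenness of \<nu> brings \<lambda> back.
  The condition \<lambda>' \<le> 2\<lambda> lets the subsolution absorb the quadratic error of f. In
  the converse direction nothing is known about the decay of the profile; averaging its logarithm
  over many shifts produces an almost exponential dependence on s. Time is discretized so that all
  shifts lie on one grid and the means are finite sums.\<close>

lemma periodicD: "periodic g \<Longrightarrow> (\<And>i. k $ i \<in> \<int>) \<Longrightarrow> g (x + k) = g x"
  by (auto simp: periodic_def)

lemma lattice_translate_unit_cube:
  fixes x :: "real ^ 'n"
  obtains k where "\<And>i. k $ i \<in> \<int>" "x + k \<in> cbox 0 1"
proof
  let ?k = "\<chi> i. - of_int \<lfloor>x $ i\<rfloor>"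
  show "(?k::real^'n) $ i \<in> \<int>" for i by simp
  show "x + ?k \<in> cbox 0 1"
    by (auto simp: mem_box_cart) (smt (verit) real_of_int_floor_add_one_ge)
qed

lemma C_perD: "\<phi> \<in> C_per \<Longrightarrow> continuous_on UNIV \<phi>" "\<phi> \<in> C_per \<Longrightarrow> periodic \<phi>"
  by (auto simp: C_per_def)

lemma C_per_measurable [measurable_dest]: "\<phi> \<in> C_per \<Longrightarrow> \<phi> \<in> borel_measurable borel"
  by (auto simp: C_per_def intro: borel_measurable_continuous_onI)

lemma C_per_const [simp]: "(\<lambda>x. c) \<in> C_per"
  by (auto simp: C_per_def periodic_def)

lemma C_per_intros [intro]:
  assumes "\<phi> \<in> C_per" "\<psi> \<in> C_per"
  shows "(\<lambda>x. \<phi> x + \<psi> x) \<in> C_per" "(\<lambda>x. \<phi> x - \<psi> x) \<in> C_per" "(\<lambda>x. \<phi> x * \<psi> x) \<in> C_per"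
    "(\<And>x. \<psi> x \<noteq> 0) \<Longrightarrow> (\<lambda>x. \<phi> x / \<psi> x) \<in> C_per"
  using assms by (auto simp: C_per_def periodic_def intro!: continuous_intros)

lemma C_per_cmult [intro]: "\<phi> \<in> C_per \<Longrightarrow> (\<lambda>x. c * \<phi> x) \<in> C_per" 
  and C_per_uminus [intro]: "\<phi> \<in> C_per \<Longrightarrow> (\<lambda>x. - \<phi> x) \<in> C_per" 
  by (auto simp: C_per_def periodic_def intro!: continuous_intros)

lemma C_per_attains_inf:
  fixes \<phi> :: "real^'n \<Rightarrow> real"
  assumes "\<phi> \<in> C_per"
  obtains x0 where "\<And>x. \<phi> x0 \<le> \<phi> x"
proof -
  have "compact (cbox 0 (1::real^'n))" "cbox 0 (1::real^'n) \<noteq> {}" 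
    using lattice_translate_unit_cube[of 0] by (auto simp del: interval_cbox_cart)
  moreover have "continuous_on (cbox 0 1) \<phi>"
    using C_perD(1)[OF assms] continuous_on_subset by blast
  ultimately obtain x0 where x0: "\<And>y. y \<in> cbox 0 1 \<Longrightarrow> \<phi> x0 \<le> \<phi> y"
    using continuous_attains_inf[of "cbox 0 1" \<phi>] by auto
  have "\<phi> x0 \<le> \<phi> x" for x
    using lattice_translate_unit_cube[of x] x0 periodicD[OF C_perD(2)[OF assms]] by metis
  then show ?thesis using that by blast
qed

lemma C_per_pos_bounds:
  assumes "\<phi> \<in> C_per" "\<And>x. 0 < \<phi> x"
  obtains m M where "0 < m" "\<And>x. m \<le> \<phi> x" "0 < M" "\<And>x. \<phi> x \<le> M"
proof -
  obtain x0 where 1: "\<And>x. \<phi> x0 \<le> \<phi> x" using C_per_attains_inf[OF assms(1)] by blast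
  obtain x1 where "\<And>x. - \<phi> x1 \<le> - \<phi> x" using C_per_attains_inf[OF C_per_uminus[OF assms(1)]] by blast
  then have "\<And>x. \<phi> x \<le> \<phi> x1" by auto
  then show ?thesis using that 1 assms(2) by blast
qed

lemma C_per_bounded:
  assumes "\<phi> \<in> C_per"
  obtains M where "0 < M" "\<And>x. \<bar>\<phi> x\<bar> \<le> M"
proof -
  obtain x0 where 1: "\<And>x. \<phi> x0 \<le> \<phi> x" using C_per_attains_inf[OF assms(1)] by blast
  obtain x1 where "\<And>x. - \<phi> x1 \<le> - \<phi> x" using C_per_attains_inf[OF C_per_uminus[OF assms(1)]] by blast
  then have 2: "\<And>x. \<phi> x \<le> \<phi> x1" by auto
  have "\<bar>\<phi> x\<bar> \<le> \<bar>\<phi> x0\<bar> + \<bar>\<phi> x1\<bar> + 1" for x using 1[of x] 2[of x] by linarith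
  moreover have "0 < \<bar>\<phi> x0\<bar> + \<bar>\<phi> x1\<bar> + 1" by simp
  ultimately show ?thesis using that by blast
qed

text \<open>The best constant \<open>\<kappa>\<close> is the sliding parameter in
  \<open>conv_compare\<close> and \<open>stationary_compare\<close>. It is an infimum that need not
  be attained, since \<open>g\<close> and \<open>h\<close> are not assumed continuous; the bounds
  \<open>m\<close> and \<open>M\<close> make it positive.\<close>

lemma ratio_infimum:
  fixes g h :: "'a \<Rightarrow> real"
  assumes "0 < m" "\<And>x. m \<le> g x" "\<And>x. h x \<le> M" "\<And>x. 0 < h x"
  obtains \<kappa> where "0 < \<kappa>" "\<And>x. \<kappa> * h x \<le> g x" "\<And>\<kappa>'. (\<And>x. \<kappa>' * h x \<le> g x) \<Longrightarrow> \<kappa>' \<le> \<kappa>"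
proof -
  let ?S = "range (\<lambda>x. g x / h x)"
  have M: "0 < M" using assms(3,4) by (meson less_le_trans)
  have lb: "m / M \<le> g x / h x" for x
    using assms(2)[of x] assms(3)[of x] assms(4)[of x] assms(1) by (intro frac_le) auto
  have bdd: "bdd_below ?S" using lb by (auto simp: bdd_below_def)
  show ?thesis
  proof
    have "m / M \<le> Inf ?S" using lb by (auto intro!: cInf_greatest)
    then show "0 < Inf ?S" using assms(1) M by (smt (verit) divide_pos_pos)
    show "Inf ?S * h x \<le> g x" for x
      using cInf_lower[OF _ bdd, of "g x / h x"] assms(4)[of x] by (simp add: pos_le_divide_eq)
    show "\<kappa>' \<le> Inf ?S" if "\<And>x. \<kappa>' * h x \<le> g x" for \<kappa>'
      using that assms(4) by (auto intro!: cInf_greatest simp: pos_le_divide_eq)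
  qed
qed

section \<open>Reflections, and convolution as an integral over the kernel variable\<close>

lemma lborel_reflect:
  fixes x :: "'a::euclidean_space"
  shows "distr lborel borel (\<lambda>y. x - y) = lborel"
  using lborel_affine[of "-1" x] by (simp add: density_1)

text \<open>Holds for every \<open>g\<close>: reflection preserves measurability in both directions,
  and for a non-measurable integrand both integrals take the default value 0. This makes
  \<open>conv_eq\<close> unconditional.\<close>

lemma lborel_integral_reflect:
  fixes g :: "'a::euclidean_space \<Rightarrow> real"
  shows "(LINT y|lborel. g (x - y)) = (LINT z|lborel. g z)"
proof (cases "g \<in> borel_measurable borel")
  case True
  then show ?thesis
    by (subst (2) lborel_reflect[of x, symmetric], subst integral_distr) auto
next
  case False
  have "(\<lambda>y. g (x - y)) \<notin> borel_measurable borel"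
  proof
    assume "(\<lambda>y. g (x - y)) \<in> borel_measurable borel"
    then have "(\<lambda>y. g (x - (x - y))) \<in> borel_measurable borel" by measurable
    then show False using False by simp
  qed
  then have "\<not> integrable lborel (\<lambda>y. g (x - y))" "\<not> integrable lborel g"
    using False by (auto dest!: borel_measurable_integrable)
  then show ?thesis by (simp add: not_integrable_integral_eq)
qed

lemma lborel_integrable_reflect:
  fixes g :: "'a::euclidean_space \<Rightarrow> real"
  assumes "integrable lborel g"
  shows "integrable lborel (\<lambda>y. g (x - y))"
proof -
  have "integrable (distr lborel borel (\<lambda>y. x - y)) g" using assms lborel_reflect[of x] by simp
  then show ?thesis using assms by (subst (asm) integrable_distr_eq) auto
qed

lemma integrable_indicator_cball:
  "integrable lborel (\<lambda>y. indicator (cball x r) y * (c::real))" for x :: "'a::euclidean_space"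
proof -
  have "emeasure lborel (cball x r) < \<infinity>" by (rule emeasure_bounded_finite) auto
  then show ?thesis by (intro integrable_mult_left integrable_real_indicator) auto
qed

lemma conv_eq: "conv K v x = (LINT z|lborel. K z * v (x - z))"
  unfolding conv_def using lborel_integral_reflect[of "\<lambda>z. K z * v (x - z)" x] by simp

lemma conv_periodic:
  fixes v :: "real^'n \<Rightarrow> real"
  assumes "periodic v"
  shows "periodic (conv K v)"
  unfolding periodic_def conv_eq
proof (intro allI impI)
  fix x k :: "real^'n" assume "\<forall>i. k $ i \<in> \<int>"
  then have "v (x + k - z) = v (x - z)" for z
    using periodicD[OF assms, of k "x - z"] by (simp add: algebra_simps)
  then show "(LINT z|lborel. K z * v (x + k - z)) = (LINT z|lborel. K z * v (x - z))" by simp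
qed

subsection \<open>Convolution with a compactly supported kernel\<close>

text \<open>What \<open>J\<close> shares with its exponential tilts. Evenness and unit mass do not
  survive tilting and are therefore kept out.\<close>

locale bump =
  fixes K :: "real^'n \<Rightarrow> real"
  assumes K_cont: "continuous_on UNIV K" and K_nonneg: "\<And>x. 0 \<le> K x" and K_0: "0 < K 0"
    and K_supp: "\<And>x. 1 < norm x \<Longrightarrow> K x = 0"
begin

lemma K_measurable [measurable]: "K \<in> borel_measurable borel"
  by (intro borel_measurable_continuous_onI K_cont)

lemma K_bounded: obtains B where "0 < B" "\<And>x. K x \<le> B"
proof -
  have "bounded (K ` cball 0 1)"
    by (intro compact_imp_bounded compact_continuous_image continuous_on_subset[OF K_cont]) auto
  then obtain B where B: "\<And>x. x \<in> cball 0 1 \<Longrightarrow> \<bar>K x\<bar> \<le> B"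
    unfolding bounded_iff by (metis image_eqI real_norm_def)
  have "K x \<le> max B 1" for x
    using B[of x] K_supp[of x] by (cases "1 < norm x") auto
  then show ?thesis using that[of "max B 1"] by auto
qed

text \<open>Bounds on \<open>v\<close> are asked only within distance 1 of \<open>x\<close>, where
  the kernel lives, because exponentials in the direction e and front profiles are controlled only
  locally.\<close>

lemma integrable_conv:
  fixes v :: "real^'n \<Rightarrow> real"
  assumes [measurable]: "v \<in> borel_measurable borel" and "\<And>y. norm (x - y) \<le> 1 \<Longrightarrow> \<bar>v y\<bar> \<le> C"
  shows "integrable lborel (\<lambda>z. K z * v (x - z))"
proof -
  obtain B where B: "0 < B" "\<And>x. K x \<le> B" using K_bounded by blast
  have C: "0 \<le> C" using assms(2)[of x] by auto
  have "integrable lborel (\<lambda>z. indicator (cball 0 1) z * (B * C))"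
    by (rule integrable_indicator_cball)
  then show ?thesis
  proof (rule Bochner_Integration.integrable_bound)
    show "AE z in lborel. norm (K z * v (x - z)) \<le> norm (indicator (cball 0 1) z * (B * C))"
      using assms(2) B C K_nonneg K_supp
      by (intro always_eventually) (auto simp: indicator_def abs_mult intro!: mult_mono)
  qed measurable
qed

lemma integrable_conv':
  assumes "v \<in> borel_measurable borel" "\<And>y. \<bar>v y\<bar> \<le> C"
  shows "integrable lborel (\<lambda>z. K z * v (x - z))"
  using integrable_conv assms by blast

lemma integrable_K: "integrable lborel K"
  using integrable_conv'[of "\<lambda>_. 1" 1] by simp

lemma conv_mono:
  assumes "v \<in> borel_measurable borel" "w \<in> borel_measurable borel"
    "\<And>y. norm (x - y) \<le> 1 \<Longrightarrow> \<bar>v y\<bar> \<le> C" "\<And>y. norm (x - y) \<le> 1 \<Longrightarrow> \<bar>w y\<bar> \<le> C" 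
    "\<And>y. norm (x - y) \<le> 1 \<Longrightarrow> v y \<le> w y"
  shows "conv K v x \<le> conv K w x"
  unfolding conv_eq
proof (intro integral_mono integrable_conv[where C=C])
  fix z
  show "K z * v (x - z) \<le> K z * w (x - z)"
    using assms(5)[of "x - z"] K_nonneg[of z] K_supp[of z]
    by (cases "norm z \<le> 1") (auto intro!: mult_left_mono)
qed (use assms in auto)

lemma conv_cmult: "conv K (\<lambda>y. c * v y) x = c * conv K v x"
  unfolding conv_def by (simp add: mult.left_commute)

lemma conv_add:
  assumes "v \<in> borel_measurable borel" "\<And>y. \<bar>v y\<bar> \<le> C" 
    "w \<in> borel_measurable borel" "\<And>y. \<bar>w y\<bar> \<le> D"
  shows "conv K (\<lambda>y. v y + w y) x = conv K v x + conv K w x"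
  unfolding conv_eq distrib_left
  by (intro Bochner_Integration.integral_add integrable_conv'[OF assms(1,2)] integrable_conv'[OF assms(3,4)])

lemma conv_diff:
  assumes "v \<in> borel_measurable borel" "\<And>y. \<bar>v y\<bar> \<le> C" 
    "w \<in> borel_measurable borel" "\<And>y. \<bar>w y\<bar> \<le> D"
  shows "conv K (\<lambda>y. v y - w y) x = conv K v x - conv K w x"
  using conv_add[OF assms(1,2), of "\<lambda>y. - w y" D] assms(3,4) conv_cmult[of "-1" w] by simp

lemma conv_nonneg:
  assumes *: "\<And>y. norm (x - y) \<le> 1 \<Longrightarrow> 0 \<le> v y"
  shows "0 \<le> conv K v x"
  unfolding conv_eq
proof (intro Bochner_Integration.integral_nonneg)
  fix z
  show "0 \<le> K z * v (x - z)"
    using K_nonneg[of z] K_supp[of z] *[of "x - z"] by (cases "norm z \<le> 1") auto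
qed

lemma K_pos_near_0: obtains \<rho> k0 where "0 < \<rho>" "\<rho> \<le> 1" "0 < k0" "\<And>z. norm z \<le> \<rho> \<Longrightarrow> k0 \<le> K z"
proof -
  have "isCont K 0" using K_cont by (simp add: continuous_on_eq_continuous_at)
  then obtain d where d: "d > 0" "\<And>z. dist z 0 < d \<Longrightarrow> dist (K z) (K 0) < K 0 / 2"
    using K_0 unfolding continuous_at_eps_delta by (metis half_gt_zero)
  show ?thesis
  proof
    show "0 < min (d/2) 1" "min (d/2) 1 \<le> 1" "0 < K 0 / 2" using d K_0 by auto
    fix z :: "real^'n" assume "norm z \<le> min (d/2) 1"
    then have "dist z 0 < d" using d(1) by auto
    then have "\<bar>K z - K 0\<bar> < K 0 / 2" using d(2) by (auto simp: dist_real_def)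
    then show "K 0 / 2 \<le> K z" unfolding abs_less_iff by linarith
  qed
qed

lemma conv_lower_ball:
  fixes x :: "real^'n" and \<rho> :: real
  assumes "v \<in> borel_measurable borel" "\<And>y. norm (x - y) \<le> 1 \<Longrightarrow> \<bar>v y\<bar> \<le> C" 
    "\<And>y. norm (x - y) \<le> 1 \<Longrightarrow> 0 \<le> v y"
    "\<And>z. norm z \<le> \<rho> \<Longrightarrow> k0 \<le> K z" "\<rho> \<le> 1" "0 < k0"
    "S \<subseteq> cball x \<rho>" "S \<in> sets borel"
  shows "k0 * (LINT y|lborel. indicator S y * v y) \<le> conv K v x"
proof -
  have [measurable]: "v \<in> borel_measurable borel" "S \<in> sets borel" using assms by auto
  have i: "integrable lborel (\<lambda>y. K (x - y) * v y)"
    using lborel_integrable_reflect[OF integrable_conv[OF assms(1,2)], of x x] by simp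
  have le: "k0 * (indicator S y * v y) \<le> K (x - y) * v y" for y
  proof (cases "y \<in> S")
    case True
    then have "norm (x - y) \<le> \<rho>" using assms(7) by (auto simp: dist_norm)
    then show ?thesis using True assms(3)[of y] assms(4)[of "x - y"] assms(5) by (auto intro!: mult_right_mono)
  next
    case False
    then show ?thesis using assms(3)[of y] K_nonneg[of "x - y"] K_supp[of "x - y"] by (cases "norm (x - y) \<le> 1") auto
  qed
  have nn: "0 \<le> indicator S y * v y" for y
    using assms(3)[of y] assms(5,7) by (cases "y \<in> S") (auto simp: dist_norm subset_eq)
  have "integrable lborel (\<lambda>y. k0 * (indicator S y * v y))"
    using i by (rule Bochner_Integration.integrable_bound) (use le nn assms(6) in \<open>auto intro!: always_eventually simp: abs_of_nonneg\<close>, smt (verit) le nn mult_nonneg_nonneg)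
  then have "(LINT y|lborel. k0 * (indicator S y * v y)) \<le> (LINT y|lborel. K (x - y) * v y)"
    by (intro integral_mono i le) 
  then show ?thesis by (simp add: conv_def)
qed

text \<open>A vanishing integral over \<open>S\<close> would make a nonempty open set
  negligible.\<close>

lemma conv_pos:
  fixes x :: "real^'n" and \<rho> :: real
  assumes "v \<in> borel_measurable borel" "\<And>y. norm (x - y) \<le> 1 \<Longrightarrow> \<bar>v y\<bar> \<le> C" 
    "\<And>y. norm (x - y) \<le> 1 \<Longrightarrow> 0 \<le> v y"
    "\<And>z. norm z \<le> \<rho> \<Longrightarrow> k0 \<le> K z" "\<rho> \<le> 1" "0 < k0"
    "open S" "S \<subseteq> cball x \<rho>" "S \<noteq> {}" "\<And>y. y \<in> S \<Longrightarrow> 0 < v y"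
  shows "0 < conv K v x"
proof -
  have [measurable]: "v \<in> borel_measurable borel" "S \<in> sets borel" using assms by auto
  have S1: "S \<subseteq> cball x 1" using assms(5,8) by auto
  have nn: "0 \<le> indicator S y * v y" for y using assms(10)[of y] by (auto simp: indicator_def)
  have i: "integrable lborel (\<lambda>y. indicator S y * v y)"
  proof (rule Bochner_Integration.integrable_bound)
    show "integrable lborel (\<lambda>y. indicator (cball x 1) y * C)"
      by (rule integrable_indicator_cball)
    show "AE y in lborel. norm (indicator S y * v y) \<le> norm (indicator (cball x 1) y * C)"
      using S1 assms(2) by (intro always_eventually) (force simp: indicator_def dist_norm subset_eq)
  qed measurable
  have "(LINT y|lborel. indicator S y * v y) \<noteq> 0"
  proof
    assume "(LINT y|lborel. indicator S y * v y) = 0"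
    then have "AE y in lborel. indicator S y * v y = 0"
      using integral_nonneg_eq_0_iff_AE[OF i] nn by auto
    then have "AE y in lborel. y \<notin> S"
      by eventually_elim (use assms(10) in \<open>force simp: indicator_def split: if_splits\<close>)
    then have "S \<in> null_sets lborel" by (subst (asm) AE_iff_null_sets[symmetric]) auto
    then have "negligible S" by (auto simp: negligible_iff_null_sets intro: null_sets_completionI)
    then show False using assms(7,9) open_not_negligible by blast
  qed
  moreover have "0 \<le> (LINT y|lborel. indicator S y * v y)" using nn by (intro Bochner_Integration.integral_nonneg) 
  ultimately have "0 < k0 * (LINT y|lborel. indicator S y * v y)" using assms(6) by auto
  also have "\<dots> \<le> conv K v x" using assms by (intro conv_lower_ball) auto
  finally show ?thesis .
qed

lemma conv_pos':
  assumes "v \<in> borel_measurable borel" "\<And>y. norm (x - y) \<le> 1 \<Longrightarrow> \<bar>v y\<bar> \<le> C" "\<And>y. norm (x - y) \<le> 1 \<Longrightarrow> 0 < v y"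
  shows "0 < conv K v x"
proof -
  obtain \<rho> k0 where r: "0 < \<rho>" "\<rho> \<le> 1" "0 < k0" "\<And>z. norm z \<le> \<rho> \<Longrightarrow> k0 \<le> K z" using K_pos_near_0 by blast
  show ?thesis by (rule conv_pos[OF assms(1,2), where \<rho>=\<rho> and ?k0.0=k0 and S="ball x \<rho>"]) (use r assms in \<open>auto simp: dist_norm less_imp_le\<close>)
qed

lemma conv_bound: "(\<And>y. \<bar>v y\<bar> \<le> C) \<Longrightarrow> v \<in> borel_measurable borel \<Longrightarrow> \<bar>conv K v x\<bar> \<le> C * (LINT z|lborel. K z)"
proof -
  assume a: "\<And>y. \<bar>v y\<bar> \<le> C" "v \<in> borel_measurable borel"
  have "\<bar>conv K v x\<bar> \<le> (LINT z|lborel. \<bar>K z * v (x - z)\<bar>)" unfolding conv_eq by (rule integral_abs_bound)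
  also have "\<dots> \<le> (LINT z|lborel. C * K z)"
    by (intro integral_mono integrable_abs integrable_conv'[where C=C] integrable_mult_right integrable_K a)
       (use a K_nonneg in \<open>auto simp: abs_mult mult.commute[of C] intro!: mult_left_mono\<close>)
  finally show ?thesis by simp
qed

lemma conv_measurable [measurable]:
  assumes [measurable]: "v \<in> borel_measurable borel"
  shows "conv K v \<in> borel_measurable borel"
proof -
  have "(\<lambda>x. LINT y|lborel. K (x - y) * v y) \<in> borel_measurable borel"
    by measurable
  then show ?thesis by (simp add: conv_def[abs_def])
qed

text \<open>The modulus \<open>\<delta>\<close> depends on \<open>v\<close> only through the bound
  \<open>C\<close>. This is the source of compactness for the eigenvalue problem.\<close>

lemma conv_equicontinuous:
  assumes "0 < \<epsilon>"
  obtains \<delta> where "0 < \<delta>" "\<And>v x x'. \<lbrakk>v \<in> borel_measurable borel; \<And>y. \<bar>v y\<bar> \<le> C; dist x x' < \<delta>\<rbrakk> \<Longrightarrow> \<bar>conv K v x - conv K v x'\<bar> < \<epsilon>"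
proof -
  define V where "V = measure lborel (cball (0::real^'n) 2)"
  have V: "0 \<le> V" by (simp add: V_def)
  define \<eta> where "\<eta> = \<epsilon> / (2 * (\<bar>C\<bar> + 1) * (V + 1))"
  have \<eta>: "0 < \<eta>" using assms V by (simp add: \<eta>_def)
  have "uniformly_continuous_on (cball 0 3) K"
    by (intro compact_uniformly_continuous continuous_on_subset[OF K_cont]) auto
  then obtain d where d: "0 < d" "\<And>x x'. x \<in> cball 0 3 \<Longrightarrow> x' \<in> cball 0 3 \<Longrightarrow> dist x' x < d \<Longrightarrow> dist (K x') (K x) < \<eta>"
    using \<eta> unfolding uniformly_continuous_on_def by metis
  \<comment> \<open>If norm x \<le> 2, both points lie in the ball of radius 3; otherwise both have
    norm above 1, where \<open>K\<close> vanishes.\<close>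
  have unif: "\<bar>K x - K x'\<bar> < \<eta>" if "dist x x' < min d 1" for x x'
  proof (cases "norm x \<le> 2")
    case True
    then have "norm x' \<le> 3" using that by (smt (verit) dist_norm norm_triangle_ineq2 norm_minus_commute)
    then show ?thesis using d(2)[of x' x] True that by (auto simp: dist_real_def)
  next
    case False
    then have "norm x' > 1" using that by (smt (verit) dist_norm norm_triangle_ineq2)
    then show ?thesis using False K_supp \<eta> by auto
  qed
  show ?thesis
  proof (rule that)
    show "0 < min d 1" using d by auto
    fix v :: "real^'n \<Rightarrow> real" and x x' :: "real^'n"
    assume v[measurable]: "v \<in> borel_measurable borel" and vC: "\<And>y. \<bar>v y\<bar> \<le> C" and dx: "dist x x' < min d 1"
    have C: "0 \<le> C" using vC[of 0] by auto
    have int: "integrable lborel (\<lambda>y. K (x - y) * v y)" for x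
      using lborel_integrable_reflect[OF integrable_conv'[OF v vC], of x x] by simp
    have "conv K v x - conv K v x' = (LINT y|lborel. K (x - y) * v y - K (x' - y) * v y)"
      unfolding conv_def by (intro Bochner_Integration.integral_diff[symmetric] int)
    also have "\<bar>\<dots>\<bar> \<le> (LINT y|lborel. \<bar>K (x - y) * v y - K (x' - y) * v y\<bar>)" by (rule integral_abs_bound)
    \<comment> \<open>Radius 2 covers the supports of both kernels, since x and x' are less than 1
      apart.\<close>
    also have "\<dots> \<le> (LINT y|lborel. indicator (cball x 2) y * (\<eta> * C))"
    proof (intro integral_mono integrable_abs Bochner_Integration.integrable_diff int)
      show "integrable lborel (\<lambda>y. indicator (cball x 2) y * (\<eta> * C))"
        by (rule integrable_indicator_cball)
      fix y
      show "\<bar>K (x - y) * v y - K (x' - y) * v y\<bar> \<le> indicator (cball x 2) y * (\<eta> * C)"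
      proof (cases "y \<in> cball x 2")
        case True
        have "\<bar>K (x - y) - K (x' - y)\<bar> \<le> \<eta>" using unif[of "x - y" "x' - y"] dx by (simp add: dist_norm)
        then have "\<bar>K (x - y) - K (x' - y)\<bar> * \<bar>v y\<bar> \<le> \<eta> * C" using vC[of y] C \<eta> by (intro mult_mono) auto
        then show ?thesis using True by (simp add: left_diff_distrib[symmetric] abs_mult)
      next
        case False
        then have n: "2 < norm (x - y)" by (simp add: dist_norm)
        then have "1 < norm (x' - y)" using dx norm_triangle_ineq[of "x - x'" "x' - y"] by (simp add: dist_norm)
        then show ?thesis using n False K_supp by simp
      qed
    qed
    also have "\<dots> = V * (\<eta> * C)"
      by (simp add: V_def content_cball)
    also have "\<dots> \<le> (V + 1) * (\<eta> * (\<bar>C\<bar> + 1))" using V C \<eta> by (intro mult_mono) auto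
    also have "\<dots> = \<epsilon> / 2"
    proof -
      have "\<bar>C\<bar> + 1 \<noteq> 0" "V + 1 \<noteq> 0" using V by linarith+
      moreover have "w * (\<epsilon> / (2 * c * w) * c) = \<epsilon> / 2" if "c \<noteq> 0" "w \<noteq> 0" for c w :: real
        using that by (simp add: field_simps)
      ultimately show ?thesis unfolding \<eta>_def by blast
    qed
    also have "\<dots> < \<epsilon>" using assms by simp
    finally show "\<bar>conv K v x - conv K v x'\<bar> < \<epsilon>" .
  qed
qed

lemma conv_continuous:
  assumes "v \<in> borel_measurable borel" "\<And>y. \<bar>v y\<bar> \<le> C"
  shows "continuous_on UNIV (conv K v)"
  unfolding continuous_on_iff dist_real_def
proof (intro ballI allI impI)
  fix x e assume "0 < (e::real)"
  then obtain d where "0 < d" "\<And>v x x'. \<lbrakk>v \<in> borel_measurable borel; \<And>y. \<bar>v y\<bar> \<le> C; dist x x' < d\<rbrakk> \<Longrightarrow> \<bar>conv K v x - conv K v x'\<bar> < e"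
    using conv_equicontinuous[where C=C] by metis
  then show "\<exists>d>0. \<forall>x'\<in>UNIV. dist x' x < d \<longrightarrow> \<bar>conv K v x' - conv K v x\<bar> < e"
    using assms by blast
qed

lemma conv_C_per: "v \<in> C_per \<Longrightarrow> conv K v \<in> C_per"
  by (rule C_per_bounded[of v], assumption)
     (auto simp: C_per_def intro: conv_periodic conv_continuous borel_measurable_continuous_onI)

lemma conv_tendsto:
  assumes "\<And>i. w i \<in> borel_measurable borel" "\<And>i y. \<bar>w i y\<bar> \<le> C" "\<And>y. (\<lambda>i. w i y) \<longlonglongrightarrow> v y"
  shows "(\<lambda>i. conv K (w i) x) \<longlonglongrightarrow> conv K v x"
  unfolding conv_eq
proof (rule integral_dominated_convergence[where w="\<lambda>z. C * K z"])
  have [measurable]: "w i \<in> borel_measurable borel" for i by fact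
  have [measurable]: "v \<in> borel_measurable borel"
    using assms(3) by (rule borel_measurable_LIMSEQ_real) measurable
  show "(\<lambda>z. K z * v (x - z)) \<in> borel_measurable lborel" by measurable
  show "(\<lambda>z. K z * w i (x - z)) \<in> borel_measurable lborel" for i by measurable
  show "integrable lborel (\<lambda>z. C * K z)" by (intro integrable_mult_right integrable_K)
  show "AE z in lborel. (\<lambda>i. K z * w i (x - z)) \<longlonglongrightarrow> K z * v (x - z)"
    by (intro always_eventually allI tendsto_mult tendsto_const assms(3))
  show "AE z in lborel. norm (K z * w i (x - z)) \<le> C * K z" for i
    using assms(2) K_nonneg by (intro always_eventually) (auto simp: abs_mult mult.commute[of C] intro!: mult_left_mono)
qed

end

lemma lattice_translate_near:
  fixes x x0 :: "real ^ 'n"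
  obtains k where "\<And>i. k $ i \<in> \<int>" "norm (x + k - x0) \<le> real CARD('n)"
proof -
  obtain k where k: "\<And>i. k $ i \<in> \<int>" "x - x0 + k \<in> cbox 0 1"
    using lattice_translate_unit_cube[of "x - x0"] by blast
  have "norm (x - x0 + k) \<le> (\<Sum>i\<in>UNIV. \<bar>(x - x0 + k) $ i\<bar>)" by (rule norm_le_l1_cart)
  also have "\<dots> \<le> (\<Sum>i\<in>(UNIV::'n set). 1)"
    using k(2) by (intro sum_mono) (auto simp: mem_box_cart)
  finally have "norm (x + k - x0) \<le> real CARD('n)" by (simp add: algebra_simps)
  then show ?thesis using that k(1) by blast
qed

subsection \<open>Existence of positive eigenfunctions\<close>

context bump
begin

text \<open>The identity plus the operator b^-1 conv K, as for a lazy random walk. The identity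
  preserves positivity already gained while the convolution enlarges the set of positivity, so
  iterates become positive everywhere. The eigenvalue 1 of b^-1 conv K becomes 2.\<close>

definition lazy :: "(real^'n \<Rightarrow> real) \<Rightarrow> (real^'n \<Rightarrow> real) \<Rightarrow> real^'n \<Rightarrow> real" where
  "lazy b \<phi> x = \<phi> x + conv K \<phi> x / b x"

lemma lazy_C_per:
  assumes "b \<in> C_per" "\<And>x. 0 < b x" "\<phi> \<in> C_per"
  shows "lazy b \<phi> \<in> C_per"
  unfolding lazy_def[abs_def]
  using assms(2) by (intro C_per_intros conv_C_per assms) (simp add: less_imp_neq[THEN not_sym])

lemma lazy_pow_C_per:
  assumes "b \<in> C_per" "\<And>x. 0 < b x" "\<phi> \<in> C_per"
  shows "(lazy b ^^ m) \<phi> \<in> C_per"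
  by (induction m) (auto intro: lazy_C_per assms)

lemma lazy_pow_nonneg:
  assumes "\<And>x. 0 < b x" "\<And>x. 0 \<le> \<phi> x"
  shows "0 \<le> (lazy b ^^ m) \<phi> x"
proof (induction m arbitrary: x)
  case (Suc m)
  have "0 \<le> conv K ((lazy b ^^ m) \<phi>) x" using Suc by (intro conv_nonneg)
  then show ?case using Suc[of x] assms(1)[of x] by (simp add: lazy_def[of b "(lazy b ^^ m) \<phi>"])
qed (use assms in auto)

lemma lazy_lin:
  assumes "\<phi> \<in> C_per" "\<psi> \<in> C_per"
  shows "lazy b (\<lambda>x. \<phi> x - c * \<psi> x) = (\<lambda>x. lazy b \<phi> x - c * lazy b \<psi> x)"
proof
  fix x
  obtain B where B: "\<And>x. \<bar>\<phi> x\<bar> \<le> B" using C_per_bounded[OF assms(1)] by blast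
  have \<psi>: "(\<lambda>x. c * \<psi> x) \<in> C_per" using assms(2) by (rule C_per_cmult)
  obtain D where D: "\<And>x. \<bar>c * \<psi> x\<bar> \<le> D" using C_per_bounded[OF \<psi>] by blast
  have "conv K (\<lambda>x. \<phi> x - c * \<psi> x) x = conv K \<phi> x - c * conv K \<psi> x"
    using conv_diff[OF C_per_measurable[OF assms(1)] B C_per_measurable[OF \<psi>] D] by (simp add: conv_cmult)
  then show "lazy b (\<lambda>x. \<phi> x - c * \<psi> x) x = lazy b \<phi> x - c * lazy b \<psi> x"
    unfolding lazy_def by (simp only: diff_divide_distrib) (simp add: algebra_simps)
qed

lemma lazy_pow_lin:
  assumes "b \<in> C_per" "\<And>x. 0 < b x" "\<phi> \<in> C_per" "\<psi> \<in> C_per"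
  shows "(lazy b ^^ m) (\<lambda>x. \<phi> x - c * \<psi> x) = (\<lambda>x. (lazy b ^^ m) \<phi> x - c * (lazy b ^^ m) \<psi> x)"
proof (induction m)
  case (Suc m)
  have "(lazy b ^^ Suc m) (\<lambda>x. \<phi> x - c * \<psi> x) = lazy b (\<lambda>x. (lazy b ^^ m) \<phi> x - c * (lazy b ^^ m) \<psi> x)"
    using Suc by simp
  also have "\<dots> = (\<lambda>x. (lazy b ^^ Suc m) \<phi> x - c * (lazy b ^^ Suc m) \<psi> x)"
    by (subst lazy_lin) (auto intro: lazy_pow_C_per[OF assms(1,2)] assms)
  finally show ?case .
qed simp

text \<open>Each iteration spreads positivity by \<open>\<rho> / 2\<close> around \<open>x0\<close>.
  By periodicity it suffices to reach the distance \<open>CARD('n)\<close>.\<close>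

lemma lazy_pow_pos:
  fixes x0 :: "real^'n"
  assumes "b \<in> C_per" "\<And>x. 0 < b x" "\<phi> \<in> C_per" "\<And>x. 0 \<le> \<phi> x" "0 < \<phi> x0"
  obtains m where "\<And>x. 0 < (lazy b ^^ m) \<phi> x"
proof -
  obtain \<rho> k0 where r: "0 < \<rho>" "\<rho> \<le> 1" "0 < k0" "\<And>z. norm z \<le> \<rho> \<Longrightarrow> k0 \<le> K z" using K_pos_near_0 by blast
  have step: "0 < (lazy b ^^ m) \<phi> x" if "norm (x - x0) \<le> m * (\<rho>/2)" for x m
    using that
  proof (induction m arbitrary: x)
    case (Suc m)
    \<comment> \<open>The point on the segment from \<open>x0\<close> to \<open>x\<close> that
      \<open>m\<close> steps reach; the last step covers the remaining distance, at most
      \<open>\<rho> / 2\<close>.\<close>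
    define y where "y = x0 + (real m / real (Suc m)) *\<^sub>R (x - x0)"
    have "y - x0 = (real m / real (Suc m)) *\<^sub>R (x - x0)" by (simp add: y_def)
    then have "norm (y - x0) = real m / real (Suc m) * norm (x - x0)" by simp
    also have "\<dots> \<le> real m / real (Suc m) * (Suc m * (\<rho>/2))" using Suc.prems by (intro mult_left_mono) auto
    also have "\<dots> = m * (\<rho>/2)" by (simp del: of_nat_Suc)
    finally have "0 < (lazy b ^^ m) \<phi> y" by (rule Suc.IH)
    let ?v = "(lazy b ^^ m) \<phi>"
    have v: "?v \<in> C_per" by (intro lazy_pow_C_per assms)
    have "x - y = (1 / real (Suc m)) *\<^sub>R (x - x0)"
      unfolding y_def by (simp add: vec_eq_iff field_simps)
    then have "norm (x - y) = norm (x - x0) / Suc m" by simp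
    also have "\<dots> \<le> (Suc m * (\<rho>/2)) / Suc m" using Suc.prems by (intro divide_right_mono) auto
    also have "\<dots> = \<rho>/2" by (simp del: of_nat_Suc)
    finally have xy: "norm (x - y) < \<rho>" using r by simp
    obtain B where B: "\<And>x. \<bar>?v x\<bar> \<le> B" using C_per_bounded[OF v] by blast
    have "0 < conv K ?v x"
    proof (rule conv_pos[where S="ball x \<rho> \<inter> {z. 0 < ?v z}" and \<rho>=\<rho> and ?k0.0=k0 and C=B])
      show "open (ball x \<rho> \<inter> {z. 0 < ?v z})"
        using C_perD(1)[OF v] by (intro open_Int open_ball open_Collect_less) (auto intro: continuous_intros)
      have "y \<in> ball x \<rho> \<inter> {z. 0 < ?v z}" using xy \<open>0 < ?v y\<close> by (simp add: dist_norm)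
      then show "ball x \<rho> \<inter> {z. 0 < ?v z} \<noteq> {}" by blast
    qed (use r B C_per_measurable[OF v] lazy_pow_nonneg assms in auto)
    moreover have "0 \<le> ?v x" by (intro lazy_pow_nonneg assms)
    ultimately show ?case using assms(2)[of x] by (simp add: lazy_def[of b "(lazy b ^^ m) \<phi>"] add_nonneg_pos)
  qed (use assms in auto)
  obtain m :: nat where m: "real CARD('n) / (\<rho>/2) \<le> m" using real_arch_simple by blast
  have "0 < (lazy b ^^ m) \<phi> x" for x
  proof -
    obtain k where k: "\<And>i. k $ i \<in> \<int>" "norm (x + k - x0) \<le> real CARD('n)" using lattice_translate_near by blast
    have "real CARD('n) \<le> m * (\<rho>/2)" using m r(1) by (simp add: field_simps)
    then have "0 < (lazy b ^^ m) \<phi> (x + k)" using k(2) by (intro step) simp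
    also have "(lazy b ^^ m) \<phi> (x + k) = (lazy b ^^ m) \<phi> x"
      using k(1) by (intro periodicD C_perD(2) lazy_pow_C_per assms)
    finally show ?thesis .
  qed
  then show ?thesis using that by blast
qed

text \<open>Collatz-Wielandt principle: the eigenvalue is the largest s for which (\<alpha> + s
  \<beta>) \<phi> \<le> conv K \<phi> has a nonzero solution \<phi> \<ge> 0. If a solution for this
  s were not an equality, positivity of the iterates of \<open>lazy\<close> would allow a larger s.
  The form \<alpha> + s \<beta> covers both the multiplicative problem (\<alpha> = 0) and the
  additive one (\<beta> = 1) in \<open>tilted_eigen_exists\<close>.\<close>

lemma eigenfunction_exists:
  fixes \<alpha> \<beta> \<phi>0 :: "real^'n \<Rightarrow> real"
  assumes \<alpha>: "\<alpha> \<in> C_per" and \<beta>: "\<beta> \<in> C_per" and \<beta>0: "\<And>x. 0 < \<beta> x" and b0: "\<And>x. 0 < \<alpha> x + s0 * \<beta> x"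
    and \<phi>0: "\<phi>0 \<in> C_per" "\<And>x. 0 \<le> \<phi>0 x" "0 < \<phi>0 x1" "\<And>x. (\<alpha> x + s0 * \<beta> x) * \<phi>0 x \<le> conv K \<phi>0 x"
  obtains s \<psi> where "s0 \<le> s" "\<psi> \<in> C_per" "\<And>x. 0 < \<psi> x" "\<And>x. conv K \<psi> x = (\<alpha> x + s * \<beta> x) * \<psi> x"
proof -
  define I where "I = (LINT z|lborel. K z)"
  have I0: "0 \<le> I" unfolding I_def using K_nonneg by (intro Bochner_Integration.integral_nonneg) 
  have bC: "(\<lambda>x. \<alpha> x + s * \<beta> x) \<in> C_per" for s using \<alpha> \<beta> by (intro C_per_intros C_per_cmult)
  obtain m0 where m0: "0 < m0" "\<And>x. m0 \<le> \<alpha> x + s0 * \<beta> x" using C_per_pos_bounds[OF bC b0] by metis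
  obtain \<beta>m \<beta>M where \<beta>m: "0 < \<beta>m" "\<And>x. \<beta>m \<le> \<beta> x" "0 < \<beta>M" "\<And>x. \<beta> x \<le> \<beta>M" using C_per_pos_bounds[OF \<beta> \<beta>0] by metis
  obtain A where A: "0 < A" "\<And>x. \<bar>\<alpha> x\<bar> \<le> A" using C_per_bounded[OF \<alpha>] by metis
  have bm: "m0 \<le> \<alpha> x + s * \<beta> x" if "s0 \<le> s" for s x
    using m0(2)[of x] mult_right_mono[OF that less_imp_le[OF \<beta>0], of x] by linarith
  define P where "P s \<phi> \<longleftrightarrow> \<phi> \<in> C_per \<and> (\<forall>x. 0 \<le> \<phi> x) \<and> (\<exists>x. 0 < \<phi> x) \<and> (\<forall>x. (\<alpha> x + s * \<beta> x) * \<phi> x \<le> conv K \<phi> x)" for s \<phi>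
  define S where "S = {s. s0 \<le> s \<and> (\<exists>\<phi>. P s \<phi>)}"
  have normalize: "\<exists>\<phi>. P s \<phi> \<and> (\<forall>x. \<phi> x \<le> 1) \<and> (\<exists>x\<in>cbox 0 1. \<phi> x = 1)" if sS: "s \<in> S" for s
  proof -
    obtain \<phi> where P: "P s \<phi>" using sS unfolding S_def by blast
    obtain x1 where "\<And>x. - \<phi> x1 \<le> - \<phi> x" using C_per_attains_inf[OF C_per_uminus] P P_def by metis
    then have x1: "\<phi> x \<le> \<phi> x1" for x by simp
    have pos: "0 < \<phi> x1" using P x1 P_def by (meson less_le_trans)
    obtain k where k: "\<And>i. k $ i \<in> \<int>" "x1 + k \<in> cbox 0 1" using lattice_translate_unit_cube by blast
    have "\<phi> (x1 + k) = \<phi> x1" using k(1) P P_def C_perD(2) periodicD by blast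
    moreover have "P s (\<lambda>x. 1 / \<phi> x1 * \<phi> x)"
      unfolding P_def
    proof (intro conjI allI)
      show "(\<lambda>x. 1 / \<phi> x1 * \<phi> x) \<in> C_per" using P by (intro C_per_cmult) (auto simp: P_def)
      show "0 \<le> 1 / \<phi> x1 * \<phi> x" for x using P pos by (auto simp: P_def)
      show "\<exists>x. 0 < 1 / \<phi> x1 * \<phi> x" using pos by (intro exI[of _ x1]) auto
      fix x
      have "1 / \<phi> x1 * ((\<alpha> x + s * \<beta> x) * \<phi> x) \<le> 1 / \<phi> x1 * conv K \<phi> x"
        using P pos unfolding P_def by (intro mult_left_mono) auto
      then show "(\<alpha> x + s * \<beta> x) * (1 / \<phi> x1 * \<phi> x) \<le> conv K (\<lambda>x. 1 / \<phi> x1 * \<phi> x) x"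
        unfolding conv_cmult by (simp add: mult.left_commute)
    qed
    ultimately show ?thesis using pos x1 k(2)
      by (intro exI[of _ "\<lambda>x. 1 / \<phi> x1 * \<phi> x"]) (auto intro!: bexI[of _ "x1 + k"])
  qed
  have Sne: "s0 \<in> S" unfolding S_def P_def using \<phi>0 by auto
  \<comment> \<open>For s > 0, evaluate the inequality at a maximum point of the normalized
    subsolution.\<close>
  have Sbdd: "s \<le> (I + A) / \<beta>m" if sS: "s \<in> S" for s
  proof (cases "s \<le> 0")
    case True
    have "0 \<le> (I + A) / \<beta>m" using I0 A \<beta>m by simp
    then show ?thesis using True by linarith
  next
    case False
    obtain \<phi> x where P: "P s \<phi>" and le: "\<And>x. \<phi> x \<le> 1" and x: "\<phi> x = 1" using normalize[OF sS] by blast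
    have "\<alpha> x + s * \<beta> x \<le> conv K \<phi> x" using P x unfolding P_def by (metis mult.right_neutral)
    also have "\<dots> \<le> I"
      using conv_bound[of \<phi> 1 x] P le C_per_measurable unfolding P_def I_def by (auto simp: abs_le_iff)
    finally have "s * \<beta> x \<le> I + A" using A(2)[of x] by (auto simp: abs_le_iff)
    moreover have "s * \<beta>m \<le> s * \<beta> x" using False \<beta>m(2)[of x] by (intro mult_left_mono) auto
    ultimately show ?thesis using \<beta>m(1) by (simp add: field_simps)
  qed
  then have bdd: "bdd_above S" by (auto simp: bdd_above_def)
  define t where "t = Sup S"
  have t0: "s0 \<le> t" unfolding t_def by (intro cSup_upper Sne bdd)
  have "\<exists>s. s \<in> S \<and> t - 1 / Suc n < s" for n
    using less_cSupD[of S "t - 1 / Suc n"] Sne unfolding t_def by auto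
  then obtain \<sigma> where \<sigma>: "\<And>n. \<sigma> n \<in> S" "\<And>n. t - 1 / Suc n < \<sigma> n" by metis
  have \<sigma>le: "\<sigma> n \<le> t" for n unfolding t_def by (intro cSup_upper \<sigma> bdd)
  have "(\<lambda>n. t - inverse (real (Suc n))) \<longlonglongrightarrow> t - 0" by (intro tendsto_diff tendsto_const LIMSEQ_inverse_real_of_nat)
  then have "(\<lambda>n. t - inverse (real (Suc n))) \<longlonglongrightarrow> t" by simp
  then have \<sigma>t: "\<sigma> \<longlonglongrightarrow> t"
  proof (rule real_tendsto_sandwich[rotated 2])
    show "\<forall>\<^sub>F n in sequentially. t - inverse (real (Suc n)) \<le> \<sigma> n"
      using \<sigma>(2) by (intro always_eventually allI) (simp only: inverse_eq_divide less_imp_le)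
    show "\<forall>\<^sub>F n in sequentially. \<sigma> n \<le> t" using \<sigma>le by (intro always_eventually allI)
  qed (rule tendsto_const)
  have \<sigma>0: "s0 \<le> \<sigma> n" for n using \<sigma>(1)[of n] by (simp add: S_def)
  obtain \<phi> where P: "\<And>n. P (\<sigma> n) (\<phi> n)" and \<phi>1: "\<And>n x. \<phi> n x \<le> 1" and "\<And>n. \<exists>x\<in>cbox 0 1. \<phi> n x = 1"
    using normalize[OF \<sigma>(1)] by metis
  then obtain y where y: "\<And>n. y n \<in> cbox 0 1" "\<And>n. \<phi> n (y n) = 1" by metis
  have \<phi>C: "\<phi> n \<in> C_per" and \<phi>nn: "0 \<le> \<phi> n x" and \<phi>sub: "(\<alpha> x + \<sigma> n * \<beta> x) * \<phi> n x \<le> conv K (\<phi> n) x" for n x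
    using P unfolding P_def by auto
  have \<phi>m: "\<phi> n \<in> borel_measurable borel" for n using \<phi>C by (rule C_per_measurable)
  have \<phi>abs: "\<bar>\<phi> n x\<bar> \<le> 1" for n x using \<phi>nn \<phi>1 by (simp add: abs_le_iff)
  \<comment> \<open>The subsolutions themselves need not have a convergent subsequence; their
    convolutions are equicontinuous and do.\<close>
  define \<kappa> where "\<kappa> n = conv K (\<phi> n)" for n
  have \<kappa>I: "\<bar>\<kappa> n x\<bar> \<le> I" for n x
    using conv_bound[OF \<phi>abs \<phi>m, of n x] by (simp add: \<kappa>_def I_def)
  have \<kappa>0: "0 \<le> \<kappa> n x" for n x unfolding \<kappa>_def using \<phi>nn by (intro conv_nonneg)
  obtain g k where g: "strict_mono (k :: nat \<Rightarrow> nat)"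
    "\<And>e. 0 < e \<Longrightarrow> \<exists>N. \<forall>n x. n \<ge> N \<and> x \<in> cbox 0 1 \<longrightarrow> norm(\<kappa>(k n) x - g x) < e"
  proof (rule Arzela_Ascoli[of "cbox (0::real^'n) 1" \<kappa> I])
    show "norm (\<kappa> n x) \<le> I" for n x using \<kappa>I by simp
    fix x :: "real^'n" and e :: real assume "0 < e"
    then obtain d where "0 < d" "\<And>v x x'. \<lbrakk>v \<in> borel_measurable borel; \<And>y. \<bar>v y\<bar> \<le> 1; dist x x' < d\<rbrakk> \<Longrightarrow> \<bar>conv K v x - conv K v x'\<bar> < e"
      using conv_equicontinuous[where C=1] by metis
    then show "\<exists>d>0. \<forall>n y. y \<in> cbox 0 1 \<and> norm (x - y) < d \<longrightarrow> norm (\<kappa> n x - \<kappa> n y) < e"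
      using \<phi>m \<phi>abs unfolding \<kappa>_def by (metis dist_norm real_norm_def)
  qed auto
  have \<kappa>per: "periodic (\<kappa> n)" for n unfolding \<kappa>_def by (intro conv_periodic C_perD \<phi>C)
  have glim: "(\<lambda>n. \<kappa> (k n) x) \<longlonglongrightarrow> g x" if "x \<in> cbox 0 1" for x
    unfolding LIMSEQ_iff using g(2) that by blast
  have "convergent (\<lambda>n. \<kappa> (k n) x)" for x
  proof -
    obtain l where l: "\<And>i. l $ i \<in> \<int>" "x + l \<in> cbox 0 1" using lattice_translate_unit_cube by blast
    then have "\<kappa> n (x + l) = \<kappa> n x" for n using \<kappa>per periodicD by blast
    then show ?thesis using glim[OF l(2)] unfolding convergent_def by auto
  qed
  then obtain \<kappa>' where \<kappa>': "\<And>x. (\<lambda>n. \<kappa> (k n) x) \<longlonglongrightarrow> \<kappa>' x" unfolding convergent_def by metis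
  have \<kappa>'C: "\<kappa>' \<in> C_per"
    unfolding C_per_def mem_Collect_eq
  proof
    show "continuous_on UNIV \<kappa>'"
      unfolding continuous_on_iff dist_real_def
    proof (intro ballI allI impI)
      fix x :: "real^'n" and e :: real assume "0 < e"
      then have "0 < e/2" by simp
      then obtain d where d: "0 < d" "\<And>v x x'. \<lbrakk>v \<in> borel_measurable borel; \<And>y. \<bar>v y\<bar> \<le> 1; dist x x' < d\<rbrakk> \<Longrightarrow> \<bar>conv K v x - conv K v x'\<bar> < e/2"
        using conv_equicontinuous[where C=1] by metis
      have "\<bar>\<kappa>' x' - \<kappa>' x\<bar> < e" if "dist x' x < d" for x'
      proof -
        have "(\<lambda>n. \<bar>\<kappa> (k n) x' - \<kappa> (k n) x\<bar>) \<longlonglongrightarrow> \<bar>\<kappa>' x' - \<kappa>' x\<bar>" by (intro tendsto_intros \<kappa>')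
        moreover have "\<bar>\<kappa> (k n) x' - \<kappa> (k n) x\<bar> \<le> e/2" for n
          using d(2)[OF \<phi>m \<phi>abs that, of "k n"] by (simp add: \<kappa>_def)
        ultimately have "\<bar>\<kappa>' x' - \<kappa>' x\<bar> \<le> e/2" by (intro LIMSEQ_le_const2) auto
        then show ?thesis using \<open>0 < e\<close> by simp
      qed
      then show "\<exists>d>0. \<forall>x'\<in>UNIV. dist x' x < d \<longrightarrow> \<bar>\<kappa>' x' - \<kappa>' x\<bar> < e" using d(1) by blast
    qed
    show "periodic \<kappa>'"
      unfolding periodic_def
    proof (intro allI impI)
      fix x l :: "real^'n" assume "\<forall>i. l $ i \<in> \<int>"
      then have "\<kappa> n (x + l) = \<kappa> n x" for n using \<kappa>per periodicD by blast
      then show "\<kappa>' (x + l) = \<kappa>' x" using \<kappa>'[of x] \<kappa>'[of "x + l"] LIMSEQ_unique by simp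
    qed
  qed
  have \<kappa>'0: "0 \<le> \<kappa>' x" for x using \<kappa>'[of x] \<kappa>0 by (intro LIMSEQ_le_const[OF \<kappa>']) auto
  \<comment> \<open>The limit is not zero: at the point of the unit cube where
    \<open>\<phi> n\<close> equals 1, the subsolution inequality gives \<kappa> n \<ge> m0, and
    convergence is uniform on the cube.\<close>
  have "\<exists>x. 0 < \<kappa>' x"
  proof -
    obtain N where "\<forall>n x. n \<ge> N \<and> x \<in> cbox 0 1 \<longrightarrow> norm(\<kappa>(k n) x - g x) < m0" using g(2)[OF m0(1)] by blast
    then have *: "\<bar>\<kappa> (k N) (y (k N)) - g (y (k N))\<bar> < m0" using y by auto
    have "m0 \<le> \<kappa> (k N) (y (k N))"
      using \<phi>sub[where x="y (k N)" and n="k N"] bm[where s="\<sigma> (k N)" and x="y (k N)", OF \<sigma>0] y(2)[of "k N"] by (simp add: \<kappa>_def)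
    then have "0 < g (y (k N))" using * by (simp add: abs_less_iff)
    moreover have "g (y (k N)) = \<kappa>' (y (k N))" using glim[OF y(1)] \<kappa>' LIMSEQ_unique by blast
    ultimately show ?thesis by auto
  qed
  then obtain x2 where x2: "0 < \<kappa>' x2" ..
  define b where "b x = \<alpha> x + t * \<beta> x" for x
  have bC': "b \<in> C_per" unfolding b_def by (rule bC)
  have bpos: "0 < b x" and bm0: "m0 \<le> b x" for x unfolding b_def using bm[OF t0, of x] m0(1) by auto
  \<comment> \<open>Convolution divided by weight is the candidate. Along the sequence,
    \<open>\<psi>n\<close> dominates \<open>\<phi>\<close>, so its convolution dominates
    \<open>\<kappa>\<close>; in the limit this is the subsolution inequality for \<psi>.\<close>
  define \<psi> where "\<psi> x = \<kappa>' x / b x" for x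
  have \<psi>C: "\<psi> \<in> C_per" unfolding \<psi>_def using bpos by (intro C_per_intros \<kappa>'C bC') (simp add: less_imp_neq[THEN not_sym])
  have \<psi>0: "0 \<le> \<psi> x" for x unfolding \<psi>_def using \<kappa>'0 bpos by (simp add: less_imp_le)
  have \<psi>2: "0 < \<psi> x2" unfolding \<psi>_def using x2 bpos by simp
  define \<psi>n where "\<psi>n n x = \<kappa> n x / (\<alpha> x + \<sigma> n * \<beta> x)" for n x
  have \<psi>nC: "\<psi>n n \<in> C_per" for n
    unfolding \<psi>n_def
  proof (rule C_per_intros(4)[OF _ bC])
    show "\<kappa> n \<in> C_per" unfolding \<kappa>_def by (intro conv_C_per \<phi>C)
    show "\<alpha> x + \<sigma> n * \<beta> x \<noteq> 0" for x using bm[where s="\<sigma> n" and x=x, OF \<sigma>0] m0(1) by linarith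
  qed
  have \<psi>nI: "\<bar>\<psi>n n x\<bar> \<le> I / m0" for n x
    unfolding \<psi>n_def abs_divide using \<kappa>I[of n x] bm[where s="\<sigma> n" and x=x, OF \<sigma>0] m0(1) I0 by (intro frac_le) auto
  have \<phi>\<psi>n: "\<phi> n x \<le> \<psi>n n x" for n x
  proof -
    have "0 < \<alpha> x + \<sigma> n * \<beta> x" using bm[where s="\<sigma> n" and x=x, OF \<sigma>0] m0(1) by linarith
    then show ?thesis unfolding \<psi>n_def \<kappa>_def using \<phi>sub[where x=x and n=n] by (simp add: pos_le_divide_eq mult.commute)
  qed
  have sub: "b x * \<psi> x \<le> conv K \<psi> x" for x
  proof -
    have "\<kappa> n x \<le> conv K (\<psi>n n) x" for n
      unfolding \<kappa>_def
      by (rule conv_mono[where C="max 1 (I/m0)"]) (use \<phi>m C_per_measurable[OF \<psi>nC] \<phi>abs \<psi>nI \<phi>\<psi>n in \<open>auto simp: le_max_iff_disj\<close>)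
    moreover have "(\<lambda>n. conv K (\<psi>n (k n)) x) \<longlonglongrightarrow> conv K \<psi> x"
    proof (rule conv_tendsto)
      show "(\<lambda>i. \<psi>n (k i) y) \<longlonglongrightarrow> \<psi> y" for y
        unfolding \<psi>n_def \<psi>_def b_def
      proof (intro tendsto_divide \<kappa>' tendsto_add tendsto_mult tendsto_const)
        show "(\<lambda>i. \<sigma> (k i)) \<longlonglongrightarrow> t" using LIMSEQ_subseq_LIMSEQ[OF \<sigma>t g(1)] by (simp add: o_def)
        show "\<alpha> y + t * \<beta> y \<noteq> 0" using bpos[of y] by (simp add: b_def)
      qed
    qed (use C_per_measurable[OF \<psi>nC] \<psi>nI in auto)
    ultimately have "\<kappa>' x \<le> conv K \<psi> x" using \<kappa>'[of x] by (intro LIMSEQ_le) auto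
    then show ?thesis unfolding \<psi>_def using bpos[of x] by simp
  qed
  have eq: "conv K \<psi> x = b x * \<psi> x" for x
  proof (rule ccontr)
    assume "conv K \<psi> x \<noteq> b x * \<psi> x"
    then have lt: "b x * \<psi> x < conv K \<psi> x" using sub[of x] by linarith
    \<comment> \<open>The defect of equality, divided by b. By linearity the iterates of
      \<open>lazy b\<close> can be moved from the defect to \<psi>, so the inequality for the
      iterated function is strict by a uniform amount \<open>\<delta>\<close>.\<close>
    define w where "w x = lazy b \<psi> x - 2 * \<psi> x" for x
    have wC: "w \<in> C_per" unfolding w_def by (intro C_per_intros C_per_cmult lazy_C_per bC' bpos \<psi>C)
    have w_eq: "w x = (conv K \<psi> x - b x * \<psi> x) / b x" for x 
      using bpos[of x] by (simp add: w_def lazy_def field_simps)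
    have w0: "0 \<le> w x" for x unfolding w_eq using sub[of x] bpos[of x] by simp
    have wx: "0 < w x" unfolding w_eq using lt bpos[of x] by simp
    obtain m where m: "\<And>x. 0 < (lazy b ^^ m) w x" using lazy_pow_pos[OF bC' bpos wC w0 wx] by blast
    obtain \<delta> where \<delta>: "0 < \<delta>" "\<And>x. \<delta> \<le> (lazy b ^^ m) w x"
      using C_per_pos_bounds[OF lazy_pow_C_per[OF bC' bpos wC] m] by metis
    define \<xi> where "\<xi> = (lazy b ^^ m) \<psi>"
    have \<xi>C: "\<xi> \<in> C_per" unfolding \<xi>_def by (intro lazy_pow_C_per bC' bpos \<psi>C)
    have \<xi>0: "0 \<le> \<xi> x" for x unfolding \<xi>_def by (intro lazy_pow_nonneg bpos \<psi>0)
    have "(lazy b ^^ m) w = (\<lambda>x. (lazy b ^^ m) (lazy b \<psi>) x - 2 * (lazy b ^^ m) \<psi> x)"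
      unfolding w_def[abs_def] by (intro lazy_pow_lin bC' bpos lazy_C_per \<psi>C)
    then have "(lazy b ^^ m) w x = lazy b \<xi> x - 2 * \<xi> x" for x
      unfolding \<xi>_def by (simp add: funpow_swap1)
    then have *: "\<delta> \<le> conv K \<xi> x / b x - \<xi> x" for x using \<delta>(2)[of x] by (simp add: lazy_def)
    have **: "b x * \<xi> x + \<delta> * b x \<le> conv K \<xi> x" for x
      using *[of x] bpos[of x] by (simp add: field_simps)
    obtain X where X: "0 < X" "\<And>x. \<bar>\<xi> x\<bar> \<le> X" using C_per_bounded[OF \<xi>C] by blast
    \<comment> \<open>Raising s by \<open>d\<close> costs at most d \<beta>M X = \<delta> m0 \<le>
      \<delta> b, which the strict inequality can pay.\<close>
    define d where "d = \<delta> * m0 / (\<beta>M * X)"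
    have d: "0 < d" using \<delta> m0 \<beta>m X by (simp add: d_def)
    have "P (t + d) \<xi>"
      unfolding P_def
    proof (intro conjI allI \<xi>C \<xi>0)
      show "\<exists>x. 0 < \<xi> x"
      proof (rule ccontr)
        assume "\<not> (\<exists>x. 0 < \<xi> x)"
        then have "\<xi> = (\<lambda>x. 0)" using \<xi>0 by (auto simp: fun_eq_iff not_less intro: antisym)
        then have "conv K \<xi> x = 0" "\<xi> x = 0" by (simp_all add: conv_def)
        then show False using **[of x] \<delta> bpos[of x] mult_pos_pos[OF \<delta>(1) bpos[of x]] by simp
      qed
      fix x
      have "d * (\<beta> x * \<xi> x) \<le> d * (\<beta>M * X)"
        using d \<beta>m \<beta>0[of x] X(2)[of x] \<xi>0[of x] by (intro mult_left_mono mult_mono) (auto simp: less_imp_le)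
      also have "\<dots> = \<delta> * m0" using \<beta>m X by (simp add: d_def)
      also have "\<dots> \<le> \<delta> * b x" using \<delta> bm0 by (intro mult_left_mono) auto
      finally show "(\<alpha> x + (t + d) * \<beta> x) * \<xi> x \<le> conv K \<xi> x"
        using **[of x] by (simp add: b_def algebra_simps)
    qed
    then have "t + d \<in> S" using t0 d unfolding S_def by auto
    then have "t + d \<le> t" unfolding t_def by (intro cSup_upper bdd)
    then show False using d by simp
  qed
  \<comment> \<open>Equality turns the iterates of \<open>lazy\<close> into multiples of \<psi>, so
    their positivity is that of \<psi>.\<close>
  have pow: "(lazy b ^^ m) \<psi> = (\<lambda>x. 2 ^ m * \<psi> x)" for m
  proof (induction m)
    case (Suc m)
    have "lazy b (\<lambda>x. 2 ^ m * \<psi> x) x = 2 ^ Suc m * \<psi> x" for x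
      using bpos[of x] by (simp add: lazy_def conv_cmult eq)
    then have "lazy b (\<lambda>x. 2 ^ m * \<psi> x) = (\<lambda>x. 2 ^ Suc m * \<psi> x)" by (intro ext)
    then show ?case by (simp only: funpow.simps o_apply Suc)
  qed simp
  obtain m where "\<And>x. 0 < (lazy b ^^ m) \<psi> x" using lazy_pow_pos[OF bC' bpos \<psi>C \<psi>0 \<psi>2] by blast
  then have "0 < \<psi> x" for x unfolding pow by (simp add: zero_less_mult_iff)
  then show ?thesis using that[of t \<psi>] t0 \<psi>C eq unfolding b_def by blast
qed

end

subsection \<open>Comparison of principal eigenvalues\<close>

context bump
begin

text \<open>If \<open>\<kappa>\<close> is the best constant in \<kappa> \<phi> \<le> \<theta>,
  convolving and dividing by F > 0 gives \<kappa> (1 + \<delta>) \<phi> \<le> \<theta>. The uniform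
  factor replaces a touching point, so that measurable functions can be compared;
  \<open>wave_speed_bound\<close> applies this to a geometric mean known only to be
  measurable.\<close>

lemma conv_compare:
  assumes [measurable]: "\<theta> \<in> borel_measurable borel" "\<phi> \<in> borel_measurable borel"
    and \<theta>: "0 < m" "\<And>x. m \<le> \<theta> x" "\<And>x. \<theta> x \<le> M" and \<phi>: "\<And>x. 0 < \<phi> x" "\<And>x. \<phi> x \<le> M'"
    and sup: "\<And>x. conv K \<theta> x \<le> F x * \<theta> x" and sub: "\<And>x. G x * \<phi> x \<le> conv K \<phi> x"
    and \<delta>: "0 < \<delta>" "\<And>x. (1 + \<delta>) * F x \<le> G x"
  shows False
proof -
  obtain \<kappa> where \<kappa>: "0 < \<kappa>" "\<And>x. \<kappa> * \<phi> x \<le> \<theta> x" "\<And>\<kappa>'. (\<And>x. \<kappa>' * \<phi> x \<le> \<theta> x) \<Longrightarrow> \<kappa>' \<le> \<kappa>"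
    using ratio_infimum[of m \<theta> \<phi> M'] \<theta> \<phi> by metis
  have \<theta>0: "0 < \<theta> x" for x using \<theta>(1) \<theta>(2)[of x] by linarith
  have "\<kappa> * (1 + \<delta>) * \<phi> x \<le> \<theta> x" for x
  proof -
    have "0 < conv K \<theta> x"
      by (rule conv_pos'[where C=M]) (use \<theta> \<theta>0 in \<open>auto simp: abs_of_pos\<close>)
    \<comment> \<open>Positivity of \<open>F\<close> is forced, as the left side of the
      supersolution inequality is positive.\<close>
    then have F: "0 < F x" using sup[of x] \<theta>0[of x] by (metis less_le_trans zero_less_mult_pos2)
    have "F x * (\<kappa> * (1 + \<delta>) * \<phi> x) = \<kappa> * ((1 + \<delta>) * F x * \<phi> x)" by simp
    also have "\<dots> \<le> \<kappa> * (G x * \<phi> x)"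
      using \<delta>(2)[of x] \<kappa>(1) \<phi>(1)[of x] by (intro mult_left_mono mult_right_mono) auto
    also have "\<dots> \<le> \<kappa> * conv K \<phi> x" using sub[of x] \<kappa>(1) by (intro mult_left_mono) auto
    also have "\<dots> = conv K (\<lambda>y. \<kappa> * \<phi> y) x" by (simp add: conv_cmult)
    also have "\<dots> \<le> conv K \<theta> x"
    proof (rule conv_mono[where C="max M (\<kappa> * M')"])
      fix y
      show "\<bar>\<kappa> * \<phi> y\<bar> \<le> max M (\<kappa> * M')" using \<phi>[of y] \<kappa>(1) by (simp add: abs_of_pos le_max_iff_disj)
      show "\<bar>\<theta> y\<bar> \<le> max M (\<kappa> * M')" using \<theta>0[of y] \<theta>(3)[of y] by (simp add: abs_of_pos le_max_iff_disj)
    qed (use \<kappa> in auto)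
    also have "\<dots> \<le> F x * \<theta> x" by (rule sup)
    finally show ?thesis using F by (simp add: mult_le_cancel_left_pos)
  qed
  then have "\<kappa> * (1 + \<delta>) \<le> \<kappa>" by (rule \<kappa>(3))
  then show False using mult_pos_pos[OF \<kappa>(1) \<delta>(1)] by (simp add: distrib_left)
qed

definition eigen :: "(real^'n \<Rightarrow> real) \<Rightarrow> real \<Rightarrow> (real^'n \<Rightarrow> real) \<Rightarrow> bool" where
  "eigen a \<nu> \<phi> \<longleftrightarrow> \<phi> \<in> C_per \<and> (\<forall>x. 0 < \<phi> x) \<and> (\<forall>x. conv K \<phi> x = (\<nu> - a x) * \<phi> x)"

lemma eigen_gap_pos:
  assumes "eigen a \<nu> \<phi>"
  shows "0 < \<nu> - a x"
proof -
  have *: "\<phi> \<in> C_per" "\<And>x. 0 < \<phi> x" "conv K \<phi> x = (\<nu> - a x) * \<phi> x" using assms by (auto simp: eigen_def)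
  obtain C where "\<And>x. \<bar>\<phi> x\<bar> \<le> C" using C_per_bounded[OF *(1)] by blast
  then have "0 < conv K \<phi> x" using conv_pos'[OF C_per_measurable[OF *(1)]] *(2) by blast
  then show ?thesis using * by (metis zero_less_mult_pos2)
qed

lemma eigen_le_of_supersolution:
  assumes "eigen a \<nu> \<phi>" "a \<in> C_per" "\<theta> \<in> borel_measurable borel" "0 < m" "\<And>x. m \<le> \<theta> x" "\<And>x. \<theta> x \<le> M"
    "\<And>x. conv K \<theta> x \<le> (\<nu>' - a x) * \<theta> x"
  shows "\<nu> \<le> \<nu>'"
proof (rule ccontr)
  assume lt: "\<not> \<nu> \<le> \<nu>'"
  have *: "\<phi> \<in> C_per" "\<And>x. 0 < \<phi> x" "\<And>x. conv K \<phi> x = (\<nu> - a x) * \<phi> x" using assms by (auto simp: eigen_def)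
  obtain M' where M': "\<And>x. \<phi> x \<le> M'" using C_per_pos_bounds[OF *(1,2)] by metis
  obtain A where A: "0 < A" "\<And>x. \<bar>a x\<bar> \<le> A" using C_per_bounded[OF assms(2)] by blast
  \<comment> \<open>A bound for the weight \<nu>' - a turns the additive gap \<nu> - \<nu>' into the
    multiplicative one that \<open>conv_compare\<close> requires.\<close>
  define B where "B = \<bar>\<nu>'\<bar> + A"
  have B: "0 < B" "\<And>x. \<nu>' - a x \<le> B"
    using A(1) A(2) by (auto simp: B_def abs_le_iff) (metis abs_ge_self add_mono diff_conv_add_uminus)
  show False
  proof (rule conv_compare[OF assms(3) C_per_measurable[OF *(1)] assms(4-6) *(2) M' assms(7)])
    show "(\<nu> - a x) * \<phi> x \<le> conv K \<phi> x" for x using * by simp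
    show "0 < (\<nu> - \<nu>') / B" using lt B by simp
    show "(1 + (\<nu> - \<nu>') / B) * (\<nu>' - a x) \<le> \<nu> - a x" for x
    proof -
      have "(\<nu> - \<nu>') / B * (\<nu>' - a x) \<le> (\<nu> - \<nu>') / B * B" using lt B by (intro mult_left_mono) auto
      then show ?thesis using B(1) by (simp add: distrib_right)
    qed
  qed
qed

lemma eigen_ge_of_subsolution:
  assumes "eigen a \<nu> \<phi>" "a \<in> C_per" "\<theta> \<in> borel_measurable borel" "\<And>x. 0 < \<theta> x" "\<And>x. \<theta> x \<le> M"
    "\<And>x. (\<nu>' - a x) * \<theta> x \<le> conv K \<theta> x"
  shows "\<nu>' \<le> \<nu>"
proof (rule ccontr)
  assume lt: "\<not> \<nu>' \<le> \<nu>"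
  have *: "\<phi> \<in> C_per" "\<And>x. 0 < \<phi> x" "\<And>x. conv K \<phi> x = (\<nu> - a x) * \<phi> x" using assms by (auto simp: eigen_def)
  obtain m' M' where M': "0 < m'" "\<And>x. m' \<le> \<phi> x" "\<And>x. \<phi> x \<le> M'" using C_per_pos_bounds[OF *(1,2)] by metis
  obtain A where A: "0 < A" "\<And>x. \<bar>a x\<bar> \<le> A" using C_per_bounded[OF assms(2)] by blast
  define B where "B = \<bar>\<nu>\<bar> + A"
  have B: "0 < B" "\<And>x. \<nu> - a x \<le> B"
    using A(1) A(2) by (auto simp: B_def abs_le_iff) (metis abs_ge_self add_mono diff_conv_add_uminus)
  show False
  proof (rule conv_compare[OF C_per_measurable[OF *(1)] assms(3) M' assms(4,5) _ assms(6)])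
    show "conv K \<phi> x \<le> (\<nu> - a x) * \<phi> x" for x using * by simp
    show "0 < (\<nu>' - \<nu>) / B" using lt B by simp
    show "(1 + (\<nu>' - \<nu>) / B) * (\<nu> - a x) \<le> \<nu>' - a x" for x
    proof -
      have "(\<nu>' - \<nu>) / B * (\<nu> - a x) \<le> (\<nu>' - \<nu>) / B * B" using lt B by (intro mult_left_mono) auto
      then show ?thesis using B(1) by (simp add: distrib_right)
    qed
  qed
qed

lemma eigen_unique:
  assumes "eigen a \<nu> \<phi>" "eigen a \<nu>' \<phi>'" "a \<in> C_per"
  shows "\<nu> = \<nu>'"
proof (rule antisym)
  have *: "\<phi>' \<in> C_per" "\<And>x. 0 < \<phi>' x" "\<And>x. conv K \<phi>' x = (\<nu>' - a x) * \<phi>' x" using assms by (auto simp: eigen_def)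
  obtain m' M' where M': "0 < m'" "\<And>x. m' \<le> \<phi>' x" "\<And>x. \<phi>' x \<le> M'" using C_per_pos_bounds[OF *(1,2)] by metis
  show "\<nu> \<le> \<nu>'" by (rule eigen_le_of_supersolution[OF assms(1,3) C_per_measurable[OF *(1)] M']) (use * in auto)
  show "\<nu>' \<le> \<nu>" by (rule eigen_ge_of_subsolution[OF assms(1,3) C_per_measurable[OF *(1)] *(2) M'(3)]) (use * in auto)
qed

lemma nn_integral_conv:
  assumes [measurable]: "v \<in> borel_measurable borel" and "\<And>y. 0 \<le> v y" "\<And>y. v y \<le> C" "0 \<le> c"
  shows "(\<integral>\<^sup>+ y. ennreal (c * (K (x - y) * v y)) \<partial>lborel) = ennreal (c * conv K v x)"
proof -
  have "integrable lborel (\<lambda>y. K (x - y) * v y)"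
    using lborel_integrable_reflect[OF integrable_conv'[OF assms(1), of C x], of x] assms by simp
  then have "(\<integral>\<^sup>+ y. ennreal (c * (K (x - y) * v y)) \<partial>lborel) = ennreal (LINT y|lborel. c * (K (x - y) * v y))"
    using assms K_nonneg by (intro nn_integral_eq_integral) (auto intro!: always_eventually)
  then show ?thesis by (simp add: conv_def)
qed

end

text \<open>Stands in for integration over a period cell. The integral of \<open>G\<close> over the
  ball of radius n is of order n^N, with N the dimension, while the shell up to radius n + 1
  contributes only order n^(N-1); growth by a fixed factor q > 1 at every step is therefore
  impossible.\<close>

lemma ball_integral_growth:
  fixes G :: "'a::euclidean_space \<Rightarrow> real"
  assumes [measurable]: "G \<in> borel_measurable borel" and G: "0 < gm" "\<And>x. gm \<le> G x" "\<And>x. G x \<le> gM" and q: "1 < q"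
    and le: "\<And>n::nat. q * (LINT x|lborel. indicator (cball 0 (real n)) x * G x) 
       \<le> (LINT x|lborel. indicator (cball 0 (real n + 1)) x * G x)"
  shows False
proof -
  define N where "N = DIM('a)"
  define V where "V = unit_ball_vol (real N)"
  have V: "0 < V" by (simp add: V_def)
  have cont: "measure lborel (cball (0::'a) r) = V * r ^ N" if "0 \<le> r" for r
    using that by (simp add: content_cball V_def N_def)
  have G0: "0 < G x" for x using G(1) G(2)[of x] by linarith
  have gM: "0 < gM" using G0[of 0] G(3)[of 0] by linarith
  have int: "integrable lborel (\<lambda>x. indicator (cball 0 r) x * G x)" for r :: real
    by (rule Bochner_Integration.integrable_bound[OF integrable_indicator_cball[of 0 r gM]])
       (use G0 gM G in \<open>auto intro!: always_eventually simp: indicator_def less_imp_le\<close>)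
  \<comment> \<open>The shell estimate divided by the N-th power of the radius; the right side tends
    to 0.\<close>
  have "(q - 1) * (gm * V) / gM \<le> V * ((1 + 1 / real (Suc k)) ^ N - 1)" for k
  proof -
    define n where "n = Suc k"
    have n: "0 < real n" by (simp add: n_def)
    let ?I = "\<lambda>r. LINT x|lborel. indicator (cball 0 r) x * G x"
    have "gm * (V * n ^ N) = (LINT x|lborel. indicator (cball (0::'a) n) x * gm)"
      using cont[of "real n"] n by simp
    also have "\<dots> \<le> ?I n"
      by (intro integral_mono integrable_indicator_cball int) (use G in \<open>auto simp: indicator_def\<close>)
    finally have "(q - 1) * (gm * (V * n ^ N)) \<le> (q - 1) * ?I n" using q by (intro mult_left_mono) auto
    also have "\<dots> \<le> ?I (n + 1) - ?I n" using le[of n] by (simp add: algebra_simps)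
    also have "\<dots> = (LINT x|lborel. indicator (cball 0 (real n + 1)) x * G x - indicator (cball 0 n) x * G x)"
      using int by (simp add: add.commute)
    also have "\<dots> \<le> (LINT x|lborel. indicator (cball (0::'a) (real n + 1)) x * gM - indicator (cball 0 n) x * gM)"
      by (intro integral_mono Bochner_Integration.integrable_diff integrable_indicator_cball int)
         (use G in \<open>auto simp: indicator_def dist_norm intro: order_trans\<close>)
    also have "\<dots> = gM * (V * (real n + 1) ^ N - V * n ^ N)"
      using cont[of "real n"] cont[of "real n + 1"] n integrable_indicator_cball[of "0::'a" "real n" gM]
        integrable_indicator_cball[of "0::'a" "real n + 1" gM]
      by (simp add: algebra_simps)
    finally have *: "(q - 1) * (gm * (V * n ^ N)) \<le> gM * (V * (real n + 1) ^ N - V * n ^ N)" .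
    have "real n + 1 = real n * (1 + 1 / n)" using n by (simp add: distrib_left)
    then have e: "(real n + 1) ^ N = real n ^ N * (1 + 1 / n) ^ N"
      by (metis power_mult_distrib)
    have "n ^ N * ((q - 1) * (gm * V)) \<le> n ^ N * (gM * (V * ((1 + 1 / n) ^ N - 1)))"
      using * unfolding e by (simp only: right_diff_distrib mult_1_right) (simp only: mult_ac of_nat_power)
    then have "(q - 1) * (gm * V) \<le> gM * (V * ((1 + 1 / n) ^ N - 1))"
      using n by (subst (asm) mult_le_cancel_left_pos) auto
    moreover have "0 < gM" using G(1) G(2)[of 0] G(3)[of 0] by linarith
    ultimately show ?thesis by (simp add: n_def pos_divide_le_eq mult.commute del: of_nat_Suc)
  qed
  moreover have "(\<lambda>k. V * ((1 + 1 / real (Suc k)) ^ N - 1)) \<longlonglongrightarrow> V * ((1 + 0) ^ N - 1)"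
    using LIMSEQ_inverse_real_of_nat by (intro tendsto_intros) (simp add: inverse_eq_divide)
  ultimately have "(q - 1) * (gm * V) / gM \<le> V * ((1 + 0) ^ N - 1)"
    by (intro LIMSEQ_le_const) auto
  moreover have "0 < gM" using G(1) G(2)[of 0] G(3)[of 0] by linarith
  then have "0 < (q - 1) * (gm * V) / gM" using q G V by simp
  ultimately show False by simp
qed

subsection \<open>Exponentially tilted kernels\<close>

locale tilted =
  fixes J :: "real^'n \<Rightarrow> real" and e :: "real^'n"
  assumes J: "kernel_assms J" and e: "norm e = 1"
begin

abbreviation Jt :: "real \<Rightarrow> real^'n \<Rightarrow> real" where "Jt \<equiv> tilted_kernel J e"

lemma J_supp: "1 < norm x \<Longrightarrow> J x = 0"
proof (rule ccontr)
  assume "1 < norm x" "J x \<noteq> 0"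
  then have "x \<in> closure {x. J x \<noteq> 0}" using closure_subset[of "{x. J x \<noteq> 0}"] by auto
  moreover have "closure {x. J x \<noteq> 0} \<subseteq> cball 0 1" using J by (simp add: kernel_assms_def)
  ultimately show False using \<open>1 < norm x\<close> by auto
qed

lemma J_nonneg: "0 \<le> J x" and J_sym: "J (- x) = J x" and J_int: "(LINT x|lborel. J x) = 1"
  using J unfolding kernel_assms_def by auto

lemma inner_e_bound: "norm z \<le> 1 \<Longrightarrow> \<bar>z \<bullet> e\<bar> \<le> 1"
  using Cauchy_Schwarz_ineq2[of z e] e by simp

lemma J_sym': "J (x - y) = J (y - x)" using J_sym[of "y - x"] by simp

lemma J_cont: "continuous_on UNIV J"
  using J unfolding kernel_assms_def smooth_def by (metis Ck_on.simps(1))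

sublocale bump J
  using J J_cont J_supp unfolding kernel_assms_def by unfold_locales auto

sublocale tk: bump "Jt l" for l
proof
  show "continuous_on UNIV (Jt l)" unfolding tilted_kernel_def[abs_def] by (intro continuous_intros J_cont)
qed (use K_0 J_supp J_nonneg in \<open>auto simp: tilted_kernel_def\<close>)

text \<open>Convolution with \<open>Jt (- l)\<close> is thus the adjoint of convolution with
  \<open>Jt l\<close>; the sign changes because \<open>J\<close> is even and the exponential is
  not.\<close>

lemma Jt_sym: "Jt l (x - y) = Jt (- l) (y - x)"
  using J_sym'[of x y] by (simp add: tilted_kernel_def algebra_simps)

text \<open>Fubini with the adjoint kernel; the ball grows by 1, the range of the kernel.
  Nonnegative integrals keep Fubini free of integrability conditions.\<close>

lemma tilted_adjoint_le:
  assumes [measurable]: "\<phi> \<in> borel_measurable borel" "\<psi> \<in> borel_measurable borel"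
    and \<phi>: "\<And>x. 0 \<le> \<phi> x" "\<And>x. \<phi> x \<le> C" and \<psi>: "\<And>x. 0 \<le> \<psi> x" "\<And>x. \<psi> x \<le> C"
  shows "(\<integral>\<^sup>+ x. ennreal (indicator (cball 0 r) x * \<phi> x * conv (Jt l) \<psi> x) \<partial>lborel)
    \<le> (\<integral>\<^sup>+ x. ennreal (indicator (cball 0 (r + 1)) x * \<psi> x * conv (Jt (- l)) \<phi> x) \<partial>lborel)"
proof -
  note [measurable] = tk.K_measurable
  have [measurable]: "cball (0::real^'n) (r + 1) \<in> sets borel" by simp
  have "(\<integral>\<^sup>+ x. ennreal (indicator (cball 0 r) x * \<phi> x * conv (Jt l) \<psi> x) \<partial>lborel)
    = (\<integral>\<^sup>+ x. \<integral>\<^sup>+ y. ennreal (indicator (cball 0 r) x * \<phi> x * (Jt l (x - y) * \<psi> y)) \<partial>lborel \<partial>lborel)"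
    using \<phi> \<psi> by (intro nn_integral_cong tk.nn_integral_conv[symmetric]) auto
  also have "\<dots> \<le> (\<integral>\<^sup>+ x. \<integral>\<^sup>+ y. ennreal (indicator (cball 0 (r + 1)) y * \<psi> y * (Jt (- l) (y - x) * \<phi> x)) \<partial>lborel \<partial>lborel)"
  proof (intro nn_integral_mono ennreal_leI)
    fix x y
    show "indicator (cball 0 r) x * \<phi> x * (Jt l (x - y) * \<psi> y) \<le> indicator (cball 0 (r + 1)) y * \<psi> y * (Jt (- l) (y - x) * \<phi> x)"
    proof (cases "x \<in> cball 0 r \<and> norm (x - y) \<le> 1")
      case True
      then have "y \<in> cball 0 (r + 1)" using norm_triangle_ineq2[of y x] by (simp add: norm_minus_commute)
      then show ?thesis using True by (simp add: Jt_sym[of l x y])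
    next
      case False
      then have "indicator (cball 0 r) x * \<phi> x * (Jt l (x - y) * \<psi> y) = 0" using tk.K_supp[of "x - y" l] by auto
      moreover have "0 \<le> indicator (cball 0 (r + 1)) y * \<psi> y * (Jt (- l) (y - x) * \<phi> x)"
        using \<phi>(1)[of x] \<psi>(1)[of y] tk.K_nonneg[of "- l" "y - x"] by simp
      ultimately show ?thesis by linarith
    qed
  qed
  also have "\<dots> = (\<integral>\<^sup>+ y. \<integral>\<^sup>+ x. ennreal (indicator (cball 0 (r + 1)) y * \<psi> y * (Jt (- l) (y - x) * \<phi> x)) \<partial>lborel \<partial>lborel)"
  proof (rule lborel_pair.Fubini')
    have "(\<lambda>z. ennreal (indicator (cball 0 (r + 1)) (fst z) * \<psi> (fst z) * (Jt (- l) (fst z - snd z) * \<phi> (snd z)))) 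
      \<in> borel_measurable (borel \<Otimes>\<^sub>M borel)" by measurable
    then show "(\<lambda>(y, x). ennreal (indicator (cball 0 (r + 1)) y * \<psi> y * (Jt (- l) (y - x) * \<phi> x)))
      \<in> borel_measurable (lborel \<Otimes>\<^sub>M lborel)"
      by (simp add: case_prod_beta measurable_cong_sets[OF sets_pair_measure_cong[OF sets_lborel sets_lborel] refl])
  qed
  also have "\<dots> = (\<integral>\<^sup>+ x. ennreal (indicator (cball 0 (r + 1)) x * \<psi> x * conv (Jt (- l)) \<phi> x) \<partial>lborel)"
    using \<phi> \<psi> by (intro nn_integral_cong tk.nn_integral_conv) auto
  finally show ?thesis .
qed

text \<open>Each eigenfunction is tested against the equation of the other. If \<nu> > \<nu>',
  duality makes the integral of (\<nu>' - a) \<phi> \<psi> grow by the factor \<open>q\<close>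
  whenever the radius of the ball grows by 1, which \<open>ball_integral_growth\<close>
  excludes.\<close>

lemma eigen_sym_le:
  assumes "tk.eigen l a \<nu> \<psi>" "tk.eigen (- l) a \<nu>' \<phi>" "a \<in> C_per"
  shows "\<nu> \<le> \<nu>'"
proof (rule ccontr)
  assume lt: "\<not> \<nu> \<le> \<nu>'"
  have \<psi>: "\<psi> \<in> C_per" "\<And>x. 0 < \<psi> x" "\<And>x. conv (Jt l) \<psi> x = (\<nu> - a x) * \<psi> x" using assms by (auto simp: tk.eigen_def)
  have \<phi>: "\<phi> \<in> C_per" "\<And>x. 0 < \<phi> x" "\<And>x. conv (Jt (- l)) \<phi> x = (\<nu>' - a x) * \<phi> x" using assms by (auto simp: tk.eigen_def)
  have gap: "0 < \<nu>' - a x" for x using tk.eigen_gap_pos[OF assms(2)] .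
  have gapC: "(\<lambda>x. \<nu>' - a x) \<in> C_per" using assms(3) by (intro C_per_intros) auto
  define G where "G x = (\<nu>' - a x) * (\<phi> x * \<psi> x)" for x
  have GC: "G \<in> C_per" unfolding G_def[abs_def] by (intro C_per_intros gapC \<phi> \<psi>)
  have G0: "0 < G x" for x unfolding G_def using gap \<phi> \<psi> by simp
  obtain gm gM where g: "0 < gm" "\<And>x. gm \<le> G x" "\<And>x. G x \<le> gM" using C_per_pos_bounds[OF GC G0] by metis
  obtain B where B: "0 < B" "\<And>x. \<nu>' - a x \<le> B" using C_per_pos_bounds[OF gapC gap] by metis
  obtain c1 where c1: "\<And>x. \<phi> x \<le> c1" using C_per_pos_bounds[OF \<phi>(1,2)] by metis
  obtain c2 where c2: "\<And>x. \<psi> x \<le> c2" using C_per_pos_bounds[OF \<psi>(1,2)] by metis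
  define q where "q = 1 + (\<nu> - \<nu>') / B"
  have q: "1 < q" using lt B by (simp add: q_def)
  have qle: "q * (\<nu>' - a x) \<le> \<nu> - a x" for x
  proof -
    have "(\<nu> - \<nu>') / B * (\<nu>' - a x) \<le> (\<nu> - \<nu>') / B * B" using lt B by (intro mult_left_mono) auto
    then show ?thesis using B(1) by (simp add: q_def distrib_right)
  qed
  note [measurable] = C_per_measurable[OF GC] C_per_measurable[OF \<phi>(1)] C_per_measurable[OF \<psi>(1)]
  have int: "integrable lborel (\<lambda>x. indicator (cball 0 r) x * G x)" for r :: real
    by (rule Bochner_Integration.integrable_bound[OF integrable_indicator_cball[of 0 r gM]])
       (use g G0 in \<open>auto intro!: always_eventually simp: indicator_def less_imp_le abs_of_pos intro: order_trans[OF _ abs_ge_self]\<close>)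
  have nn: "(\<integral>\<^sup>+ x. ennreal (indicator (cball 0 r) x * G x) \<partial>lborel) = ennreal (LINT x|lborel. indicator (cball 0 r) x * G x)" for r :: real
    using G0 by (intro nn_integral_eq_integral int) (auto intro!: always_eventually simp: less_imp_le)
  show False
  proof (rule ball_integral_growth[OF C_per_measurable[OF GC] g q])
    fix n :: nat
    let ?I = "\<lambda>r::real. LINT x|lborel. indicator (cball 0 r) x * G x"
    have I0: "0 \<le> ?I r" for r using G0 by (intro Bochner_Integration.integral_nonneg) (auto simp: less_imp_le)
    have "ennreal (q * ?I n) = (\<integral>\<^sup>+ x. ennreal (q * (indicator (cball 0 (real n)) x * G x)) \<partial>lborel)"
    proof (subst nn_integral_eq_integral)
      show "integrable lborel (\<lambda>x. q * (indicator (cball 0 (real n)) x * G x))" by (intro integrable_mult_right int)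
    qed (use G0 q in \<open>auto intro!: always_eventually simp: less_imp_le\<close>)
    also have "\<dots> \<le> (\<integral>\<^sup>+ x. ennreal (indicator (cball 0 (real n)) x * \<phi> x * conv (Jt l) \<psi> x) \<partial>lborel)"
    proof (intro nn_integral_mono ennreal_leI)
      fix x
      have "q * (\<nu>' - a x) * (\<phi> x * \<psi> x) \<le> (\<nu> - a x) * (\<phi> x * \<psi> x)"
        using qle[of x] \<phi>(2)[of x] \<psi>(2)[of x] by (intro mult_right_mono) auto
      then show "q * (indicator (cball 0 (real n)) x * G x) \<le> indicator (cball 0 (real n)) x * \<phi> x * conv (Jt l) \<psi> x"
        by (auto simp: \<psi>(3) G_def indicator_def algebra_simps)
    qed
    also have "\<dots> \<le> (\<integral>\<^sup>+ x. ennreal (indicator (cball 0 (real n + 1)) x * \<psi> x * conv (Jt (- l)) \<phi> x) \<partial>lborel)"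
      by (rule tilted_adjoint_le[where C="max c1 c2"]) (use \<phi>(2) \<psi>(2) c1 c2 in \<open>auto simp: less_imp_le le_max_iff_disj\<close>)
    also have "\<dots> = (\<integral>\<^sup>+ x. ennreal (indicator (cball 0 (real n + 1)) x * G x) \<partial>lborel)"
      by (intro nn_integral_cong) (simp add: \<phi>(3) G_def algebra_simps)
    also have "\<dots> = ennreal (?I (real n + 1))" by (rule nn)
    finally show "q * ?I n \<le> ?I (real n + 1)" using I0 by (simp add: ennreal_le_iff)
  qed
qed

lemma eigen_sym:
  assumes "tk.eigen l a \<nu> \<psi>" "tk.eigen (- l) a \<nu>' \<phi>" "a \<in> C_per"
  shows "\<nu> = \<nu>'"
  using eigen_sym_le[OF assms] eigen_sym_le[of "- l" a \<nu>' \<phi> \<nu> \<psi>] assms by simp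

text \<open>The integrand on the right is the one on the left times a factor \<open>t x y\<close> with
  \<open>t y x = 1 / t x y\<close>, so the claim follows from \<open>t + 1 / t \<ge> 2\<close> after symmetrization. The balls
  have different radii because symmetrization needs a symmetric domain.\<close>

lemma tilted_amgm:
  assumes \<phi>m [measurable]: "\<phi> \<in> borel_measurable borel" and \<psi>m [measurable]: "\<psi> \<in> borel_measurable borel"
    and \<phi>: "\<And>x. 0 < \<phi> x" "\<And>x. \<phi> x \<le> C" and \<psi>: "\<And>x. 0 < \<psi> x" "\<And>x. \<psi> x \<le> C"
  shows "(\<integral>\<^sup>+ x. ennreal (indicator (cball 0 r) x * \<phi> x * conv J \<phi> x) \<partial>lborel)
    \<le> (\<integral>\<^sup>+ x. ennreal (indicator (cball 0 (r + 1)) x * (\<phi> x)\<^sup>2 / \<psi> x * conv (Jt l) \<psi> x) \<partial>lborel)"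
proof -
  define B where "B = cball (0::real^'n) (r + 1)"
  have [measurable]: "B \<in> sets borel" by (simp add: B_def)
  define W where "W x y = indicator B x * indicator B y * (J (x - y) * (\<phi> x * \<phi> y))" for x y
  define T where "T x y = exp (l * ((x - y) \<bullet> e)) * (\<psi> y * \<phi> x) / (\<psi> x * \<phi> y)" for x y
  have T0: "0 < T x y" for x y using \<phi> \<psi> by (simp add: T_def)
  have W0: "0 \<le> W x y" for x y using \<phi>(1)[of x] \<phi>(1)[of y] J_nonneg by (simp add: W_def)
  have Wsym: "W y x = W x y" for x y by (simp add: W_def J_sym'[of x y] mult_ac)
  have Tsym: "T y x = inverse (T x y)" for x y
  proof -
    have "l * ((y - x) \<bullet> e) = - (l * ((x - y) \<bullet> e))" by (simp add: inner_diff_left algebra_simps)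
    then show ?thesis by (simp add: T_def exp_minus field_simps)
  qed
  have mW: "(\<lambda>z. W (fst z) (snd z)) \<in> borel_measurable (borel \<Otimes>\<^sub>M borel)" unfolding W_def by measurable
  have mT: "(\<lambda>z. T (fst z) (snd z)) \<in> borel_measurable (borel \<Otimes>\<^sub>M borel)" unfolding T_def by measurable
  note mW' [measurable] = measurable_compose[OF measurable_Pair mW, simplified]
  note mT' [measurable] = measurable_compose[OF measurable_Pair mT, simplified]
  define X where "X = (\<integral>\<^sup>+ x. \<integral>\<^sup>+ y. ennreal (W x y * T x y) \<partial>lborel \<partial>lborel)"
  define Y where "Y = (\<integral>\<^sup>+ x. \<integral>\<^sup>+ y. ennreal (W x y) \<partial>lborel \<partial>lborel)"
  have "X = (\<integral>\<^sup>+ y. \<integral>\<^sup>+ x. ennreal (W x y * T x y) \<partial>lborel \<partial>lborel)"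
    unfolding X_def
  proof (rule lborel_pair.Fubini'[symmetric])
    have "(\<lambda>z. ennreal (W (fst z) (snd z) * T (fst z) (snd z))) \<in> borel_measurable (borel \<Otimes>\<^sub>M borel)"
      using mW mT by measurable
    then show "(\<lambda>(x, y). ennreal (W x y * T x y)) \<in> borel_measurable (lborel \<Otimes>\<^sub>M lborel)"
      by (simp add: case_prod_beta measurable_cong_sets[OF sets_pair_measure_cong[OF sets_lborel sets_lborel] refl])
  qed
  also have "\<dots> = (\<integral>\<^sup>+ x. \<integral>\<^sup>+ y. ennreal (W x y * inverse (T x y)) \<partial>lborel \<partial>lborel)"
    by (intro nn_integral_cong, subst Tsym, subst Wsym, rule refl)
  finally have X': "X = (\<integral>\<^sup>+ x. \<integral>\<^sup>+ y. ennreal (W x y * inverse (T x y)) \<partial>lborel \<partial>lborel)" .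
  have "2 * Y = (\<integral>\<^sup>+ x. \<integral>\<^sup>+ y. 2 * ennreal (W x y) \<partial>lborel \<partial>lborel)"
    unfolding Y_def by (simp add: nn_integral_cmult)
  also have "\<dots> \<le> (\<integral>\<^sup>+ x. \<integral>\<^sup>+ y. ennreal (W x y * T x y) + ennreal (W x y * inverse (T x y)) \<partial>lborel \<partial>lborel)"
  proof (intro nn_integral_mono)
    fix x y
    have "0 \<le> (T x y - 1)\<^sup>2 / T x y" using T0[of x y] by simp
    also have "\<dots> = T x y + inverse (T x y) - 2" using T0[of x y] by (simp add: power2_eq_square field_simps)
    finally have "W x y * 2 \<le> W x y * (T x y + inverse (T x y))" using W0 by (intro mult_left_mono) auto
    then have "ennreal (2 * W x y) \<le> ennreal (W x y * T x y + W x y * inverse (T x y))"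
      by (intro ennreal_leI) (simp add: distrib_left)
    then show "2 * ennreal (W x y) \<le> ennreal (W x y * T x y) + ennreal (W x y * inverse (T x y))"
      using W0[of x y] T0[of x y] by (simp add: ennreal_plus ennreal_mult' less_imp_le)
  qed
  also have "\<dots> = (\<integral>\<^sup>+ x. (\<integral>\<^sup>+ y. ennreal (W x y * T x y) \<partial>lborel) + (\<integral>\<^sup>+ y. ennreal (W x y * inverse (T x y)) \<partial>lborel) \<partial>lborel)"
    by (intro nn_integral_cong nn_integral_add) measurable
  also have "\<dots> = X + (\<integral>\<^sup>+ x. \<integral>\<^sup>+ y. ennreal (W x y * inverse (T x y)) \<partial>lborel \<partial>lborel)"
    unfolding X_def by (intro nn_integral_add) measurable
  also have "\<dots> = X + X" by (simp only: X'[symmetric])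
  also have "X + X = 2 * X" by (simp add: mult_2)
  finally have YX: "Y \<le> X" by (simp add: ennreal_mult_le_mult_iff)
  have "(\<integral>\<^sup>+ x. ennreal (indicator (cball 0 r) x * \<phi> x * conv J \<phi> x) \<partial>lborel)
    = (\<integral>\<^sup>+ x. \<integral>\<^sup>+ y. ennreal (indicator (cball 0 r) x * \<phi> x * (J (x - y) * \<phi> y)) \<partial>lborel \<partial>lborel)"
    using \<phi> by (intro nn_integral_cong nn_integral_conv[symmetric]) (auto simp: less_imp_le)
  also have "\<dots> \<le> Y"
    unfolding Y_def
  proof (intro nn_integral_mono ennreal_leI)
    fix x y
    show "indicator (cball 0 r) x * \<phi> x * (J (x - y) * \<phi> y) \<le> W x y"
    proof (cases "x \<in> cball 0 r \<and> norm (x - y) \<le> 1")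
      case True
      then have "y \<in> B" using norm_triangle_ineq2[of y x] by (simp add: B_def norm_minus_commute)
      moreover have "x \<in> B" using True by (simp add: B_def)
      ultimately show ?thesis using True by (simp add: W_def mult_ac)
    next
      case False
      then have "indicator (cball 0 r) x * \<phi> x * (J (x - y) * \<phi> y) = 0" using K_supp[of "x - y"] by auto
      then show ?thesis using W0[of x y] by linarith
    qed
  qed
  also note YX
  also have "X \<le> (\<integral>\<^sup>+ x. \<integral>\<^sup>+ y. ennreal (indicator B x * (\<phi> x)\<^sup>2 / \<psi> x * (Jt l (x - y) * \<psi> y)) \<partial>lborel \<partial>lborel)"
    unfolding X_def
  proof (intro nn_integral_mono ennreal_leI)
    fix x y
    have "W x y * T x y = indicator B y * (indicator B x * (\<phi> x)\<^sup>2 / \<psi> x * (Jt l (x - y) * \<psi> y))"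
      using \<phi>(1)[of x] \<phi>(1)[of y] \<psi>(1)[of x] \<psi>(1)[of y]
      by (simp add: W_def T_def tilted_kernel_def power2_eq_square field_simps)
    moreover have "0 \<le> indicator B x * (\<phi> x)\<^sup>2 / \<psi> x * (Jt l (x - y) * \<psi> y)"
      using \<psi>(1)[of x] \<psi>(1)[of y] tk.K_nonneg[of l "x - y"] by simp
    ultimately show "W x y * T x y \<le> indicator B x * (\<phi> x)\<^sup>2 / \<psi> x * (Jt l (x - y) * \<psi> y)"
      by (auto simp: indicator_def)
  qed
  also have "\<dots> = (\<integral>\<^sup>+ x. ennreal (indicator B x * (\<phi> x)\<^sup>2 / \<psi> x * conv (Jt l) \<psi> x) \<partial>lborel)"
    using \<phi> \<psi> by (intro nn_integral_cong tk.nn_integral_conv) (auto simp: less_imp_le)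
  finally show ?thesis by (simp add: B_def)
qed

text \<open>Two uses of \<open>eigenfunction_exists\<close>. The weighted problem conv (Jt l) \<psi>
  = r \<beta> \<psi> with \<beta> = \<nu>0 - a > 0 can be started from a constant and a small r.
  Once r \<ge> 1 is known, \<psi> is a subsolution of the additive problem at level \<nu>0, which
  starts the second use.\<close>

lemma tilted_eigen_exists:
  assumes eig: "eigen a \<nu>0 \<phi>" and a: "a \<in> C_per"
  obtains \<nu> \<psi> where "tk.eigen l a \<nu> \<psi>" "\<nu>0 \<le> \<nu>"
proof -
  have \<phi>: "\<phi> \<in> C_per" "\<And>x. 0 < \<phi> x" "\<And>x. conv J \<phi> x = (\<nu>0 - a x) * \<phi> x" using eig by (auto simp: eigen_def)
  define \<beta> where "\<beta> x = \<nu>0 - a x" for x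
  have \<beta>0: "0 < \<beta> x" for x using eigen_gap_pos[OF eig] by (simp add: \<beta>_def)
  have \<beta>C: "\<beta> \<in> C_per" unfolding \<beta>_def[abs_def] using a by (intro C_per_intros) auto
  obtain B where B: "0 < B" "\<And>x. \<beta> x \<le> B" using C_per_pos_bounds[OF \<beta>C \<beta>0] by metis
  define I where "I = conv (Jt l) (\<lambda>x. 1) 0"
  have I: "conv (Jt l) (\<lambda>x. 1) x = I" for x by (simp add: I_def conv_eq)
  have I0: "0 < I" unfolding I_def by (rule tk.conv_pos'[where C=1]) auto
  have p1: "0 < 0 + I / B * \<beta> x" for x using \<beta>0 I0 B by simp
  have p2: "(0 + I / B * \<beta> x) * 1 \<le> conv (Jt l) (\<lambda>_. 1) x" for x
  proof -
    have "I / B * \<beta> x \<le> I / B * B" using B I0 by (intro mult_left_mono) auto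
    then show ?thesis using B(1) by (simp add: I)
  qed
  obtain r \<psi> where r: "I / B \<le> r" and \<psi>: "\<psi> \<in> C_per" "\<And>x. 0 < \<psi> x" "\<And>x. conv (Jt l) \<psi> x = (0 + r * \<beta> x) * \<psi> x"
    using tk.eigenfunction_exists[where l=l and \<alpha>="\<lambda>_. 0" and ?\<phi>0.0="\<lambda>_. 1",
      OF C_per_const \<beta>C \<beta>0 p1 C_per_const zero_le_one zero_less_one p2] by blast
  have r0: "0 < r" using r I0 B by (meson divide_pos_pos less_le_trans)
  \<comment> \<open>By \<open>tilted_amgm\<close>, the integral of \<beta> \<phi>^2 over a ball is
    at most r times the one over the ball of radius larger by 1; r < 1 would mean geometric
    growth.\<close>
  have "1 \<le> r"
  proof (rule ccontr)
    assume "\<not> 1 \<le> r"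
    then have q: "1 < 1 / r" using r0 by simp
    define G where "G x = \<beta> x * (\<phi> x * \<phi> x)" for x
    have GC: "G \<in> C_per" unfolding G_def[abs_def] by (intro C_per_intros \<beta>C \<phi>)
    have G0: "0 < G x" for x unfolding G_def using \<beta>0 \<phi> by simp
    obtain gm gM where g: "0 < gm" "\<And>x. gm \<le> G x" "\<And>x. G x \<le> gM" using C_per_pos_bounds[OF GC G0] by metis
    obtain c1 where c1: "\<And>x. \<phi> x \<le> c1" using C_per_pos_bounds[OF \<phi>(1,2)] by metis
    obtain c2 where c2: "\<And>x. \<psi> x \<le> c2" using C_per_pos_bounds[OF \<psi>(1,2)] by metis
    note [measurable] = C_per_measurable[OF GC]
    have int: "integrable lborel (\<lambda>x. indicator (cball 0 r) x * G x)" for r :: real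
      by (rule Bochner_Integration.integrable_bound[OF integrable_indicator_cball[of 0 r gM]])
         (use g G0 in \<open>auto intro!: always_eventually simp: indicator_def less_imp_le abs_of_pos intro: order_trans[OF _ abs_ge_self]\<close>)
    have nn: "(\<integral>\<^sup>+ x. ennreal (s * (indicator (cball 0 r) x * G x)) \<partial>lborel) = ennreal (s * (LINT x|lborel. indicator (cball 0 r) x * G x))" 
      if "0 \<le> s" for r s :: real
    proof (subst nn_integral_eq_integral)
      show "integrable lborel (\<lambda>x. s * (indicator (cball 0 r) x * G x))" by (intro integrable_mult_right int)
    qed (use G0 that in \<open>auto intro!: always_eventually simp: less_imp_le\<close>)
    show False
    proof (rule ball_integral_growth[OF C_per_measurable[OF GC] g q])
      fix n :: nat
      let ?I = "\<lambda>r::real. LINT x|lborel. indicator (cball 0 r) x * G x"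
      have I0: "0 \<le> ?I r" for r using G0 by (intro Bochner_Integration.integral_nonneg) (auto simp: less_imp_le)
      have "ennreal (1 * ?I n) = (\<integral>\<^sup>+ x. ennreal (1 * (indicator (cball 0 (real n)) x * G x)) \<partial>lborel)"
        by (rule nn[symmetric]) simp
      also have "\<dots> = (\<integral>\<^sup>+ x. ennreal (indicator (cball 0 (real n)) x * \<phi> x * conv J \<phi> x) \<partial>lborel)"
        by (intro nn_integral_cong) (simp add: \<phi>(3) G_def \<beta>_def mult_ac)
      also have "\<dots> \<le> (\<integral>\<^sup>+ x. ennreal (indicator (cball 0 (real n + 1)) x * (\<phi> x)\<^sup>2 / \<psi> x * conv (Jt l) \<psi> x) \<partial>lborel)"
        by (rule tilted_amgm[where C="max c1 c2"])
           (use \<phi>(2) \<psi>(2) c1 c2 C_per_measurable \<phi>(1) \<psi>(1) in \<open>auto simp: le_max_iff_disj\<close>)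
      also have "\<dots> = (\<integral>\<^sup>+ x. ennreal (r * (indicator (cball 0 (real n + 1)) x * G x)) \<partial>lborel)"
      proof (intro nn_integral_cong arg_cong[where f=ennreal])
        fix x
        show "indicator (cball 0 (real n + 1)) x * (\<phi> x)\<^sup>2 / \<psi> x * conv (Jt l) \<psi> x = r * (indicator (cball 0 (real n + 1)) x * G x)"
          using \<psi>(2)[of x] by (simp add: \<psi>(3) G_def power2_eq_square)
      qed
      also have "\<dots> = ennreal (r * ?I (real n + 1))" using r0 by (intro nn) simp
      finally have "?I n \<le> r * ?I (real n + 1)" using I0 r0 by (simp add: ennreal_le_iff)
      then show "1 / r * ?I n \<le> ?I (real n + 1)" using r0 by (simp add: pos_divide_le_eq mult.commute)
    qed
  qed
  have p3: "0 < - a x + \<nu>0 * 1" for x using \<beta>0[of x] by (simp add: \<beta>_def)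
  have p4: "(- a x + \<nu>0 * 1) * \<psi> x \<le> conv (Jt l) \<psi> x" for x
  proof -
    have "1 * (\<beta> x * \<psi> x) \<le> r * (\<beta> x * \<psi> x)"
      using \<open>1 \<le> r\<close> \<beta>0[of x] \<psi>(2)[of x] by (intro mult_right_mono) auto
    then show ?thesis by (simp add: \<psi>(3) mult.assoc) (simp add: \<beta>_def)
  qed
  obtain \<nu> \<xi> where \<nu>: "\<nu>0 \<le> \<nu>" and \<xi>: "\<xi> \<in> C_per" "\<And>x. 0 < \<xi> x" "\<And>x. conv (Jt l) \<xi> x = (- a x + \<nu> * 1) * \<xi> x"
    using tk.eigenfunction_exists[where l=l and \<alpha>="\<lambda>x. - a x" and \<beta>="\<lambda>_. 1",
      OF C_per_uminus[OF a] C_per_const zero_less_one p3 \<psi>(1) less_imp_le[OF \<psi>(2)] \<psi>(2) p4] by blast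
  have "tk.eigen l a \<nu> \<xi>" unfolding tk.eigen_def using \<xi> by simp
  then show ?thesis using that \<nu> by blast
qed

end

section \<open>The principal eigenvalue as a function of the tilt\<close>

locale kpp_linear = tilted J e for J :: "real^'n \<Rightarrow> real" and e +
  fixes a \<phi>0 :: "real^'n \<Rightarrow> real" and \<nu>0 :: real
  assumes a_C_per: "a \<in> C_per" and eigen0: "eigen a \<nu>0 \<phi>0"
begin

definition nu :: "real \<Rightarrow> real" where "nu l = (THE \<nu>. \<exists>\<phi>. tk.eigen l a \<nu> \<phi>)"

lemma nu_eqI: "tk.eigen l a \<nu> \<phi> \<Longrightarrow> nu l = \<nu>"
  unfolding nu_def using tk.eigen_unique a_C_per by blast

lemma nu_eigen: obtains \<phi> where "tk.eigen l a (nu l) \<phi>"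
  by (metis nu_eqI eigen0 a_C_per tilted_eigen_exists)

lemma nu_ge: "\<nu>0 \<le> nu l"
  by (metis nu_eqI eigen0 a_C_per tilted_eigen_exists)

lemma nu_uminus: "nu (- l) = nu l"
proof -
  obtain \<phi> where 1: "tk.eigen l a (nu l) \<phi>" using nu_eigen by blast
  obtain \<psi> where 2: "tk.eigen (- l) a (nu (- l)) \<psi>" using nu_eigen by blast
  show ?thesis using eigen_sym[OF 1 2 a_C_per] by simp
qed

lemma Jt_le: "Jt l' x \<le> exp \<bar>l' - l\<bar> * Jt l x"
proof (cases "norm x \<le> 1")
  case True
  have "\<bar>x \<bullet> e\<bar> \<le> norm x * norm e" by (rule Cauchy_Schwarz_ineq2)
  then have "\<bar>x \<bullet> e\<bar> \<le> 1" using True e by simp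
  then have "\<bar>l' - l\<bar> * \<bar>x \<bullet> e\<bar> \<le> \<bar>l' - l\<bar> * 1" by (intro mult_left_mono) auto
  then have "\<bar>(l' - l) * (x \<bullet> e)\<bar> \<le> \<bar>l' - l\<bar>" by (simp add: abs_mult)
  then have "l' * (x \<bullet> e) \<le> \<bar>l' - l\<bar> + l * (x \<bullet> e)" by (auto simp: abs_le_iff algebra_simps)
  then have "exp (l' * (x \<bullet> e)) \<le> exp \<bar>l' - l\<bar> * exp (l * (x \<bullet> e))" by (simp add: exp_add[symmetric])
  then have "J x * exp (l' * (x \<bullet> e)) \<le> J x * (exp \<bar>l' - l\<bar> * exp (l * (x \<bullet> e)))"
    using J_nonneg by (intro mult_left_mono) auto
  then show ?thesis by (simp add: tilted_kernel_def mult_ac)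
qed (simp add: tilted_kernel_def J_supp)

text \<open>By \<open>Jt_le\<close>, the eigenfunction for \<open>l\<close> is a supersolution for
  \<open>l'\<close>. Adding A \<ge> |a| makes A + a nonnegative, so that the factor can be applied
  to all of nu l + A.\<close>

lemma nu_shift_le:
  assumes "\<And>x. \<bar>a x\<bar> \<le> A"
  shows "nu l' + A \<le> exp \<bar>l' - l\<bar> * (nu l + A)"
proof -
  obtain \<phi> where 1: "tk.eigen l a (nu l) \<phi>" using nu_eigen by blast
  obtain \<psi> where 2: "tk.eigen l' a (nu l') \<psi>" using nu_eigen by blast
  have \<phi>: "\<phi> \<in> C_per" "\<And>x. 0 < \<phi> x" "\<And>x. conv (Jt l) \<phi> x = (nu l - a x) * \<phi> x" using 1 by (auto simp: tk.eigen_def)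
  obtain m M where m: "0 < m" "\<And>x. m \<le> \<phi> x" "\<And>x. \<phi> x \<le> M" using C_per_pos_bounds[OF \<phi>(1,2)] by metis
  define q where "q = exp \<bar>l' - l\<bar>"
  have q: "1 \<le> q" by (simp add: q_def)
  have "nu l' \<le> q * (nu l + A) - A"
  proof (rule tk.eigen_le_of_supersolution[OF 2 a_C_per C_per_measurable[OF \<phi>(1)] m])
    fix x
    have abs: "\<bar>\<phi> y\<bar> \<le> M" for y using \<phi>(2)[of y] m(3)[of y] by simp
    have "conv (Jt l') \<phi> x \<le> (LINT z|lborel. q * (Jt l z * \<phi> (x - z)))"
      unfolding conv_eq
    proof (intro integral_mono integrable_mult_right tk.integrable_conv'[OF C_per_measurable[OF \<phi>(1)] abs])
      fix z
      have "Jt l' z * \<phi> (x - z) \<le> q * Jt l z * \<phi> (x - z)"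
        using Jt_le[of l' z l] \<phi>(2) by (intro mult_right_mono) (auto simp: q_def less_imp_le)
      then show "Jt l' z * \<phi> (x - z) \<le> q * (Jt l z * \<phi> (x - z))" by (simp add: mult.assoc)
    qed
    also have "\<dots> = q * ((nu l - a x) * \<phi> x)" by (simp add: conv_eq[symmetric] \<phi>(3))
    also have "\<dots> = q * (nu l - a x) * \<phi> x" by simp
    also have "\<dots> \<le> (q * (nu l + A) - A - a x) * \<phi> x"
    proof (intro mult_right_mono)
      have "1 * (A + a x) \<le> q * (A + a x)" using q assms[of x] by (intro mult_right_mono) (auto simp: abs_le_iff)
      then show "q * (nu l - a x) \<le> q * (nu l + A) - A - a x" by (simp add: algebra_simps)
    qed (use \<phi>(2)[of x] in simp)
    finally show "conv (Jt l') \<phi> x \<le> (q * (nu l + A) - A - a x) * \<phi> x" .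
  qed
  then show ?thesis by (simp add: q_def)
qed

lemma nu_continuous: "continuous_on UNIV nu"
proof -
  obtain A where A: "\<And>x. \<bar>a x\<bar> \<le> A" using C_per_bounded[OF a_C_per] by blast
  have "isCont nu l" for l
  proof -
    have "((\<lambda>l'. exp (- \<bar>l' - l\<bar>) * (nu l + A) - A) \<longlongrightarrow> exp (- \<bar>l - l\<bar>) * (nu l + A) - A) (at l)"
      by (intro tendsto_intros)
    moreover have "((\<lambda>l'. exp \<bar>l' - l\<bar> * (nu l + A) - A) \<longlongrightarrow> exp \<bar>l - l\<bar> * (nu l + A) - A) (at l)"
      by (intro tendsto_intros)
    moreover have "exp (- \<bar>l' - l\<bar>) * (nu l + A) - A \<le> nu l'" for l'
    proof -
      have "exp (- \<bar>l' - l\<bar>) * (nu l + A) \<le> exp (- \<bar>l' - l\<bar>) * (exp \<bar>l' - l\<bar> * (nu l' + A))"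
        using nu_shift_le[OF A, of l l'] by (intro mult_left_mono) (auto simp: abs_minus_commute)
      also have "\<dots> = nu l' + A" by (simp add: mult.assoc[symmetric] exp_add[symmetric])
      finally show ?thesis by simp
    qed
    moreover have "nu l' \<le> exp \<bar>l' - l\<bar> * (nu l + A) - A" for l'
      using nu_shift_le[OF A, of l' l] by simp
    ultimately have "(nu \<longlongrightarrow> nu l) (at l)"
      by (intro tendsto_sandwich[of "\<lambda>l'. exp (- \<bar>l' - l\<bar>) * (nu l + A) - A" nu "at l" "\<lambda>l'. exp \<bar>l' - l\<bar> * (nu l + A) - A"]
            always_eventually allI) auto
    then show ?thesis by (simp add: isCont_def)
  qed
  then show ?thesis by (simp add: continuous_at_imp_continuous_on)
qed

text \<open>\<open>l\<close> is the last zero of nu l - c l before \<open>l1\<close>. From there up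
  to \<open>l1\<close> the difference is negative, so \<open>l'\<close> can be taken as close to
  \<open>l\<close> as desired, here within the factor 2.\<close>

lemma nu_crossing:
  assumes "0 < \<nu>0" "0 < l1" "nu l1 < c * l1"
  obtains l l' where "0 < l" "l < l'" "l' \<le> 2 * l" "nu l = c * l" "nu l' < c * l'"
proof -
  define h where "h l = nu l - c * l" for l
  have h: "continuous_on S h" for S unfolding h_def
    by (intro continuous_intros continuous_on_subset[OF nu_continuous]) auto
  have h0: "0 < h 0" using nu_ge[of 0] assms(1) by (simp add: h_def)
  have h1: "h l1 < 0" using assms by (simp add: h_def)
  define S where "S = {0..l1} \<inter> h -` {0..}"
  have "closed S" unfolding S_def 
    using continuous_closed_preimage[OF h closed_atLeastAtMost closed_atLeast, of 0 l1 0] by (simp add: Int_commute)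
  then have "compact S" by (simp add: compact_eq_bounded_closed S_def bounded_Int)
  moreover have "0 \<in> S" using h0 assms by (simp add: S_def)
  then have "S \<noteq> {}" by blast
  ultimately obtain l where l: "l \<in> S" "\<And>x. x \<in> S \<Longrightarrow> x \<le> l" using compact_attains_sup by metis
  have ll: "0 \<le> l" "l \<le> l1" "0 \<le> h l" using l(1) by (auto simp: S_def)
  obtain x where x: "l \<le> x" "x \<le> l1" "h x = 0" using IVT2'[of h l1 0 l] h ll h1 by force
  then have "x \<in> S" using ll by (simp add: S_def)
  then have hl: "h l = 0" using l(2) x by fastforce
  have l0: "0 < l" using hl h0 ll by (cases "l = 0") auto
  have l1: "l < l1" using hl h1 ll by (cases "l = l1") auto
  define l' where "l' = min l1 (2 * l)"
  have l': "l < l'" "l' \<le> 2 * l" "l' \<le> l1" using l0 l1 by (auto simp: l'_def)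
  then have "l' \<notin> S" using l(2) by fastforce
  then have "h l' < 0" using l' l0 by (auto simp: S_def)
  then show ?thesis using that[of l l'] l0 l' hl by (simp add: h_def)
qed

end

subsection \<open>The reaction term\<close>

lemma Ck_on_SucE:
  assumes "Ck_on (Suc k) S g"
  obtains g' where "\<forall>x\<in>S. (g has_derivative g' x) (at x within S)" "\<forall>v. Ck_on k S (\<lambda>x. g' x v)"
  using assms by auto

locale reaction =
  fixes f :: "real^'n \<Rightarrow> real \<Rightarrow> real"
  assumes f: "reaction_assms f"
begin

lemma f_0 [simp]: "f x 0 = 0" and f_C3: "Ck_on 3 (UNIV \<times> {0..}) (\<lambda>(x, u). f x u)"
  and f_decr: "0 < u \<Longrightarrow> u < v \<Longrightarrow> f x v / v < f x u / u"
  using f by (auto simp: reaction_assms_def monotone_on_def)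

lemma f_periodic: "0 \<le> u \<Longrightarrow> (\<And>i. k $ i \<in> \<int>) \<Longrightarrow> f (x + k) u = f x u"
  using f periodicD[of "\<lambda>x. f x u" k x] unfolding reaction_assms_def by simp

lemma f_saturation: obtains M where "0 < M" "\<And>x u. M \<le> u \<Longrightarrow> f x u \<le> 0"
  using f unfolding reaction_assms_def by metis

lemma f_continuous: "continuous_on (UNIV \<times> {0..}) (\<lambda>(x, u). f x u)"
proof -
  obtain f' where "\<forall>z\<in>UNIV \<times> {0..}. ((\<lambda>(x, u). f x u) has_derivative f' z) (at z within UNIV \<times> {0..})"
    by (rule Ck_on_SucE[OF f_C3[unfolded numeral_3_eq_3]], rule that)
  then show ?thesis by (intro has_derivative_continuous_on) (rule bspec)
qed

lemma slice_derivative: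
  fixes g :: "(real^'n) \<times> real \<Rightarrow> real"
  assumes "(g has_derivative g') (at (x, u) within UNIV \<times> {0..})" "0 \<le> u"
  shows "((\<lambda>u. g (x, u)) has_real_derivative g' (0, 1)) (at u within {0..})"
proof -
  have "((\<lambda>u. (x, u)) has_derivative (\<lambda>h. (0, h))) (at u within {0..})"
    by (intro has_derivative_Pair has_derivative_const has_derivative_ident)
  moreover have "(g has_derivative g') (at (x, u) within (\<lambda>u. (x, u)) ` {0..})"
    using assms(1) by (rule has_derivative_subset) auto
  ultimately have "((\<lambda>u. g (x, u)) has_derivative (\<lambda>h. g' (0, h))) (at u within {0..})"
    by (rule has_derivative_in_compose)
  moreover have "g' (0, h) = g' (0, 1) * h" for h
  proof -
    have "linear g'" using assms(1) has_derivative_linear by blast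
    then have "g' (h *\<^sub>R (0, 1)) = h *\<^sub>R g' (0, 1)" by (rule linear_scale)
    then show ?thesis by simp
  qed
  then have "(\<lambda>h. g' (0, h)) = (*) (g' (0, 1))" by (intro ext)
  ultimately show ?thesis unfolding has_field_derivative_def by (simp only:)
qed

lemma within_nonneg_unique:
  assumes "(g has_real_derivative d) (at u within {0..})" "0 \<le> u"
  shows "vector_derivative g (at u within {0..}) = d"
proof (rule vector_derivative_within)
  have "u islimpt {u<..<u+1}" by (rule islimpt_greaterThanLessThan1) simp
  then have "u islimpt {0..}" by (rule islimpt_subset) (use assms(2) in auto)
  then show "at u within {0..} \<noteq> bot" by (simp add: trivial_limit_within)
  show "(g has_vector_derivative d) (at u within {0..})"
    using assms(1) by (simp add: has_real_derivative_iff_has_vector_derivative)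
qed

lemma derivatives:
  obtains E where
    "\<And>x u. 0 \<le> u \<Longrightarrow> (f x has_real_derivative f_u f x u) (at u within {0..})"
    "\<And>x u. 0 \<le> u \<Longrightarrow> (f_u f x has_real_derivative E x u) (at u within {0..})"
    "continuous_on (UNIV \<times> {0..}) (\<lambda>(x, u). f_u f x u)"
    "continuous_on (UNIV \<times> {0..}) (\<lambda>(x, u). E x u)"
proof -
  let ?S = "UNIV \<times> {0..} :: ((real^'n) \<times> real) set"
  obtain f' where f': "\<forall>z\<in>?S. ((\<lambda>(x, u). f x u) has_derivative f' z) (at z within ?S)"
    "\<forall>v. Ck_on (Suc (Suc 0)) ?S (\<lambda>z. f' z v)"
    by (rule Ck_on_SucE[OF f_C3[unfolded numeral_3_eq_3]], rule that)
  have 1: "(f x has_real_derivative f' (x, u) (0, 1)) (at u within {0..})" if "0 \<le> u" for x u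
    using slice_derivative[OF f'(1)[rule_format], of x u] that by simp
  then have fu: "f_u f x u = f' (x, u) (0, 1)" if "0 \<le> u" for x u
    unfolding f_u_def using within_nonneg_unique that by blast
  obtain g where g: "\<forall>z\<in>?S. ((\<lambda>z. f' z (0, 1)) has_derivative g z) (at z within ?S)"
    "\<forall>v. Ck_on (Suc 0) ?S (\<lambda>z. g z v)"
    by (rule Ck_on_SucE[OF f'(2)[rule_format, of "(0, 1)"]], rule that)
  have 2: "((\<lambda>u. f' (x, u) (0, 1)) has_real_derivative g (x, u) (0, 1)) (at u within {0..})" if "0 \<le> u" for x u
    using slice_derivative[OF g(1)[rule_format], of x u] that by simp
  obtain h where h: "\<forall>z\<in>?S. ((\<lambda>z. g z (0, 1)) has_derivative h z) (at z within ?S)"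
    by (rule Ck_on_SucE[OF g(2)[rule_format, of "(0, 1)"]], rule that)
  show ?thesis
  proof (rule that[of "\<lambda>x u. g (x, u) (0, 1)"])
    show "(f x has_real_derivative f_u f x u) (at u within {0..})" if "0 \<le> u" for x u
      using 1 fu that by simp
    show "(f_u f x has_real_derivative g (x, u) (0, 1)) (at u within {0..})" if "0 \<le> u" for x u
      using 2[OF that, of x] by (rule has_field_derivative_transform_within[where d=1]) (use fu that in auto)
    have "continuous_on ?S (\<lambda>z. f' z (0, 1))" using g(1) by (intro has_derivative_continuous_on) (rule bspec)
    then show "continuous_on ?S (\<lambda>(x, u). f_u f x u)"
      by (rule continuous_on_eq) (auto simp: fu)
    have "continuous_on ?S (\<lambda>z. g z (0, 1))" using h by (intro has_derivative_continuous_on) (rule bspec)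
    then show "continuous_on ?S (\<lambda>(x, u). g (x, u) (0, 1))"
      by (rule continuous_on_eq) auto
  qed
qed

lemma f_u_periodic: 
  assumes "\<And>i. k $ i \<in> \<int>" "0 \<le> u"
  shows "f_u f (x + k) u = f_u f x u"
proof -
  obtain E where *: "\<And>x u. 0 \<le> u \<Longrightarrow> (f x has_real_derivative f_u f x u) (at u within {0..})"
    using derivatives by metis
  have "(f x has_real_derivative f_u f (x + k) u) (at u within {0..})"
    using *[OF assms(2), of "x + k"] by (rule has_field_derivative_transform_within[where d=1]) (use assms in \<open>auto simp: f_periodic\<close>)
  then show ?thesis using within_nonneg_unique[OF _ assms(2)] *[OF assms(2), of x] by metis
qed

lemma f_u_C_per: "(\<lambda>x. f_u f x 0) \<in> C_per"
  unfolding C_per_def periodic_def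
proof (intro CollectI conjI allI impI)
  obtain E where *: "continuous_on (UNIV \<times> {0..}) (\<lambda>(x, u). f_u f x u)" using derivatives by metis
  have "continuous_on UNIV (\<lambda>x. (\<lambda>(x, u). f_u f x u) (x, 0))"
    by (rule continuous_on_compose2[OF *]) (auto intro: continuous_intros)
  then show "continuous_on UNIV (\<lambda>x. f_u f x 0)" by simp
qed (use f_u_periodic in auto)

text \<open>The quotient f(x, u) / u is decreasing and tends to f_u(x, 0) as u tends to 0.\<close>

lemma f_le_linear:
  assumes "0 \<le> u"
  shows "f x u \<le> f_u f x 0 * u"
proof (cases "u = 0")
  case False
  then have u: "0 < u" using assms by simp
  obtain E where *: "\<And>x u. 0 \<le> u \<Longrightarrow> (f x has_real_derivative f_u f x u) (at u within {0..})"
    using derivatives by metis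
  have "(f x has_real_derivative f_u f x 0) (at_right 0)"
    using *[OF order_refl, of x] by (rule DERIV_subset) auto
  then have "((\<lambda>v. f x v / v) \<longlongrightarrow> f_u f x 0) (at_right 0)" by (simp add: has_field_derivative_iff)
  moreover have "\<forall>\<^sub>F v in at_right 0. f x u / u \<le> f x v / v"
    using eventually_at_right_real[OF u] by eventually_elim (use f_decr[of _ u x] in \<open>auto intro: less_imp_le\<close>)
  ultimately have "f x u / u \<le> f_u f x 0" by (rule tendsto_lowerbound) simp
  then show ?thesis using u by (simp add: pos_divide_le_eq)
qed simp

lemma increasing_of_derivative_within:
  fixes g :: "real \<Rightarrow> real"
  assumes "\<And>u. 0 \<le> u \<Longrightarrow> (g has_real_derivative g' u) (at u within {0..})" 
    "\<And>u. 0 \<le> u \<Longrightarrow> u \<le> v \<Longrightarrow> 0 \<le> g' u" "0 \<le> u" "u \<le> v"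
  shows "g u \<le> g v"
proof (rule DERIV_nonneg_imp_increasing_open[OF assms(4)])
  fix w assume w: "u < w" "w < v"
  then have "at w within {0..} = at w" using assms(3) by (intro at_within_interior) (simp add: interior_real_atLeast)
  then show "\<exists>y. (g has_real_derivative y) (at w) \<and> 0 \<le> y" using assms(1)[of w] assms(2)[of w] assms(3) w by auto
next
  have "continuous_on {0..} g" using assms(1) by (intro DERIV_continuous_on) auto
  then show "continuous_on {u..v} g" by (rule continuous_on_subset) (use assms(3) in auto)
qed

lemma bounded_on_strip:
  fixes g :: "real^'n \<Rightarrow> real \<Rightarrow> real" and M :: real
  assumes "continuous_on (UNIV \<times> {0..}) (\<lambda>(x, u). g (x::real^'n) u)"
  obtains C :: real where "0 < C" "\<And>x u. x \<in> cbox 0 1 \<Longrightarrow> 0 \<le> u \<Longrightarrow> u \<le> M \<Longrightarrow> \<bar>g x u\<bar> \<le> C"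
proof -
  have "compact (cbox 0 (1::real^'n) \<times> {0..M})" by (intro compact_Times) auto
  moreover have "continuous_on (cbox 0 (1::real^'n) \<times> {0..M}) (\<lambda>(x, u). g x u)"
    by (rule continuous_on_subset[OF assms]) auto
  ultimately have "bounded ((\<lambda>(x, u). g x u) ` (cbox 0 1 \<times> {0..M}))"
    using compact_continuous_image compact_imp_bounded by blast
  then obtain C where "0 < C" "\<And>y. y \<in> (\<lambda>(x, u). g x u) ` (cbox 0 1 \<times> {0..M}) \<Longrightarrow> norm y \<le> C"
    unfolding bounded_pos by blast
  then show ?thesis using that[of C] by force
qed

text \<open>Taylor bound with \<open>C\<close> bounding the second u-derivative over a period cell.
  It is obtained by integrating twice in the form of monotonicity, as derivatives at u = 0 are
  one-sided; periodicity extends it to all x.\<close>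

lemma f_ge_quadratic:
  obtains C where "0 < C" "\<And>x u. 0 \<le> u \<Longrightarrow> u \<le> M \<Longrightarrow> f_u f x 0 * u - C * u\<^sup>2 \<le> f x u"
proof -
  obtain E where 1: "\<And>x u. 0 \<le> u \<Longrightarrow> (f x has_real_derivative f_u f x u) (at u within {0..})"
    and 2: "\<And>x u. 0 \<le> u \<Longrightarrow> (f_u f x has_real_derivative E x u) (at u within {0..})"
    and cE: "continuous_on (UNIV \<times> {0..}) (\<lambda>(x, u). E x u)"
    using derivatives by metis
  obtain C where C: "0 < C" "\<And>x u. x \<in> cbox 0 1 \<Longrightarrow> 0 \<le> u \<Longrightarrow> u \<le> M \<Longrightarrow> \<bar>E x u\<bar> \<le> C"
    using bounded_on_strip[OF cE] by metis
  have D: "f_u f x 0 - C * u \<le> f_u f x u" if x: "x \<in> cbox 0 1" and u: "0 \<le> u" "u \<le> M" for x u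
  proof -
    have "f_u f x 0 + C * 0 \<le> f_u f x u + C * u"
    proof (rule increasing_of_derivative_within[where g="\<lambda>u. f_u f x u + C * u" and g'="\<lambda>u. E x u + C * 1"])
      fix v assume "0 \<le> v" "v \<le> u" 
      then show "0 \<le> E x v + C * 1" using C(2)[OF x, of v] u by (auto simp: abs_le_iff)
    next
      fix v assume "0 \<le> (v::real)"
      then show "((\<lambda>u. f_u f x u + C * u) has_real_derivative E x v + C * 1) (at v within {0..})"
        by (intro DERIV_add 2 DERIV_cmult DERIV_ident)
    qed (use u in auto)
    then show ?thesis by simp
  qed
  have F: "f_u f x 0 * u - C * u\<^sup>2 \<le> f x u" if x: "x \<in> cbox 0 1" and u: "0 \<le> u" "u \<le> M" for x u
  proof -
    have "f x 0 - (f_u f x 0 * 0 - C * 0\<^sup>2) \<le> f x u - (f_u f x 0 * u - C * u\<^sup>2)"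
    proof (rule increasing_of_derivative_within[where g="\<lambda>u. f x u - (f_u f x 0 * u - C * u\<^sup>2)" and g'="\<lambda>u. f_u f x u - (f_u f x 0 * 1 - C * (2 * u))"])
      fix v assume v: "0 \<le> v" "v \<le> u" 
      moreover have "0 \<le> C * v" using C v by simp
      ultimately show "0 \<le> f_u f x v - (f_u f x 0 * 1 - C * (2 * v))" using D[OF x, of v] u by auto
    next
      fix v assume "0 \<le> (v::real)"
      have "((\<lambda>u. u\<^sup>2) has_real_derivative 2 * v) (at v within {0..})" by (auto intro!: derivative_eq_intros)
      then show "((\<lambda>u. f x u - (f_u f x 0 * u - C * u\<^sup>2)) has_real_derivative f_u f x v - (f_u f x 0 * 1 - C * (2 * v))) (at v within {0..})"
        by (intro DERIV_diff 1 DERIV_cmult DERIV_ident \<open>0 \<le> v\<close>)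
    qed (use u in auto)
    then show ?thesis by simp
  qed
  have "f_u f x 0 * u - C * u\<^sup>2 \<le> f x u" if u: "0 \<le> u" "u \<le> M" for x u
  proof -
    obtain k where k: "\<And>i. k $ i \<in> \<int>" "x + k \<in> cbox 0 1" using lattice_translate_unit_cube by blast
    show ?thesis using F[OF k(2) u] f_u_periodic[of k 0 x, OF k(1)] f_periodic[of u k x, OF u(1) k(1)] by simp
  qed
  then show ?thesis using that C(1) by blast
qed

text \<open>Supplies the shift that makes the monotone iterations order preserving, both for the
  stationary problem and for fronts.\<close>

lemma f_one_sided_lipschitz:
  obtains C where "0 < C" "\<And>x u v. 0 \<le> u \<Longrightarrow> u \<le> v \<Longrightarrow> v \<le> M \<Longrightarrow> f x u + C * u \<le> f x v + C * v"
proof -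
  obtain E where 1: "\<And>x u. 0 \<le> u \<Longrightarrow> (f x has_real_derivative f_u f x u) (at u within {0..})"
    and cD: "continuous_on (UNIV \<times> {0..}) (\<lambda>(x, u). f_u f x u)"
    using derivatives by metis
  obtain C where C: "0 < C" "\<And>x u. x \<in> cbox 0 1 \<Longrightarrow> 0 \<le> u \<Longrightarrow> u \<le> M \<Longrightarrow> \<bar>f_u f x u\<bar> \<le> C"
    using bounded_on_strip[OF cD] by metis
  have F: "f x u + C * u \<le> f x v + C * v" if x: "x \<in> cbox 0 1" and u: "0 \<le> u" "u \<le> v" "v \<le> M" for x u v
  proof (rule increasing_of_derivative_within[where g="\<lambda>u. f x u + C * u" and g'="\<lambda>u. f_u f x u + C * 1"])
    fix w assume w: "0 \<le> w" "w \<le> v" 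
    then show "0 \<le> f_u f x w + C * 1" using C(2)[OF x, of w] u by (auto simp: abs_le_iff)
  next
    fix v assume "0 \<le> (v::real)"
    then show "((\<lambda>u. f x u + C * u) has_real_derivative f_u f x v + C * 1) (at v within {0..})"
      by (intro DERIV_add 1 DERIV_cmult DERIV_ident)
  qed (use u in auto)
  have "f x u + C * u \<le> f x v + C * v" if u: "0 \<le> u" "u \<le> v" "v \<le> M" for x u v
  proof -
    obtain k where k: "\<And>i. k $ i \<in> \<int>" "x + k \<in> cbox 0 1" using lattice_translate_unit_cube by blast
    have "0 \<le> v" using u by simp
    show ?thesis using F[OF k(2) u] f_periodic[of u k x, OF u(1) k(1)] f_periodic[of v k x, OF \<open>0 \<le> v\<close> k(1)] by simp
  qed
  then show ?thesis using that C(1) by blast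
qed

lemma f_measurable:
  assumes [measurable]: "g \<in> borel_measurable M" "h \<in> borel_measurable M" and "\<And>z. 0 \<le> h z"
  shows "(\<lambda>z. f (g z) (h z)) \<in> borel_measurable M"
proof -
  \<comment> \<open>\<open>f\<close> is constrained only for u \<ge> 0, so the argument is truncated
    before continuity is used.\<close>
  have "continuous_on UNIV (\<lambda>z. (\<lambda>(x, u). f x u) (fst z, max 0 (snd z)))"
    by (rule continuous_on_compose2[OF f_continuous]) (auto intro!: continuous_intros)
  then have "(\<lambda>z. f (fst z) (max 0 (snd z))) \<in> borel_measurable borel"
    by (intro borel_measurable_continuous_onI) simp
  then have [measurable]: "(\<lambda>z. f (fst z) (max 0 (snd z))) \<in> borel_measurable (borel \<Otimes>\<^sub>M borel)" by (simp add: borel_prod)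
  have "(\<lambda>z. (\<lambda>z. f (fst z) (max 0 (snd z))) (g z, h z)) \<in> borel_measurable M" by measurable
  then show ?thesis using assms(3) by (simp add: max_absorb2)
qed

lemma f_continuous_u: "continuous_on {0..} (f x)"
proof -
  have "continuous_on {0..} (\<lambda>u. (\<lambda>(x, u). f x u) (x, u))"
    by (rule continuous_on_compose2[OF f_continuous]) (auto intro!: continuous_intros)
  then show ?thesis by simp
qed

lemma f_tendsto:
  assumes "(\<lambda>i. u i) \<longlonglongrightarrow> v" "\<And>i. 0 \<le> u i"
  shows "(\<lambda>i. f x (u i)) \<longlonglongrightarrow> f x v"
proof -
  have "0 \<le> v" using assms by (intro LIMSEQ_le_const) auto
  then show ?thesis using continuous_on_tendsto_compose[OF f_continuous_u assms(1)] assms(2) by auto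
qed

text \<open>Compactness of a period cell times [m, M] makes the strict decrease of f(x, u) / u
  uniform. The amount \<open>\<eta>\<close> is the gain in both nonlinear comparison arguments,
  \<open>stationary_compare\<close> and \<open>profile_limit\<close>.\<close>

lemma f_gap:
  assumes "0 < m" "0 < \<kappa>" "\<kappa> < 1"
  obtains \<eta> where "0 < \<eta>" "\<And>x v. m \<le> v \<Longrightarrow> v \<le> M \<Longrightarrow> \<eta> \<le> f x (\<kappa> * v) / (\<kappa> * v) - f x v / v"
proof (cases "m \<le> M")
  case True
  let ?S = "cbox 0 (1::real^'n) \<times> {m..M}"
  let ?g = "\<lambda>z. f (fst z) (\<kappa> * snd z) / (\<kappa> * snd z) - f (fst z) (snd z) / snd z"
  have "compact ?S" by (intro compact_Times) auto
  moreover have "(0, m) \<in> ?S" using lattice_translate_unit_cube[of 0] True by (auto simp: mem_box_cart)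
  then have "?S \<noteq> {}" by blast
  moreover have "continuous_on ?S ?g"
  proof -
    have 1: "continuous_on ?S (\<lambda>z. f (fst z) (\<kappa> * snd z))"
    proof -
      have "continuous_on ?S (\<lambda>z. (fst z, \<kappa> * snd z))" by (intro continuous_intros)
      moreover have "(\<lambda>z. (fst z, \<kappa> * snd z)) ` ?S \<subseteq> UNIV \<times> {0..}" using assms by auto
      ultimately show ?thesis using continuous_on_compose2[OF f_continuous, of ?S "\<lambda>z. (fst z, \<kappa> * snd z)"] by simp
    qed
    have "?S \<subseteq> UNIV \<times> {0..}" using assms by auto
    then have 2: "continuous_on ?S (\<lambda>z. f (fst z) (snd z))"
      using continuous_on_subset[OF f_continuous, of ?S] by (simp add: case_prod_beta)
    show ?thesis using assms by (intro continuous_intros 1 2) auto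
  qed
  ultimately obtain z where z: "z \<in> ?S" "\<And>y. y \<in> ?S \<Longrightarrow> ?g z \<le> ?g y"
    using continuous_attains_inf[of ?S ?g] by blast
  show ?thesis
  proof (rule that[of "?g z"])
    have "0 < snd z" using z(1) assms by auto
    then have "\<kappa> * snd z < 1 * snd z" using assms by (intro mult_strict_right_mono) auto
    then show "0 < ?g z" using f_decr[of "\<kappa> * snd z" "snd z" "fst z"] assms \<open>0 < snd z\<close> by simp
    fix x :: "real^'n" and v :: real assume v: "m \<le> v" "v \<le> M"
    obtain k where k: "\<And>i. k $ i \<in> \<int>" "x + k \<in> cbox 0 1" using lattice_translate_unit_cube[of x] by metis
    have nn: "0 \<le> v" "0 \<le> \<kappa> * v" using v assms by auto
    have "?g z \<le> ?g (x + k, v)" using k v by (intro z(2)) auto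
    then show "?g z \<le> f x (\<kappa> * v) / (\<kappa> * v) - f x v / v"
      using f_periodic[OF nn(1) k(1), of x] f_periodic[OF nn(2) k(1), of x] by simp
  qed
next
  case False
  then show ?thesis using that[of 1] by auto
qed

end

subsection \<open>The stationary state\<close>

locale kpp = reaction f + kpp_linear J e "\<lambda>x. f_u f x 0 - 1" \<phi>0 \<nu>0
  for f :: "real^'n \<Rightarrow> real \<Rightarrow> real" and J e \<phi>0 \<nu>0 +
  assumes \<nu>0: "0 < \<nu>0"
begin

text \<open>Suppose the best constant in \<kappa> p \<le> q is below 1. Where q / p is at least (1 +
  \<kappa>) / 2 there is room; elsewhere the two inequalities at the point and the gap of f(x, u) /
  u push q / p above \<kappa> by a fixed amount. The functions are merely measurable because the
  lemma is applied to monotone limits of iterates.\<close>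

lemma stationary_compare:
  assumes [measurable]: "q \<in> borel_measurable borel" "p \<in> borel_measurable borel"
    and m: "0 < m" and q: "\<And>x. m \<le> q x" "\<And>x. q x \<le> M" and p: "\<And>x. m \<le> p x" "\<And>x. p x \<le> M"
    and sup: "\<And>x. conv J q x - q x + f x (q x) \<le> 0" and sub: "\<And>x. 0 \<le> conv J p x - p x + f x (p x)"
  shows "p x \<le> q x"
proof -
  have p0: "0 < p x" and q0: "0 < q x" for x using m p(1)[of x] q(1)[of x] by linarith+
  obtain \<kappa> where \<kappa>: "0 < \<kappa>" "\<And>x. \<kappa> * p x \<le> q x" "\<And>\<kappa>'. (\<And>x. \<kappa>' * p x \<le> q x) \<Longrightarrow> \<kappa>' \<le> \<kappa>"
    using ratio_infimum[of m q p M] m p q p0 by metis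
  have "1 \<le> \<kappa>"
  proof (rule ccontr)
    assume "\<not> 1 \<le> \<kappa>"
    then have \<kappa>1: "\<kappa> < 1" by simp
    \<comment> \<open>Staying below \<open>\<kappa>1\<close> < 1 keeps k = q x / p x away from 1, so
      that \<open>f_gap\<close> gives one \<open>\<eta>\<close> for all points.\<close>
    define \<kappa>1 where "\<kappa>1 = (1 + \<kappa>) / 2"
    have k1: "\<kappa> < \<kappa>1" "\<kappa>1 < 1" "0 < \<kappa>1" using \<kappa>1 \<kappa>(1) by (auto simp: \<kappa>1_def)
    obtain \<eta> where \<eta>: "0 < \<eta>" "\<And>x v. m \<le> v \<Longrightarrow> v \<le> M \<Longrightarrow> \<eta> \<le> f x (\<kappa>1 * v) / (\<kappa>1 * v) - f x v / v"
      using f_gap[OF m k1(3,2)] by metis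
    obtain C where C: "0 < C" "\<And>x u v. 0 \<le> u \<Longrightarrow> u \<le> v \<Longrightarrow> v \<le> M \<Longrightarrow> f x u + C * u \<le> f x v + C * v"
      using f_one_sided_lipschitz by metis
    \<comment> \<open>The gains of the two cases; the second comes from k \<eta> \<le> (k -
      \<kappa>) P with P \<le> 1 + C.\<close>
    define \<delta> where "\<delta> = min (\<kappa>1 - \<kappa>) (\<kappa> * \<eta> / (1 + C))"
    have \<delta>: "0 < \<delta>" using k1 \<kappa> \<eta> C by (simp add: \<delta>_def)
    have "(\<kappa> + \<delta>) * p x \<le> q x" for x
    proof (cases "\<kappa>1 * p x \<le> q x")
      case True
      have "(\<kappa> + \<delta>) * p x \<le> \<kappa>1 * p x" using p0[of x] by (intro mult_right_mono) (auto simp: \<delta>_def)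
      then show ?thesis using True by simp
    next
      case False
      define k where "k = q x / p x"
      have qk: "q x = k * p x" using p0[of x] by (simp add: k_def)
      have k: "\<kappa> \<le> k" "k < \<kappa>1" using False \<kappa>(2)[of x] p0[of x] by (auto simp: qk)
      define P where "P = 1 - f x (p x) / p x"
      have "- C * p x \<le> f x (p x)" using C(2)[of 0 "p x" x] p0[of x] p(2)[of x] by (simp add: less_imp_le)
      then have PL: "P \<le> 1 + C" using p0[of x] by (simp add: P_def field_simps)
      have "f x (\<kappa>1 * p x) / (\<kappa>1 * p x) < f x (q x) / q x"
        unfolding qk using k \<kappa>(1) p0[of x] by (intro f_decr) auto
      then have fq: "f x (p x) / p x + \<eta> \<le> f x (q x) / q x" using \<eta>(2)[OF p(1,2), of x x] by linarith
      have "\<kappa> * (p x * P) = \<kappa> * (p x - f x (p x))" using p0[of x] by (simp add: P_def field_simps)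
      also have "\<dots> \<le> \<kappa> * conv J p x" using sub[of x] \<kappa>(1) by (intro mult_left_mono) auto
      also have "\<dots> = conv J (\<lambda>y. \<kappa> * p y) x" by (simp add: conv_cmult)
      also have "\<dots> \<le> conv J q x"
      proof (rule conv_mono[where C="max M (\<kappa> * M)"])
        fix y
        show "\<bar>\<kappa> * p y\<bar> \<le> max M (\<kappa> * M)" using p0[of y] p(2)[of y] \<kappa>(1) by (simp add: abs_of_pos le_max_iff_disj)
        show "\<bar>q y\<bar> \<le> max M (\<kappa> * M)" using q0[of y] q(2)[of y] by (simp add: abs_of_pos le_max_iff_disj)
      qed (use \<kappa> in auto)
      also have "\<dots> \<le> q x - f x (q x)" using sup[of x] by simp
      also have "\<dots> = q x * (1 - f x (q x) / q x)" using q0[of x] by (simp add: field_simps)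
      also have "\<dots> \<le> q x * (P - \<eta>)" using fq q0[of x] by (intro mult_left_mono) (auto simp: P_def)
      also have "\<dots> = p x * (k * (P - \<eta>))" by (simp add: qk)
      finally have "p x * (\<kappa> * P) \<le> p x * (k * (P - \<eta>))" by (simp add: mult_ac)
      then have "\<kappa> * P \<le> k * (P - \<eta>)" using p0[of x] by (simp add: mult_le_cancel_left_pos)
      then have "k * \<eta> \<le> (k - \<kappa>) * P" by (simp add: algebra_simps)
      also have "\<dots> \<le> (k - \<kappa>) * (1 + C)" using k PL by (intro mult_left_mono) auto
      finally have "\<kappa> * \<eta> \<le> (k - \<kappa>) * (1 + C)" using mult_right_mono[OF k(1), of \<eta>] \<eta>(1) by linarith
      then have "\<kappa> * \<eta> / (1 + C) \<le> k - \<kappa>" using C(1) by (simp add: pos_divide_le_eq)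
      then have "\<kappa> + \<delta> \<le> k" by (simp add: \<delta>_def)
      then show ?thesis unfolding qk using p0[of x] by (intro mult_right_mono) auto
    qed
    then have "\<kappa> + \<delta> \<le> \<kappa>" by (rule \<kappa>(3))
    then show False using \<delta> by simp
  qed
  then have "1 * p x \<le> \<kappa> * p x" using p0[of x] by (intro mult_right_mono) auto
  then show ?thesis using \<kappa>(2)[of x] by simp
qed

lemma conv_const [simp]: "conv J (\<lambda>_. c) x = c"
  using J_int by (simp add: conv_eq)

text \<open>The stationary equation solved for q after adding C q to both sides; for large
  \<open>C\<close> the map is order preserving.\<close>

definition stat_step :: "real \<Rightarrow> (real^'n \<Rightarrow> real) \<Rightarrow> real^'n \<Rightarrow> real" where
  "stat_step C q x = (conv J q x + (C * q x + f x (q x))) / (C + 1)"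

lemma stat_step_C_per:
  assumes "q \<in> C_per" "\<And>x. 0 \<le> q x"
  shows "stat_step C q \<in> C_per"
proof -
  have "(\<lambda>x. f x (q x)) \<in> C_per"
    unfolding C_per_def periodic_def
  proof (intro CollectI conjI allI impI)
    have "continuous_on UNIV (\<lambda>x. (x, q x))" using C_perD(1)[OF assms(1)] by (intro continuous_intros)
    then show "continuous_on UNIV (\<lambda>x. f x (q x))"
      using continuous_on_compose2[OF f_continuous, of UNIV "\<lambda>x. (x, q x)"] assms(2) by auto
    fix x k :: "real^'n" assume k: "\<forall>i. k $ i \<in> \<int>"
    then show "f (x + k) (q (x + k)) = f x (q x)"
      using periodicD[OF C_perD(2)[OF assms(1)], of k x] f_periodic[OF assms(2), of k x] by simp
  qed
  then have "(\<lambda>x. 1 / (C + 1) * (conv J q x + (C * q x + f x (q x)))) \<in> C_per"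
    by (intro C_per_cmult C_per_intros conv_C_per assms)
  then show ?thesis by (simp add: stat_step_def[abs_def])
qed

lemma stat_step_mono:
  assumes "0 < C" "\<And>x u v. 0 \<le> u \<Longrightarrow> u \<le> v \<Longrightarrow> v \<le> M \<Longrightarrow> f x u + C * u \<le> f x v + C * v"
    "p \<in> borel_measurable borel" "q \<in> borel_measurable borel"
    "\<And>x. 0 \<le> p x" "\<And>x. p x \<le> q x" "\<And>x. q x \<le> M"
  shows "stat_step C p x \<le> stat_step C q x"
proof -
  have "p x \<le> M" "0 \<le> q x" for x using assms(5-7)[of x] by linarith+
  then have "conv J p x \<le> conv J q x"
    using assms(5-7) by (intro conv_mono[where C=M] assms(3,4)) auto
  then show ?thesis using assms(2)[of "p x" "q x" x] assms(1,5-7) unfolding stat_step_def by (intro divide_right_mono) auto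
qed

lemma stat_step_limit:
  assumes "0 < C" "\<And>i. w i \<in> borel_measurable borel" "\<And>i y. 0 \<le> w i y" "\<And>i y. w i y \<le> M" "\<And>y. (\<lambda>i. w i y) \<longlonglongrightarrow> v y"
    "\<And>i. w (Suc i) = stat_step C (w i)"
  shows "conv J v x - v x + f x (v x) = 0"
proof -
  have "(\<lambda>i. stat_step C (w i) x) \<longlonglongrightarrow> stat_step C v x"
    unfolding stat_step_def using assms(1)
    by (intro tendsto_intros conv_tendsto[where C=M] f_tendsto assms) (use assms in auto)
  moreover have "(\<lambda>i. stat_step C (w i) x) \<longlonglongrightarrow> v x"
    using LIMSEQ_Suc[OF assms(5)[of x]] by (simp add: assms(6))
  ultimately have "stat_step C v x = v x" by (rule LIMSEQ_unique)
  then show ?thesis using assms(1) by (simp add: stat_step_def field_simps)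
qed

text \<open>Iterates of the constant \<open>M\<close> decrease, iterates of a small multiple of
  \<open>\<phi>0\<close> increase, and their limits coincide by \<open>stationary_compare\<close>. A
  common limit of an increasing and a decreasing sequence of continuous functions is lower and upper
  semicontinuous, hence continuous.\<close>

lemma stationary_exists:
  obtains p where "p \<in> C_per" "\<And>x. 0 < p x" "\<And>x. conv J p x - p x + f x (p x) = 0"
proof -
  obtain M where M: "0 < M" "\<And>x u. M \<le> u \<Longrightarrow> f x u \<le> 0" using f_saturation by metis
  obtain C where C: "0 < C" "\<And>x u v. 0 \<le> u \<Longrightarrow> u \<le> v \<Longrightarrow> v \<le> M \<Longrightarrow> f x u + C * u \<le> f x v + C * v"
    using f_one_sided_lipschitz by metis
  obtain C2 where C2: "0 < C2" "\<And>x u. 0 \<le> u \<Longrightarrow> u \<le> M \<Longrightarrow> f_u f x 0 * u - C2 * u\<^sup>2 \<le> f x u"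
    using f_ge_quadratic by metis
  have \<phi>: "\<phi>0 \<in> C_per" "\<And>x. 0 < \<phi>0 x" "\<And>x. conv J \<phi>0 x = (\<nu>0 - (f_u f x 0 - 1)) * \<phi>0 x"
    using eigen0 by (auto simp: eigen_def)
  obtain m B where m: "0 < m" "\<And>x. m \<le> \<phi>0 x" "0 < B" "\<And>x. \<phi>0 x \<le> B" using C_per_pos_bounds[OF \<phi>(1,2)] by metis
  \<comment> \<open>Small enough that the multiple stays below \<open>M\<close> and that the
    quadratic loss C2 (\<epsilon> \<phi>0)^2 does not exceed the linear gain \<nu>0 \<epsilon>
    \<phi>0.\<close>
  define \<epsilon> where "\<epsilon> = min (M / B) (\<nu>0 / (C2 * B))"
  have \<epsilon>: "0 < \<epsilon>" "\<epsilon> * B \<le> M" "C2 * (\<epsilon> * B) \<le> \<nu>0"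
  proof -
    show "0 < \<epsilon>" using M m C2 \<nu>0 by (simp add: \<epsilon>_def)
    have "\<epsilon> \<le> M / B" "\<epsilon> \<le> \<nu>0 / (C2 * B)" by (simp_all add: \<epsilon>_def)
    then show "\<epsilon> * B \<le> M" "C2 * (\<epsilon> * B) \<le> \<nu>0"
      using m(3) C2(1) by (simp_all add: pos_le_divide_eq mult_ac)
  qed
  define l0 where "l0 x = \<epsilon> * \<phi>0 x" for x
  have l0C: "l0 \<in> C_per" unfolding l0_def[abs_def] by (intro C_per_cmult \<phi>)
  have l0b: "\<epsilon> * m \<le> l0 x" "l0 x \<le> \<epsilon> * B" for x using \<epsilon>(1) m by (auto simp: l0_def)
  have \<epsilon>m: "0 < \<epsilon> * m" using \<epsilon> m by simp
  define U where "U n = (stat_step C ^^ n) (\<lambda>_. M)" for n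
  define L where "L n = (stat_step C ^^ n) l0" for n
  have Usuc: "U (Suc n) = stat_step C (U n)" and Lsuc: "L (Suc n) = stat_step C (L n)" for n by (simp_all add: U_def L_def)
  have U0: "U 0 = (\<lambda>_. M)" and L0: "L 0 = l0" by (simp_all add: U_def L_def)
  \<comment> \<open>\<open>M\<close> is a supersolution, because \<open>J\<close> has unit mass and
    f(x, M) \<le> 0.\<close>
  have Ustart: "U 1 x \<le> U 0 x" for x
    using M(2)[OF order_refl, of x] M(1) C(1) by (simp add: Usuc U0 stat_step_def divide_simps) (simp add: algebra_simps)
  have Lstart: "L 0 x \<le> L 1 x" for x
  proof -
    have l0: "0 \<le> l0 x" "l0 x \<le> M" using l0b[of x] \<epsilon>m \<epsilon>(2) by linarith+
    have "C2 * l0 x \<le> C2 * (\<epsilon> * B)" using l0b C2 by (intro mult_left_mono) auto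
    then have "C2 * l0 x \<le> \<nu>0" using \<epsilon>(3) by linarith
    then have "C2 * l0 x * l0 x \<le> \<nu>0 * l0 x" using l0 by (intro mult_right_mono)
    moreover have "conv J l0 x = (\<nu>0 - (f_u f x 0 - 1)) * l0 x"
      by (simp add: l0_def[abs_def] conv_cmult \<phi>(3))
    moreover have "f_u f x 0 * l0 x - C2 * l0 x * l0 x \<le> f x (l0 x)"
      using C2(2)[OF l0, of x] by (simp add: power2_eq_square)
    ultimately have "l0 x * (C + 1) \<le> conv J l0 x + (C * l0 x + f x (l0 x))" by (simp add: algebra_simps)
    then show ?thesis using C(1) by (simp add: Lsuc L0 stat_step_def pos_le_divide_eq)
  qed
  have inv: "U n \<in> C_per \<and> L n \<in> C_per \<and> (\<forall>x. \<epsilon> * m \<le> L n x \<and> L n x \<le> L (Suc n) x \<and> L (Suc n) x \<le> U (Suc n) x \<and> U (Suc n) x \<le> U n x \<and> U n x \<le> M)" for n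
  proof (induction n)
    case 0
    have "l0 x \<le> M" for x using l0b[of x] \<epsilon>(2) by linarith
    then have "stat_step C (L 0) x \<le> stat_step C (U 0) x" for x
      unfolding U0 L0 using C_per_measurable[OF l0C] l0b \<epsilon>m
      by (intro stat_step_mono[OF C]) (auto intro: order_trans[OF less_imp_le])
    then have "L 1 x \<le> U 1 x" for x by (simp add: Usuc Lsuc)
    then show ?case using Ustart Lstart l0C l0b by (simp add: U0 L0)
  next
    case (Suc n)
    then have IH: "U n \<in> C_per" "L n \<in> C_per" "\<And>x. \<epsilon> * m \<le> L n x" "\<And>x. L n x \<le> L (Suc n) x"
      "\<And>x. L (Suc n) x \<le> U (Suc n) x" "\<And>x. U (Suc n) x \<le> U n x" "\<And>x. U n x \<le> M" by auto
    have nn: "0 \<le> L n x" "0 \<le> L (Suc n) x" "0 \<le> U (Suc n) x" "0 \<le> U n x" "U (Suc n) x \<le> M" "L (Suc n) x \<le> M" for x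
      using IH(3-7)[of x] \<epsilon>m by linarith+
    have c: "U (Suc n) \<in> C_per" "L (Suc n) \<in> C_per"
      unfolding Usuc Lsuc by (intro stat_step_C_per IH nn)+
    note me = c[THEN C_per_measurable] IH(1,2)[THEN C_per_measurable]
    have "stat_step C (L n) x \<le> stat_step C (L (Suc n)) x" for x
      by (rule stat_step_mono[OF C me(4) me(2) nn(1) IH(4) nn(6)])
    moreover have "stat_step C (L (Suc n)) x \<le> stat_step C (U (Suc n)) x" for x
      by (rule stat_step_mono[OF C me(2) me(1) nn(2) IH(5) nn(5)])
    moreover have "stat_step C (U (Suc n)) x \<le> stat_step C (U n) x" for x
      by (rule stat_step_mono[OF C me(1) me(3) nn(3) IH(6) IH(7)])
    ultimately have "L (Suc n) x \<le> L (Suc (Suc n)) x" "L (Suc (Suc n)) x \<le> U (Suc (Suc n)) x"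
      "U (Suc (Suc n)) x \<le> U (Suc n) x" for x
      by (simp_all only: Lsuc[symmetric] Usuc[symmetric])
    moreover have "\<epsilon> * m \<le> L (Suc n) x" for x using IH(3,4)[of x] by linarith
    ultimately show ?case using c nn by blast
  qed
  have UC: "U n \<in> C_per" "L n \<in> C_per" for n using inv by auto
  have mono: "\<epsilon> * m \<le> L n x" "L n x \<le> L (Suc n) x" "U (Suc n) x \<le> U n x" "U n x \<le> M" for n x using inv[of n] by auto
  have LU: "L n x \<le> U n x" for n x using inv[of n] by (meson order_trans)
  have incL: "incseq (\<lambda>n. L n x)" and decU: "decseq (\<lambda>n. U n x)" for x
    using mono by (auto intro: incseq_SucI decseq_SucI)
  have bL: "L n x \<le> M" and bU: "\<epsilon> * m \<le> U n x" for n x using mono LU order_trans by metis+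
  have "\<exists>a. (\<lambda>n. L n x) \<longlonglongrightarrow> a \<and> (\<forall>n. L n x \<le> a)" for x
  proof -
    have "\<forall>n. L n x \<le> M" using bL by simp
    then show ?thesis by (rule incseq_convergent[OF incL]) (intro exI conjI)
  qed
  then obtain l where l: "\<And>x. (\<lambda>n. L n x) \<longlonglongrightarrow> l x" "\<And>n x. L n x \<le> l x"
    by metis
  have "\<exists>a. (\<lambda>n. U n x) \<longlonglongrightarrow> a \<and> (\<forall>n. a \<le> U n x)" for x
  proof -
    have "\<forall>n. \<epsilon> * m \<le> U n x" using bU by simp
    then show ?thesis by (rule decseq_convergent[OF decU]) (intro exI conjI)
  qed
  then obtain u where u: "\<And>x. (\<lambda>n. U n x) \<longlonglongrightarrow> u x" "\<And>n x. u x \<le> U n x"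
    by metis
  have lb: "\<epsilon> * m \<le> l x" "l x \<le> M" "\<epsilon> * m \<le> u x" "u x \<le> M" for x
    by (rule LIMSEQ_le_const[OF l(1)] LIMSEQ_le_const2[OF l(1)] LIMSEQ_le_const[OF u(1)] LIMSEQ_le_const2[OF u(1)],
        use bL bU mono in blast)+
  note me = UC[THEN C_per_measurable]
  have lm: "l \<in> borel_measurable borel" and um: "u \<in> borel_measurable borel"
    by (rule borel_measurable_LIMSEQ_real[where u=L], use l(1) me in auto)
       (rule borel_measurable_LIMSEQ_real[where u=U], use u(1) me in auto)
  have nn: "0 \<le> L n x" "0 \<le> U n x" for n x using mono(1)[of n x] bU[of n x] \<epsilon>m by linarith+
  have leq: "conv J l x - l x + f x (l x) = 0" for x
    by (rule stat_step_limit[OF C(1) me(2) nn(1) bL l(1) Lsuc])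
  have ueq: "conv J u x - u x + f x (u x) = 0" for x
    by (rule stat_step_limit[OF C(1) me(1) nn(2) mono(4) u(1) Usuc])
  have "u x \<le> l x" for x
    by (rule stationary_compare[OF lm um \<epsilon>m lb(1,2) lb(3,4)]) (simp_all add: leq ueq)
  moreover have "l x \<le> u x" for x by (rule LIMSEQ_le[OF l(1) u(1)]) (use LU in blast)
  ultimately have ul: "u = l" by (auto intro: antisym)
  have "isCont l x" for x
    unfolding isCont_def
  proof (rule order_tendstoI)
    fix b assume "b < l x"
    then have "\<forall>\<^sub>F n in sequentially. b < L n x" using l(1) order_tendstoD(1) by blast
    then obtain n where n: "b < L n x" by (auto simp: eventually_sequentially)
    have "isCont (L n) x" using C_perD(1)[OF UC(2)] by (simp add: continuous_on_eq_continuous_at)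
    then have "\<forall>\<^sub>F y in at x. b < L n y" using n order_tendstoD(1) isCont_def by blast
    then show "\<forall>\<^sub>F y in at x. b < l y" by eventually_elim (use l(2) in \<open>auto intro: less_le_trans\<close>)
  next
    fix b assume "l x < b"
    then have "\<forall>\<^sub>F n in sequentially. U n x < b" using u(1) order_tendstoD(2) ul by blast
    then obtain n where n: "U n x < b" by (auto simp: eventually_sequentially)
    have "isCont (U n) x" using C_perD(1)[OF UC(1)] by (simp add: continuous_on_eq_continuous_at)
    then have "\<forall>\<^sub>F y in at x. U n y < b" using n order_tendstoD(2) isCont_def by blast
    then show "\<forall>\<^sub>F y in at x. l y < b" by eventually_elim (use u(2) ul in \<open>auto intro: le_less_trans\<close>)
  qed
  moreover have "periodic l"
    unfolding periodic_def
  proof (intro allI impI)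
    fix x k :: "real^'n" assume "\<forall>i. k $ i \<in> \<int>"
    then have "L n (x + k) = L n x" for n using periodicD[OF C_perD(2)[OF UC(2)]] by blast
    then show "l (x + k) = l x" using l(1)[of x] l(1)[of "x + k"] LIMSEQ_unique by simp
  qed
  ultimately have "l \<in> C_per" by (simp add: C_per_def continuous_on_eq_continuous_at)
  moreover have "0 < l x" for x using lb(1)[of x] \<epsilon>m by linarith
  ultimately show ?thesis using that leq by blast
qed

definition p where "p = stationary_state J f"

lemma p: "p \<in> C_per" "0 < p x" "conv J p x - p x + f x (p x) = 0"
proof -
  let ?P = "\<lambda>p. p \<in> C_per \<and> (\<forall>x. 0 < p x) \<and> (\<forall>x. conv J p x - p x + f x (p x) = 0)"
  have "\<exists>!p. ?P p"
  proof (rule ex_ex1I)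
    show "\<exists>p. ?P p" using stationary_exists by metis
    have le: "q x \<le> q' x" if q: "?P q" "?P q'" for q q' x
    proof -
      obtain m M where 1: "0 < m" "\<And>x. m \<le> q x" "0 < M" "\<And>x. q x \<le> M" using C_per_pos_bounds[of q] q by metis
      obtain m' M' where 2: "0 < m'" "\<And>x. m' \<le> q' x" "0 < M'" "\<And>x. q' x \<le> M'" using C_per_pos_bounds[of q'] q by metis
      show ?thesis
        by (rule stationary_compare[where m="min m m'" and M="max M M'"])
           (use q 1 2 C_per_measurable in \<open>auto simp: le_max_iff_disj min_le_iff_disj\<close>)
    qed
    show "q = q'" if "?P q" "?P q'" for q q' using le[OF that] le[OF that(2,1)] by (intro ext antisym)
  qed
  from theI'[OF this] show "p \<in> C_per" "0 < p x" "conv J p x - p x + f x (p x) = 0"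
    unfolding p_def stationary_state_def by auto
qed

end

subsection \<open>Exponential memory kernels\<close>

definition kap :: "real \<Rightarrow> real \<Rightarrow> real" where "kap K r = indicator {0..} r * exp (- K * r)"

lemma kap_nonneg: "0 \<le> kap K r" by (simp add: kap_def)

lemma kap_measurable [measurable]: "kap K \<in> borel_measurable borel"
  unfolding kap_def[abs_def] by measurable

lemma kap_integral:
  assumes "0 < K"
  shows "integrable lborel (kap K)" "(LINT r|lborel. kap K r) = 1 / K"
proof -
  have "(\<integral>\<^sup>+ r. ennreal (exp (- K * r)) * indicator {0..} r \<partial>lborel) = ennreal (0 - (- exp (- K * 0) / K))"
  proof (rule nn_integral_FTC_atLeast)
    fix r :: real
    show "((\<lambda>r. - exp (- K * r) / K) has_real_derivative exp (- K * r)) (at r)"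
      using assms by (auto intro!: derivative_eq_intros)
    have "filterlim (\<lambda>r. K * r) at_top at_top"
      by (rule filterlim_tendsto_pos_mult_at_top[OF tendsto_const assms filterlim_ident])
    then have "filterlim (\<lambda>r. - K * r) at_bot at_top" by (simp add: filterlim_uminus_at_bot)
    then have "((\<lambda>r. exp (- K * r)) \<longlongrightarrow> 0) at_top" by (rule filterlim_compose[OF exp_at_bot])
    then have "((\<lambda>r. - exp (- K * r) / K) \<longlongrightarrow> - 0 / K) at_top" by (intro tendsto_intros) (use assms in auto)
    then show "((\<lambda>r. - exp (- K * r) / K) \<longlongrightarrow> 0) at_top" by simp
  qed auto
  then have nn: "(\<integral>\<^sup>+ r. ennreal (kap K r) \<partial>lborel) = ennreal (1 / K)"
    by (simp add: kap_def[abs_def] ennreal_mult' ennreal_indicator mult.commute)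
  show i: "integrable lborel (kap K)"
    by (rule integrableI_nonneg) (use nn kap_nonneg in \<open>auto intro: always_eventually simp: less_top[symmetric]\<close>)
  show "(LINT r|lborel. kap K r) = 1 / K"
    using nn assms kap_nonneg by (subst integral_eq_nn_integral) auto
qed

lemma kap_mult_exp: "kap K r * exp (- L * r) = kap (K + L) r"
  by (simp add: kap_def exp_add[symmetric] algebra_simps)

lemma kap_integrable_mult:
  assumes "0 < K" and [measurable]: "g \<in> borel_measurable borel" and "\<And>r. 0 \<le> r \<Longrightarrow> \<bar>g r\<bar> \<le> B"
  shows "integrable lborel (\<lambda>r. kap K r * g r)"
proof (rule Bochner_Integration.integrable_bound)
  show "integrable lborel (\<lambda>r. kap K r * B)" by (intro integrable_mult_left kap_integral assms)
  show "AE r in lborel. norm (kap K r * g r) \<le> norm (kap K r * B)"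
    using assms(3) by (intro always_eventually allI)
      (auto simp: kap_def indicator_def abs_mult intro!: mult_left_mono intro: order_trans[OF _ abs_ge_self])
qed measurable

text \<open>For bounded measurable \<open>g\<close> the memory term is already continuous; it is
  differentiable once \<open>g\<close> is continuous. This gain of regularity in two steps turns a
  measurable fixed point into a solution.\<close>

lemma kap_memory:
  fixes g :: "real \<Rightarrow> real"
  assumes K: "0 < K" and [measurable]: "g \<in> borel_measurable borel" and B: "\<And>r. \<bar>g r\<bar> \<le> B"
  defines "V \<equiv> \<lambda>t. LINT r|lborel. kap K r * g (t - r)"
  shows "continuous_on UNIV V"
    and "continuous_on UNIV g \<Longrightarrow> (V has_real_derivative g t - K * V t) (at t)"
proof -
  define h where "h r = exp (K * r) * g r" for r
  have [measurable]: "h \<in> borel_measurable borel" unfolding h_def[abs_def] by measurable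
  have B0: "0 \<le> B" using B[of 0] by auto
  \<comment> \<open>The factor exp (- K t) separates from the kernel and leaves an integral whose
    only dependence on t is its upper limit.\<close>
  have V_eq: "V t = exp (- K * t) * (LINT r|lborel. indicator {..t} r * h r)" for t
  proof -
    have "V t = (LINT y|lborel. kap K (t - y) * g (t - (t - y)))"
      unfolding V_def using lborel_integral_reflect[of "\<lambda>r. kap K r * g (t - r)" t] by simp
    also have "\<dots> = (LINT r|lborel. exp (- K * t) * (indicator {..t} r * h r))"
      by (intro Bochner_Integration.integral_cong)
         (auto simp: kap_def h_def indicator_def exp_add[symmetric] algebra_simps mult_exp_exp)
    finally show ?thesis by simp
  qed
  have int: "integrable lborel (\<lambda>r. indicator S r * h r)" if S: "S \<subseteq> {..t}" "S \<in> sets borel" for t S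
  proof (rule Bochner_Integration.integrable_bound)
    have "integrable lborel (\<lambda>r. kap K (t - r))" by (intro lborel_integrable_reflect kap_integral K)
    then show "integrable lborel (\<lambda>r. exp (K * t) * B * kap K (t - r))" by (intro integrable_mult_right)
    show "AE r in lborel. norm (indicator S r * h r) \<le> norm (exp (K * t) * B * kap K (t - r))"
    proof (intro always_eventually allI)
      fix r
      show "norm (indicator S r * h r) \<le> norm (exp (K * t) * B * kap K (t - r))"
      proof (cases "r \<in> S")
        case True
        then have "r \<le> t" using S by auto
        then have eq: "exp (K * t) * B * kap K (t - r) = exp (K * r) * B"
          using mult_exp_exp[of "K * t" "- K * (t - r)"] by (simp add: kap_def algebra_simps)
        show ?thesis unfolding eq using True B[of r] B0 by (simp add: h_def abs_mult)
      qed auto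
    qed
    show "(\<lambda>r. indicator S r * h r) \<in> borel_measurable lborel" using S(2) by measurable
  qed
  have split: "V s = exp (- K * s) * ((LINT r|lborel. indicator {..<a} r * h r) + integral {a..s} h)" if "a \<le> s" for a s
  proof -
    have "(LINT r|lborel. indicator {..s} r * h r) = (LINT r|lborel. indicator {..<a} r * h r + indicator {a..s} r * h r)"
      using that by (intro Bochner_Integration.integral_cong) (auto simp: indicator_def)
    also have "\<dots> = (LINT r|lborel. indicator {..<a} r * h r) + (LINT r|lborel. indicator {a..s} r * h r)"
      by (intro Bochner_Integration.integral_add int[where t=s]) (use that in auto)
    also have "(LINT r|lborel. indicator {a..s} r * h r) = integral {a..s} h"
      using set_borel_integral_eq_integral(2)[of "{a..s}" h] int[of "{a..s}" s]
      by (simp add: set_integrable_def set_lebesgue_integral_def)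
    finally show ?thesis by (simp add: V_eq)
  qed
  have hint: "h integrable_on {a..b}" for a b
    using set_borel_integral_eq_integral(1)[of "{a..b}" h] int[of "{a..b}" b]
    by (simp add: set_integrable_def)
  have "isCont V t" for t
  proof -
    have "continuous_on {t - 1..t + 1} (\<lambda>s. exp (- K * s) * ((LINT r|lborel. indicator {..<t-1} r * h r) + integral {t-1..s} h))"
      by (intro continuous_intros indefinite_integral_continuous_1 hint)
    then have "continuous_on {t - 1..t + 1} V" by (rule continuous_on_eq) (rule split[symmetric], simp)
    then show ?thesis by (rule continuous_on_interior) (simp add: interior_atLeastAtMost_real)
  qed
  then show "continuous_on UNIV V" by (simp add: continuous_at_imp_continuous_on)
  assume "continuous_on UNIV g"
  then have hc: "continuous_on S h" for S unfolding h_def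
    by (intro continuous_intros) (erule continuous_on_subset, simp)
  have "((\<lambda>s. integral {t-1..s} h) has_real_derivative h t) (at t within {t-1..t+1})"
    by (intro integral_has_real_derivative hc) simp
  moreover have "at t within {t-1..t+1} = at t"
    by (rule at_within_interior) (simp add: interior_atLeastAtMost_real)
  ultimately have I: "((\<lambda>s. integral {t-1..s} h) has_real_derivative h t) (at t)"
    by (simp only:)
  let ?A = "LINT r|lborel. indicator {..<t-1} r * h r"
  have "((\<lambda>s. exp (- K * s) * (?A + integral {t-1..s} h)) has_real_derivative
      exp (- K * t) * (0 + h t) + (exp (- K * t) * (- K * 1)) * (?A + integral {t-1..t} h)) (at t)"
    by (intro DERIV_mult' DERIV_add DERIV_const I DERIV_fun_exp DERIV_cmult DERIV_ident)
  moreover have "exp (- K * t) * (0 + h t) = g t" by (simp add: h_def mult_exp_exp mult.assoc[symmetric])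
  then have "exp (- K * t) * (0 + h t) + (exp (- K * t) * (- K * 1)) * (?A + integral {t-1..t} h) = g t - K * V t"
    using split[of "t-1" t] by simp
  ultimately have "((\<lambda>s. exp (- K * s) * (?A + integral {t-1..s} h)) has_real_derivative g t - K * V t) (at t)"
    by (simp only:)
  then show "(V has_real_derivative g t - K * V t) (at t)"
  proof (rule has_field_derivative_transform_within_open)
    show "open {t-1<..<t+1}" "t \<in> {t-1<..<t+1}" by auto
    fix s assume "s \<in> {t-1<..<t+1}"
    then have "t - 1 \<le> s" by simp
    then show "exp (- K * s) * (?A + integral {t-1..s} h) = V s" by (rule split[symmetric])
  qed
qed

subsection \<open>Monotone iteration for front profiles\<close>

text \<open>\<open>C\<close> serves two purposes: \<open>C_lip\<close> makes the nonlinear part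
  order preserving on values up to \<open>pM\<close>, and \<open>C_fu\<close> makes the linearized
  part order preserving on values of any size, such as growing exponentials.\<close>

locale kpp_front = kpp f J e \<phi>0 \<nu>0
  for f :: "real^'n \<Rightarrow> real \<Rightarrow> real" and J e \<phi>0 \<nu>0 +
  fixes c C pm pM :: real
  assumes c: "0 < c" and C: "0 < C" and C_fu: "\<And>x. 0 \<le> C + f_u f x 0"
    and C_lip: "\<And>x u v. 0 \<le> u \<Longrightarrow> u \<le> v \<Longrightarrow> v \<le> pM \<Longrightarrow> f x u + C * u \<le> f x v + C * v"
    and pm: "0 < pm" "\<And>x. pm \<le> p x" "\<And>x. p x \<le> pM"
begin

definition adm :: "(real \<Rightarrow> real^'n \<Rightarrow> real) \<Rightarrow> bool" where
  "adm \<psi> \<longleftrightarrow> (\<lambda>z. \<psi> (fst z) (snd z)) \<in> borel_measurable (borel \<Otimes>\<^sub>M borel) \<and> (\<forall>s x. 0 \<le> \<psi> s x \<and> \<psi> s x \<le> p x)"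

text \<open>In the coordinate s = x.e + ct, the point y at the same time has coordinate s - (x -
  y).e; so this is J * u + C u + f(x, u).\<close>

definition GG :: "(real \<Rightarrow> real^'n \<Rightarrow> real) \<Rightarrow> real \<Rightarrow> real^'n \<Rightarrow> real" where
  "GG \<psi> s x = conv J (\<lambda>y. \<psi> (s - (x - y) \<bullet> e) y) x + (C * \<psi> s x + f x (\<psi> s x))"

text \<open>Going back in time by r at fixed x lowers s by c r.\<close>

definition Gam :: "(real \<Rightarrow> real^'n \<Rightarrow> real) \<Rightarrow> real \<Rightarrow> real^'n \<Rightarrow> real" where
  "Gam \<psi> s x = (LINT r|lborel. kap (C + 1) r * GG \<psi> (s - c * r) x)"

lemma admD: "adm \<psi> \<Longrightarrow> 0 \<le> \<psi> s x" "adm \<psi> \<Longrightarrow> \<psi> s x \<le> p x" "adm \<psi> \<Longrightarrow> \<psi> s x \<le> pM" "adm \<psi> \<Longrightarrow> \<bar>\<psi> s x\<bar> \<le> pM"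
  using pm(3)[of x] unfolding adm_def by (auto intro: order_trans simp: abs_of_nonneg)

lemma adm_measurable:
  assumes "adm \<psi>" and [measurable]: "g \<in> borel_measurable M" "h \<in> measurable M borel"
  shows "(\<lambda>w. \<psi> (g w) (h w)) \<in> borel_measurable M"
proof -
  have "(\<lambda>w. (g w, h w)) \<in> M \<rightarrow>\<^sub>M borel \<Otimes>\<^sub>M borel" by measurable
  then show ?thesis using measurable_compose[of "\<lambda>w. (g w, h w)" M "borel \<Otimes>\<^sub>M borel" "\<lambda>z. \<psi> (fst z) (snd z)"] assms(1)
    by (simp add: adm_def)
qed

lemma adm_p: "adm (\<lambda>s. p)"
proof -
  have [measurable]: "p \<in> borel_measurable borel" by (rule C_per_measurable[OF p(1)])
  have "(\<lambda>z::real \<times> (real^'n). p (snd z)) \<in> borel_measurable (borel \<Otimes>\<^sub>M borel)" by measurable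
  then show ?thesis unfolding adm_def using p(2) by (auto simp: less_imp_le)
qed

lemma adm_0: "adm (\<lambda>s x. 0)"
  unfolding adm_def using p(2) by (auto simp: less_imp_le)

lemma GG_p: "GG (\<lambda>s. p) s x = (C + 1) * p x"
  using p(3)[of x] by (simp add: GG_def algebra_simps)

lemma GG_measurable:
  assumes "adm \<psi>"
  shows "(\<lambda>z. GG \<psi> (fst z) (snd z)) \<in> borel_measurable (borel \<Otimes>\<^sub>M borel)"
proof -
  note [measurable] = adm_measurable[OF assms]
  have "(\<lambda>z. LINT y|lborel. J (snd z - y) * \<psi> (fst z - (snd z - y) \<bullet> e) y) \<in> borel_measurable (borel \<Otimes>\<^sub>M borel)"
    by measurable
  moreover have "(\<lambda>z. f (snd z) (\<psi> (fst z) (snd z))) \<in> borel_measurable (borel \<Otimes>\<^sub>M borel)"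
    by (intro f_measurable) (use admD(1)[OF assms] in measurable)
  ultimately show ?thesis unfolding GG_def conv_def by measurable
qed

lemma GG_measurable_s:
  assumes "adm \<psi>" and [measurable]: "g \<in> borel_measurable M" "h \<in> measurable M borel"
  shows "(\<lambda>w. GG \<psi> (g w) (h w)) \<in> borel_measurable M"
proof -
  have "(\<lambda>w. (g w, h w)) \<in> M \<rightarrow>\<^sub>M borel \<Otimes>\<^sub>M borel" by measurable
  from measurable_compose[OF this GG_measurable[OF assms(1)]] show ?thesis by simp
qed

lemma slice_measurable: "adm \<psi> \<Longrightarrow> (\<lambda>y. \<psi> (s - (x - y) \<bullet> e) y) \<in> borel_measurable borel"
  by (rule adm_measurable) measurable

lemma F_mono: "adm \<psi> \<Longrightarrow> 0 \<le> u \<Longrightarrow> u \<le> \<psi> s x \<Longrightarrow> C * u + f x u \<le> C * \<psi> s x + f x (\<psi> s x)"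
  using C_lip[of u "\<psi> s x" x] admD(3)[of \<psi> s x] by linarith

lemma GG_mono:
  assumes "adm \<psi>" "adm \<psi>'" "\<And>s x. \<psi> s x \<le> \<psi>' s x"
  shows "GG \<psi> s x \<le> GG \<psi>' s x"
  unfolding GG_def
  by (intro add_mono[OF _ F_mono] conv_mono[where C=pM] slice_measurable assms admD) 

lemma GG_bounds:
  assumes "adm \<psi>"
  shows "0 \<le> GG \<psi> s x" "GG \<psi> s x \<le> (C + 1) * pM" "\<bar>GG \<psi> s x\<bar> \<le> (C + 1) * pM"
proof -
  have "GG (\<lambda>s x. 0) s x = 0" by (simp add: GG_def)
  then show 1: "0 \<le> GG \<psi> s x" using GG_mono[OF adm_0 assms, of s x] admD[OF assms] by simp
  have "GG \<psi> s x \<le> (C + 1) * p x" using GG_mono[OF assms adm_p, of s x] admD[OF assms] by (simp add: GG_p)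
  also have "\<dots> \<le> (C + 1) * pM" using C pm by (intro mult_left_mono) auto
  finally show "GG \<psi> s x \<le> (C + 1) * pM" .
  then show "\<bar>GG \<psi> s x\<bar> \<le> (C + 1) * pM" using 1 by simp
qed

lemma Gam_integrable:
  assumes "adm \<psi>"
  shows "integrable lborel (\<lambda>r. kap (C + 1) r * GG \<psi> (s - c * r) x)"
  by (rule kap_integrable_mult[where B="(C + 1) * pM"])
     (use C GG_bounds[OF assms] in \<open>auto intro!: GG_measurable_s[OF assms]\<close>)

lemma Gam_mono:
  assumes "adm \<psi>" "adm \<psi>'" "\<And>s x. \<psi> s x \<le> \<psi>' s x"
  shows "Gam \<psi> s x \<le> Gam \<psi>' s x"
  unfolding Gam_def
  by (intro integral_mono Gam_integrable assms mult_left_mono GG_mono kap_nonneg)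

lemma Gam_p: "Gam (\<lambda>s. p) s x = p x"
  using C kap_integral(2)[of "C + 1"] by (simp add: Gam_def GG_p)

lemma Gam_adm:
  assumes "adm \<psi>"
  shows "adm (Gam \<psi>)"
  unfolding adm_def
proof (intro conjI allI)
  note [measurable] = GG_measurable_s[OF assms]
  show "(\<lambda>z. Gam \<psi> (fst z) (snd z)) \<in> borel_measurable (borel \<Otimes>\<^sub>M borel)"
    unfolding Gam_def by measurable
  show "0 \<le> Gam \<psi> s x" for s x
    unfolding Gam_def using GG_bounds(1)[OF assms] kap_nonneg by (intro Bochner_Integration.integral_nonneg mult_nonneg_nonneg) 
  show "Gam \<psi> s x \<le> p x" for s x
    using Gam_mono[OF assms adm_p, of s x] admD[OF assms] by (simp add: Gam_p)
qed

lemma Gam_tendsto: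
  assumes "\<And>i. adm (w i)" "adm \<psi>" "\<And>s x. (\<lambda>i. w i s x) \<longlonglongrightarrow> \<psi> s x"
  shows "(\<lambda>i. Gam (w i) s x) \<longlonglongrightarrow> Gam \<psi> s x"
  unfolding Gam_def
proof (rule integral_dominated_convergence[where w="\<lambda>r. kap (C + 1) r * ((C + 1) * pM)"])
  note [measurable] = GG_measurable_s[OF assms(1)] GG_measurable_s[OF assms(2)]
  show "(\<lambda>r. kap (C + 1) r * GG \<psi> (s - c * r) x) \<in> borel_measurable lborel" by measurable
  show "(\<lambda>r. kap (C + 1) r * GG (w i) (s - c * r) x) \<in> borel_measurable lborel" for i by measurable
  show "integrable lborel (\<lambda>r. kap (C + 1) r * ((C + 1) * pM))" using C by (intro integrable_mult_left kap_integral) auto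
  have "(\<lambda>i. GG (w i) s x) \<longlonglongrightarrow> GG \<psi> s x" for s
    unfolding GG_def
    by (intro tendsto_intros conv_tendsto[where C=pM] f_tendsto assms slice_measurable admD)
  then show "AE r in lborel. (\<lambda>i. kap (C + 1) r * GG (w i) (s - c * r) x) \<longlonglongrightarrow> kap (C + 1) r * GG \<psi> (s - c * r) x"
    by (intro always_eventually allI tendsto_mult tendsto_const)
  show "AE r in lborel. norm (kap (C + 1) r * GG (w i) (s - c * r) x) \<le> kap (C + 1) r * ((C + 1) * pM)" for i
    using GG_bounds(3)[OF assms(1)] kap_nonneg
    by (intro always_eventually allI) (auto simp: abs_mult intro!: mult_left_mono)
qed

text \<open>A fixed point of \<open>Gam\<close> solves the evolution equation: \<open>Gam\<close> is the variation of constants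
  formula for \<open>\<partial>\<^sub>t u + (C + 1) u = J * u + C u + f(x, u)\<close>.\<close>

lemma fixed_point_entire_solution:
  assumes "adm \<psi>" "\<And>s x. Gam \<psi> s x = \<psi> s x"
  shows "entire_solution J f (\<lambda>x t. \<psi> (x \<bullet> e + c * t) x)"
proof -
  define u where "u x t = \<psi> (x \<bullet> e + c * t) x" for x t
  define g where "g x t = GG \<psi> (x \<bullet> e + c * t) x" for x t
  have ub: "0 \<le> u x t" "\<bar>u x t\<bar> \<le> pM" for x t using admD[OF assms(1)] by (auto simp: u_def)
  have um: "(\<lambda>y. u y t) \<in> borel_measurable borel" for t
    unfolding u_def by (rule adm_measurable[OF assms(1)]) measurable
  have gm: "g x \<in> borel_measurable borel" for x
    unfolding g_def[abs_def] by (rule GG_measurable_s[OF assms(1)]) measurable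
  have gb: "\<bar>g x t\<bar> \<le> (C + 1) * pM" for x t unfolding g_def by (rule GG_bounds[OF assms(1)])
  have g_eq: "g x t = conv J (\<lambda>y. u y t) x + (C * u x t + f x (u x t))" for x t
    by (simp add: g_def GG_def u_def inner_diff_left algebra_simps)
  have u_eq: "u x = (\<lambda>t. LINT r|lborel. kap (C + 1) r * g x (t - r))" for x
    using assms(2)[symmetric] by (simp add: fun_eq_iff u_def g_def Gam_def algebra_simps)
  \<comment> \<open>Bootstrap in time: the profile is only measurable, but u is a memory integral,
    hence continuous in t; then so is \<open>g\<close> by dominated convergence, and the memory
    integral is differentiable.\<close>
  have uc: "continuous_on UNIV (u x)" for x
    unfolding u_eq using C by (intro kap_memory(1)[OF _ gm gb]) auto
  have gc: "continuous_on UNIV (g x)" for x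
    unfolding continuous_on_sequentially
  proof (intro allI ballI impI, elim conjE)
    fix T t assume T: "T \<longlonglongrightarrow> (t::real)"
    have uT: "(\<lambda>i. u y (T i)) \<longlonglongrightarrow> u y t" for y
      using continuous_on_tendsto_compose[OF uc T] by simp
    have "(\<lambda>i. g x (T i)) \<longlonglongrightarrow> g x t"
      unfolding g_eq by (intro tendsto_intros conv_tendsto[where C=pM] f_tendsto uT um ub)
    then show "(g x \<circ> T) \<longlonglongrightarrow> g x t" by (simp add: o_def)
  qed
  have "(u x has_real_derivative g x t - (C + 1) * u x t) (at t)" for x t
    using kap_memory(2)[OF _ gm gb gc, of "C + 1" x t] C
    by (simp add: u_eq[symmetric] fun_cong[OF u_eq, symmetric])
  then have "((\<lambda>\<tau>. u x \<tau>) has_real_derivative conv J (\<lambda>y. u y t) x - u x t + f x (u x t)) (at t)" for x t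
    by (simp add: g_eq algebra_simps)
  moreover have "integrable lborel (\<lambda>y. J (x - y) * u y t)" for x t
    using lborel_integrable_reflect[OF integrable_conv'[OF um ub(2)], of x x] by simp
  ultimately show ?thesis using ub unfolding entire_solution_def u_def by blast
qed

section \<open>Exponential super- and subsolutions of the fixed point equation\<close>

abbreviation a where "a \<equiv> (\<lambda>x. f_u f x 0 - 1)"

text \<open>The shift s - (x - y).e tilts the kernel by -l rather than l; the evenness of
  \<open>nu\<close> compensates for this in \<open>front_exists\<close>.\<close>

lemma exp_slice: "J (x - y) * (exp (l * (s - (x - y) \<bullet> e)) * \<xi> y) = exp (l * s) * (Jt (- l) (x - y) * \<xi> y)"
  using mult_exp_exp[of "l * s" "- l * ((x - y) \<bullet> e)"] by (simp add: tilted_kernel_def right_diff_distrib exp_diff exp_minus field_simps)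

lemma exp_slice_integrable:
  assumes "\<xi> \<in> C_per"
  shows "integrable lborel (\<lambda>y. J (x - y) * (exp (l * (s - (x - y) \<bullet> e)) * \<xi> y))"
proof -
  obtain B where "\<And>x. \<bar>\<xi> x\<bar> \<le> B" using C_per_bounded[OF assms] by blast
  then have "integrable lborel (\<lambda>y. Jt (- l) (x - y) * \<xi> y)"
    using lborel_integrable_reflect[OF tk.integrable_conv'[OF C_per_measurable[OF assms]], of B "- l" x x] by simp
  then show ?thesis unfolding exp_slice by (rule integrable_mult_right)
qed

lemma conv_exp: "conv J (\<lambda>y. exp (l * (s - (x - y) \<bullet> e)) * \<xi> y) x = exp (l * s) * conv (Jt (- l)) \<xi> x"
  unfolding conv_def exp_slice by simp

lemma conv_exp_diff:
  assumes "\<xi> \<in> C_per" "\<xi>' \<in> C_per"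
  shows "conv J (\<lambda>y. exp (l * (s - (x - y) \<bullet> e)) * \<xi> y - exp (l' * (s - (x - y) \<bullet> e)) * \<xi>' y) x
    = exp (l * s) * conv (Jt (- l)) \<xi> x - exp (l' * s) * conv (Jt (- l')) \<xi>' x"
proof -
  have eq: "J (x - y) * (u - w) = J (x - y) * u - J (x - y) * w" for y u w by (rule right_diff_distrib)
  show ?thesis
    unfolding conv_exp[symmetric] unfolding conv_def eq
    by (intro Bochner_Integration.integral_diff exp_slice_integrable assms)
qed

lemma exp_slice_bound:
  assumes "\<And>y. \<bar>\<xi> y\<bar> \<le> B" "norm (x - y) \<le> 1"
  shows "\<bar>exp (l * (s - (x - y) \<bullet> e)) * \<xi> y\<bar> \<le> exp (\<bar>l\<bar> * (\<bar>s\<bar> + 1)) * B"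
proof -
  have "l * (s - (x - y) \<bullet> e) \<le> \<bar>l\<bar> * \<bar>s - (x - y) \<bullet> e\<bar>" by (simp add: abs_mult[symmetric])
  also have "\<dots> \<le> \<bar>l\<bar> * (\<bar>s\<bar> + 1)" using inner_e_bound[OF assms(2)] by (intro mult_left_mono) (auto simp: abs_le_iff)
  finally have "exp (l * (s - (x - y) \<bullet> e)) \<le> exp (\<bar>l\<bar> * (\<bar>s\<bar> + 1))" by simp
  then show ?thesis unfolding abs_mult using assms(1)[of y] by (intro mult_mono) auto
qed

text \<open>The memory integral acts on e^(ls) as division by C + 1 + l c. This is exactly the
  factor that the linearization of \<open>GG\<close> produces on an eigenfunction with eigenvalue c
  l, so the corresponding exponential is fixed by the linearized map.\<close>

lemma kap_exp_integral:
  assumes "0 < l"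
  shows "integrable lborel (\<lambda>r. kap (C + 1) r * (exp (l * (s - c * r)) * b))"
    and "(LINT r|lborel. kap (C + 1) r * (exp (l * (s - c * r)) * b)) = exp (l * s) * b / (C + 1 + l * c)"
proof -
  have pos: "0 < C + 1 + l * c" using C c assms by (simp add: add_pos_pos)
  have eq: "kap (C + 1) r * (exp (l * (s - c * r)) * b) = exp (l * s) * b * kap (C + 1 + l * c) r" for r
  proof -
    have "exp (l * (s - c * r)) = exp (l * s) * exp (- (l * c) * r)" by (simp add: mult_exp_exp algebra_simps)
    then show ?thesis unfolding kap_mult_exp[symmetric] by simp
  qed
  show "integrable lborel (\<lambda>r. kap (C + 1) r * (exp (l * (s - c * r)) * b))"
    unfolding eq by (intro integrable_mult_right kap_integral pos)
  show "(LINT r|lborel. kap (C + 1) r * (exp (l * (s - c * r)) * b)) = exp (l * s) * b / (C + 1 + l * c)"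
    unfolding eq using kap_integral(2)[OF pos] by simp
qed

text \<open>\<open>f\<close> lies below its linearization, for which e^(ls) \<phi> is a fixed point
  because the eigenvalue is c l.\<close>

lemma Gam_le_exp:
  assumes \<psi>: "adm \<psi>" and l: "0 < l" and eig: "tk.eigen (- l) a (c * l) \<phi>"
    and le: "\<And>s x. \<psi> s x \<le> exp (l * s) * \<phi> x"
  shows "Gam \<psi> s x \<le> exp (l * s) * \<phi> x"
proof -
  have \<phi>: "\<phi> \<in> C_per" "\<And>x. 0 < \<phi> x" "\<And>x. conv (Jt (- l)) \<phi> x = (c * l - a x) * \<phi> x" using eig by (auto simp: tk.eigen_def)
  obtain B where B: "\<And>x. \<bar>\<phi> x\<bar> \<le> B" using C_per_bounded[OF \<phi>(1)] by blast
  note [measurable] = C_per_measurable[OF \<phi>(1)]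
  have GG: "GG \<psi> s x \<le> exp (l * s) * (\<phi> x * (C + 1 + l * c))" for s
  proof -
    have "conv J (\<lambda>y. \<psi> (s - (x - y) \<bullet> e) y) x \<le> conv J (\<lambda>y. exp (l * (s - (x - y) \<bullet> e)) * \<phi> y) x"
    proof (rule conv_mono[where C="max pM (exp (\<bar>l\<bar> * (\<bar>s\<bar> + 1)) * B)"])
      fix y assume "norm (x - y) \<le> 1"
      then show "\<bar>exp (l * (s - (x - y) \<bullet> e)) * \<phi> y\<bar> \<le> max pM (exp (\<bar>l\<bar> * (\<bar>s\<bar> + 1)) * B)"
        by (intro max.coboundedI2 exp_slice_bound B)
      show "\<bar>\<psi> (s - (x - y) \<bullet> e) y\<bar> \<le> max pM (exp (\<bar>l\<bar> * (\<bar>s\<bar> + 1)) * B)"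
        by (intro max.coboundedI1 admD \<psi>)
    qed (use le slice_measurable[OF \<psi>] in auto)
    also have "\<dots> = exp (l * s) * ((c * l - a x) * \<phi> x)" by (simp only: conv_exp \<phi>(3))
    finally have 1: "conv J (\<lambda>y. \<psi> (s - (x - y) \<bullet> e) y) x \<le> exp (l * s) * ((c * l - a x) * \<phi> x)" .
    have "C * \<psi> s x + f x (\<psi> s x) \<le> (C + f_u f x 0) * \<psi> s x"
      using f_le_linear[of "\<psi> s x" x] admD(1)[OF \<psi>, of s x] by (simp add: distrib_right)
    also have "\<dots> \<le> (C + f_u f x 0) * (exp (l * s) * \<phi> x)" using le C_fu by (intro mult_left_mono)
    finally have 2: "C * \<psi> s x + f x (\<psi> s x) \<le> (C + f_u f x 0) * (exp (l * s) * \<phi> x)" .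
    have "exp (l * s) * ((c * l - a x) * \<phi> x) + (C + f_u f x 0) * (exp (l * s) * \<phi> x) = exp (l * s) * (\<phi> x * (C + 1 + l * c))"
      by (simp add: algebra_simps)
    then show ?thesis using 1 2 unfolding GG_def by linarith
  qed
  have "Gam \<psi> s x \<le> (LINT r|lborel. kap (C + 1) r * (exp (l * (s - c * r)) * (\<phi> x * (C + 1 + l * c))))"
    unfolding Gam_def
    by (intro integral_mono Gam_integrable \<psi> kap_exp_integral l mult_left_mono GG kap_nonneg)
  also have "\<dots> = exp (l * s) * \<phi> x"
    using kap_exp_integral(2)[OF l, of s "\<phi> x * (C + 1 + l * c)"] C c l by (simp add: add_pos_pos less_imp_neq[THEN not_sym])
  finally show ?thesis .
qed

text \<open>The eigenvalue \<nu>' is below c l', so the subtracted exponential leaves a gain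
  proportional to A e^(l's). The quadratic loss is at most Q e^(2ls) \<phi>^2, which for s < 0 and
  l' \<le> 2 l is at most Q e^(l's) \<phi>^2; a large \<open>A\<close> covers it.\<close>

lemma Gam_ge_barrier:
  assumes \<psi>: "adm \<psi>" and l: "0 < l" "0 < l'" "l' \<le> 2 * l"
    and eig: "tk.eigen (- l) a (c * l) \<phi>" "tk.eigen (- l') a \<nu>' \<phi>'"
    and Q: "\<And>x u. 0 \<le> u \<Longrightarrow> u \<le> pM \<Longrightarrow> f_u f x 0 * u - Q * u\<^sup>2 \<le> f x u" "0 < Q"
    and A: "\<And>s x. 0 < exp (l * s) * \<phi> x - exp (l' * s) * (A * \<phi>' x) \<Longrightarrow> s < 0" "0 < A"
      "\<And>x. Q * (\<phi> x)\<^sup>2 \<le> A * \<phi>' x * (c * l' - \<nu>')"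
    and ge: "\<And>s x. exp (l * s) * \<phi> x - exp (l' * s) * (A * \<phi>' x) \<le> \<psi> s x"
  shows "exp (l * s) * \<phi> x - exp (l' * s) * (A * \<phi>' x) \<le> Gam \<psi> s x"
proof -
  define v where "v s x = exp (l * s) * \<phi> x - exp (l' * s) * (A * \<phi>' x)" for s x
  have \<phi>: "\<phi> \<in> C_per" "\<And>x. 0 < \<phi> x" "\<And>x. conv (Jt (- l)) \<phi> x = (c * l - a x) * \<phi> x" using eig by (auto simp: tk.eigen_def)
  have \<phi>': "\<phi>' \<in> C_per" "\<And>x. 0 < \<phi>' x" "\<And>x. conv (Jt (- l')) \<phi>' x = (\<nu>' - a x) * \<phi>' x" using eig by (auto simp: tk.eigen_def)
  have A\<phi>': "(\<lambda>x. A * \<phi>' x) \<in> C_per" by (intro C_per_cmult \<phi>')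
  obtain B where B: "\<And>x. \<bar>\<phi> x\<bar> \<le> B" using C_per_bounded[OF \<phi>(1)] by blast
  obtain B' where B': "\<And>x. \<bar>A * \<phi>' x\<bar> \<le> B'" using C_per_bounded[OF A\<phi>'] by blast
  note [measurable] = C_per_measurable[OF \<phi>(1)] C_per_measurable[OF \<phi>'(1)]
  \<comment> \<open>The coefficient of -e^(l's) in the lower bound for \<open>GG\<close>, quadratic
    loss included; assumption \<open>A(3)\<close> says exactly that b \<le> A \<phi>' (C + 1 + l'
    c).\<close>
  define b where "b = A * \<phi>' x * (\<nu>' + C + 1) + Q * (\<phi> x)\<^sup>2"
  have GG: "exp (l * s) * (\<phi> x * (C + 1 + l * c)) - exp (l' * s) * b \<le> GG \<psi> s x" for s
  proof -
    let ?D = "max pM (exp (\<bar>l\<bar> * (\<bar>s\<bar> + 1)) * B + exp (\<bar>l'\<bar> * (\<bar>s\<bar> + 1)) * B')"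
    have "conv J (\<lambda>y. v (s - (x - y) \<bullet> e) y) x \<le> conv J (\<lambda>y. \<psi> (s - (x - y) \<bullet> e) y) x"
    proof (rule conv_mono[where C="?D"])
      fix y assume y: "norm (x - y) \<le> 1"
      have "\<bar>v (s - (x - y) \<bullet> e) y\<bar> \<le> exp (\<bar>l\<bar> * (\<bar>s\<bar> + 1)) * B + exp (\<bar>l'\<bar> * (\<bar>s\<bar> + 1)) * B'"
        unfolding v_def
        by (rule order_trans[OF abs_triangle_ineq4 add_mono[OF exp_slice_bound[OF B y] exp_slice_bound[OF B' y]]])
      then show "\<bar>v (s - (x - y) \<bullet> e) y\<bar> \<le> ?D" by (rule max.coboundedI2)
      show "\<bar>\<psi> (s - (x - y) \<bullet> e) y\<bar> \<le> ?D" by (intro max.coboundedI1 admD \<psi>)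
      show "v (s - (x - y) \<bullet> e) y \<le> \<psi> (s - (x - y) \<bullet> e) y" unfolding v_def by (rule ge)
    next
      show "(\<lambda>y. v (s - (x - y) \<bullet> e) y) \<in> borel_measurable borel" unfolding v_def by measurable
    qed (rule slice_measurable[OF \<psi>])
    moreover have "conv J (\<lambda>y. v (s - (x - y) \<bullet> e) y) x
        = exp (l * s) * ((c * l - a x) * \<phi> x) - exp (l' * s) * (A * ((\<nu>' - a x) * \<phi>' x))"
      unfolding v_def by (simp only: conv_exp_diff[OF \<phi>(1) A\<phi>'] tk.conv_cmult \<phi>(3) \<phi>'(3))
    ultimately have 1: "exp (l * s) * ((c * l - a x) * \<phi> x) - exp (l' * s) * (A * ((\<nu>' - a x) * \<phi>' x))
        \<le> conv J (\<lambda>y. \<psi> (s - (x - y) \<bullet> e) y) x" by simp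
    \<comment> \<open>The truncation at 0 concerns the reaction term, as \<open>f\<close> is given
      for u \<ge> 0; in the convolution the possibly negative barrier is itself a valid lower
      bound.\<close>
    define w where "w = max (v s x) 0"
    have w: "0 \<le> w" "w \<le> \<psi> s x" "w \<le> pM" "v s x \<le> w"
      using ge[of s x] admD(1)[OF \<psi>, of s x] admD(3)[OF \<psi>, of s x] by (auto simp: w_def v_def)
    have w2: "w\<^sup>2 \<le> exp (l' * s) * (\<phi> x)\<^sup>2"
    proof (cases "0 < v s x")
      case True
      then have s: "s < 0" using A(1)[of s x] by (simp add: v_def)
      have "w \<le> exp (l * s) * \<phi> x" using True A(2) \<phi>'(2)[of x] by (simp add: w_def v_def)
      then have "w\<^sup>2 \<le> (exp (l * s) * \<phi> x)\<^sup>2" using w(1) by (intro power_mono)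
      also have "\<dots> = exp (2 * l * s) * (\<phi> x)\<^sup>2" 
        by (simp add: power_mult_distrib exp_double[symmetric] mult.assoc)
      also have "\<dots> \<le> exp (l' * s) * (\<phi> x)\<^sup>2"
        using mult_right_mono_neg[OF l(3), of s] s by (intro mult_right_mono) auto
      finally show ?thesis .
    qed (simp add: w_def)
    have "(C + f_u f x 0) * v s x - Q * (exp (l' * s) * (\<phi> x)\<^sup>2) \<le> (C + f_u f x 0) * w - Q * w\<^sup>2"
      using w2 w(4) C_fu[of x] Q(2) by (intro diff_mono mult_left_mono) auto
    also have "\<dots> \<le> C * w + f x w" using Q(1)[OF w(1,3), of x] by (simp add: algebra_simps)
    also have "\<dots> \<le> C * \<psi> s x + f x (\<psi> s x)" by (rule F_mono[OF \<psi> w(1,2)])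
    finally have 2: "(C + f_u f x 0) * v s x - Q * (exp (l' * s) * (\<phi> x)\<^sup>2) \<le> C * \<psi> s x + f x (\<psi> s x)" .
    have "exp (l * s) * ((c * l - a x) * \<phi> x) - exp (l' * s) * (A * ((\<nu>' - a x) * \<phi>' x))
       + ((C + f_u f x 0) * v s x - Q * (exp (l' * s) * (\<phi> x)\<^sup>2))
       = exp (l * s) * (\<phi> x * (C + 1 + l * c)) - exp (l' * s) * b"
      by (simp add: v_def b_def algebra_simps)
    then show ?thesis using 1 2 unfolding GG_def by linarith
  qed
  have pos: "0 < C + 1 + l * c" "0 < C + 1 + l' * c" using C c l by (simp_all add: add_pos_pos)
  have "b \<le> A * \<phi>' x * (C + 1 + l' * c)" using A(3)[of x] by (simp add: b_def algebra_simps)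
  then have "b / (C + 1 + l' * c) \<le> A * \<phi>' x" using pos by (simp add: pos_divide_le_eq)
  then have "exp (l' * s) * (b / (C + 1 + l' * c)) \<le> exp (l' * s) * (A * \<phi>' x)" by (intro mult_left_mono) auto
  then have "v s x \<le> exp (l * s) * (\<phi> x * (C + 1 + l * c)) / (C + 1 + l * c) - exp (l' * s) * b / (C + 1 + l' * c)"
    using pos by (simp add: v_def)
  also have "\<dots> = (LINT r|lborel. kap (C + 1) r * (exp (l * (s - c * r)) * (\<phi> x * (C + 1 + l * c)))
      - kap (C + 1) r * (exp (l' * (s - c * r)) * b))"
    using kap_exp_integral[OF l(1)] kap_exp_integral[OF l(2)] by simp
  also have "\<dots> \<le> Gam \<psi> s x"
    unfolding Gam_def
  proof (intro integral_mono Gam_integrable \<psi> Bochner_Integration.integrable_diff kap_exp_integral l)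
    fix r
    show "kap (C + 1) r * (exp (l * (s - c * r)) * (\<phi> x * (C + 1 + l * c))) - kap (C + 1) r * (exp (l' * (s - c * r)) * b)
        \<le> kap (C + 1) r * GG \<psi> (s - c * r) x"
      using mult_left_mono[OF GG[of "s - c * r"] kap_nonneg[of "C + 1" r]] by (simp only: right_diff_distrib)
  qed
  finally show ?thesis by (simp add: v_def)
qed

section \<open>Construction of the profile and its limit at plus infinity\<close>

lemma GG_mono_s:
  assumes "adm \<psi>" "\<And>s s' x. s \<le> s' \<Longrightarrow> \<psi> s x \<le> \<psi> s' x" "s \<le> s'"
  shows "GG \<psi> s x \<le> GG \<psi> s' x"
  unfolding GG_def
proof (rule add_mono)
  have "\<psi> (s - (x - y) \<bullet> e) y \<le> \<psi> (s' - (x - y) \<bullet> e) y" for y using assms(3) by (intro assms(2)) simp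
  then show "conv J (\<lambda>y. \<psi> (s - (x - y) \<bullet> e) y) x \<le> conv J (\<lambda>y. \<psi> (s' - (x - y) \<bullet> e) y) x"
    by (intro conv_mono[where C=pM] slice_measurable[OF assms(1)] admD(4)[OF assms(1)])
  show "C * \<psi> s x + f x (\<psi> s x) \<le> C * \<psi> s' x + f x (\<psi> s' x)"
    by (rule F_mono[OF assms(1) admD(1)[OF assms(1)] assms(2)[OF assms(3)]])
qed

lemma Gam_mono_s:
  assumes "adm \<psi>" "\<And>s s' x. s \<le> s' \<Longrightarrow> \<psi> s x \<le> \<psi> s' x" "s \<le> s'"
  shows "Gam \<psi> s x \<le> Gam \<psi> s' x"
  unfolding Gam_def
  by (intro integral_mono Gam_integrable assms(1) mult_left_mono GG_mono_s[OF assms(1,2)] kap_nonneg) (use assms(3) in simp_all)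

lemma Gam_periodic:
  assumes "adm \<psi>" "\<And>s. periodic (\<psi> s)"
  shows "periodic (Gam \<psi> s)"
  unfolding periodic_def
proof (intro allI impI)
  fix x k :: "real^'n" assume k: "\<forall>i. k $ i \<in> \<int>"
  have per: "\<psi> s (x + k) = \<psi> s x" for s x using periodicD[OF assms(2)] k by blast
  have per': "\<psi> s (x + k - z) = \<psi> s (x - z)" for s x z using per[of s "x - z"] by (simp add: algebra_simps)
  have "GG \<psi> s (x + k) = GG \<psi> s x" for s
    using f_periodic[OF admD(1)[OF assms(1)], of k x s x] k by (simp add: GG_def conv_eq per per')
  then show "Gam \<psi> s (x + k) = Gam \<psi> s x" by (simp add: Gam_def)
qed

text \<open>The iteration starts from the supersolution and decreases pointwise, so the limit exists
  without compactness and inherits all properties stable under pointwise limits. The lower barrier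
  \<open>v\<close> enters only through its invariance; in the application it keeps the limit from
  vanishing.\<close>

lemma profile_exists:
  assumes l: "0 < l" and eig: "tk.eigen (- l) a (c * l) \<phi>"
    and v0: "\<And>s x. v s x \<le> min (exp (l * s) * \<phi> x) (p x)"
    and v_step: "\<And>\<psi> s x. adm \<psi> \<Longrightarrow> (\<And>s x. v s x \<le> \<psi> s x) \<Longrightarrow> v s x \<le> Gam \<psi> s x"
  obtains \<psi> where "adm \<psi>" "\<And>s x. Gam \<psi> s x = \<psi> s x" "\<And>s s' x. s \<le> s' \<Longrightarrow> \<psi> s x \<le> \<psi> s' x"
    "\<And>s. periodic (\<psi> s)" "\<And>s x. v s x \<le> \<psi> s x" "\<And>s x. \<psi> s x \<le> exp (l * s) * \<phi> x"
proof -
  have \<phi>: "\<phi> \<in> C_per" "\<And>x. 0 < \<phi> x" using eig by (auto simp: tk.eigen_def)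
  note [measurable] = C_per_measurable[OF \<phi>(1)] C_per_measurable[OF p(1)]
  define \<Psi>0 where "\<Psi>0 s x = min (exp (l * s) * \<phi> x) (p x)" for s x
  define \<Psi> where "\<Psi> n = (Gam ^^ n) \<Psi>0" for n
  have \<Psi>_0: "\<Psi> 0 = \<Psi>0" and \<Psi>_Suc: "\<Psi> (Suc n) = Gam (\<Psi> n)" for n by (simp_all add: \<Psi>_def)
  have adm0: "adm \<Psi>0"
    unfolding adm_def
  proof (intro conjI allI)
    show "(\<lambda>z. \<Psi>0 (fst z) (snd z)) \<in> borel_measurable (borel \<Otimes>\<^sub>M borel)" unfolding \<Psi>0_def by measurable
  qed (use \<phi>(2) p(2) in \<open>auto simp: \<Psi>0_def less_imp_le\<close>)
  have per0: "periodic (\<Psi>0 s)" for s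
    using C_perD(2)[OF \<phi>(1)] C_perD(2)[OF p(1)] by (simp add: periodic_def \<Psi>0_def)
  have mono0: "\<Psi>0 s x \<le> \<Psi>0 s' x" if "s \<le> s'" for s s' x
    unfolding \<Psi>0_def using that l \<phi>(2)[of x] by (intro min.mono mult_right_mono) auto
  have inv: "adm (\<Psi> n) \<and> (\<forall>s x. v s x \<le> \<Psi> n s x \<and> \<Psi> n s x \<le> exp (l * s) * \<phi> x) \<and> (\<forall>s. periodic (\<Psi> n s))
    \<and> (\<forall>s s' x. s \<le> s' \<longrightarrow> \<Psi> n s x \<le> \<Psi> n s' x)" for n
  proof (induction n)
    case 0
    have "v s x \<le> \<Psi>0 s x" "\<Psi>0 s x \<le> exp (l * s) * \<phi> x" for s x
      using v0[of s x] by (auto simp: \<Psi>0_def)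
    then show ?case using adm0 per0 mono0 unfolding \<Psi>_0 by blast
  next
    case (Suc n)
    then have IH: "adm (\<Psi> n)" "\<And>s x. v s x \<le> \<Psi> n s x" "\<And>s x. \<Psi> n s x \<le> exp (l * s) * \<phi> x"
      "\<And>s. periodic (\<Psi> n s)" "\<And>s s' x. s \<le> s' \<Longrightarrow> \<Psi> n s x \<le> \<Psi> n s' x" by blast+
    show ?case unfolding \<Psi>_Suc
      using Gam_adm[OF IH(1)] v_step[OF IH(1,2)] Gam_le_exp[OF IH(1) l eig IH(3)] Gam_periodic[OF IH(1,4)] Gam_mono_s[OF IH(1,5)]
      by blast
  qed
  have A: "adm (\<Psi> n)" for n using inv by blast
  have dec: "\<Psi> (Suc n) s x \<le> \<Psi> n s x" for n s x
  proof (induction n arbitrary: s x)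
    case 0
    have "\<Psi> 1 s x \<le> exp (l * s) * \<phi> x" using inv[of 1] by blast
    moreover have "\<Psi> 1 s x \<le> p x" by (rule admD(2)[OF A])
    ultimately show ?case by (simp add: \<Psi>_0 \<Psi>0_def)
  next
    case (Suc n)
    have "Gam (\<Psi> (Suc n)) s x \<le> Gam (\<Psi> n) s x" by (rule Gam_mono[OF A A Suc])
    then show ?case by (simp only: \<Psi>_Suc)
  qed
  have "\<exists>L. (\<lambda>n. \<Psi> n s x) \<longlonglongrightarrow> L" for s x
  proof -
    have "decseq (\<lambda>n. \<Psi> n s x)" by (rule decseq_SucI) (rule dec)
    moreover have "\<forall>n. 0 \<le> \<Psi> n s x" using admD(1)[OF A] by simp
    ultimately show ?thesis by (rule decseq_convergent) (rule exI)
  qed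
  then obtain \<psi> where lim: "\<And>s x. (\<lambda>n. \<Psi> n s x) \<longlonglongrightarrow> \<psi> s x" by metis
  have adm: "adm \<psi>"
    unfolding adm_def
  proof (intro conjI allI)
    show "(\<lambda>z. \<psi> (fst z) (snd z)) \<in> borel_measurable (borel \<Otimes>\<^sub>M borel)"
    proof (rule borel_measurable_LIMSEQ_real)
      show "(\<lambda>n. \<Psi> n (fst z) (snd z)) \<longlonglongrightarrow> \<psi> (fst z) (snd z)" for z by (rule lim)
      show "(\<lambda>z. \<Psi> n (fst z) (snd z)) \<in> borel_measurable (borel \<Otimes>\<^sub>M borel)" for n using A by (simp add: adm_def)
    qed
    show "0 \<le> \<psi> s x" for s x by (rule LIMSEQ_le_const[OF lim]) (use admD(1)[OF A] in blast)
    show "\<psi> s x \<le> p x" for s x by (rule LIMSEQ_le_const2[OF lim]) (use admD(2)[OF A] in blast)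
  qed
  show ?thesis
  proof (rule that[OF adm])
    show "Gam \<psi> s x = \<psi> s x" for s x
    proof (rule LIMSEQ_unique)
      show "(\<lambda>n. Gam (\<Psi> n) s x) \<longlonglongrightarrow> Gam \<psi> s x" by (rule Gam_tendsto[OF A adm lim])
      show "(\<lambda>n. Gam (\<Psi> n) s x) \<longlonglongrightarrow> \<psi> s x" using LIMSEQ_Suc[OF lim[of s x]] by (simp only: \<Psi>_Suc)
    qed
    show "\<psi> s x \<le> \<psi> s' x" if "s \<le> s'" for s s' x
      by (rule LIMSEQ_le[OF lim lim]) (use inv that in blast)
    show "periodic (\<psi> s)" for s
      unfolding periodic_def
    proof (intro allI impI)
      fix x k :: "real^'n" assume "\<forall>i. k $ i \<in> \<int>"
      then have "\<Psi> n s (x + k) = \<Psi> n s x" for n using inv periodicD by blast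
      then show "\<psi> s (x + k) = \<psi> s x" using lim[of s x] lim[of s "x + k"] LIMSEQ_unique by simp
    qed
    show "v s x \<le> \<psi> s x" for s x by (rule LIMSEQ_le_const[OF lim]) (use inv in blast)
    show "\<psi> s x \<le> exp (l * s) * \<phi> x" for s x by (rule LIMSEQ_le_const2[OF lim]) (use inv in blast)
  qed
qed

text \<open>Consider the fractions k \<le> 1 such that \<psi> is eventually above k p. If their
  supremum \<open>ks\<close> were below 1, the fixed point equation would improve every positive
  such k by one and the same factor q > 1, because f(x, u) / u exceeds its value at p by a fixed
  amount for u \<le> ks p; a k close to \<open>ks\<close> would then pass it.\<close>

lemma profile_limit:
  assumes \<psi>: "adm \<psi>" "\<And>s x. Gam \<psi> s x = \<psi> s x" "\<And>s s' x. s \<le> s' \<Longrightarrow> \<psi> s x \<le> \<psi> s' x"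
    and k0: "0 < k0" "\<And>x. k0 * p x \<le> \<psi> s0 x" and k: "k < 1"
  obtains S where "\<And>s x. S \<le> s \<Longrightarrow> k * p x \<le> \<psi> s x"
proof -
  define A where "A = {k. k \<le> 1 \<and> (\<exists>S. \<forall>s\<ge>S. \<forall>x. k * p x \<le> \<psi> s x)}"
  have bdd: "bdd_above A" by (auto simp: A_def bdd_above_def)
  have k0A: "k0 \<in> A"
  proof -
    have "k0 * p 0 \<le> 1 * p 0" using k0(2)[of 0] admD(2)[OF \<psi>(1), of s0 0] by simp
    then have "k0 \<le> 1" using p(2)[of 0] by (simp add: mult_le_cancel_right)
    moreover have "k0 * p x \<le> \<psi> s x" if "s0 \<le> s" for s x using k0(2)[of x] \<psi>(3)[OF that, of x] by linarith
    ultimately show ?thesis by (auto simp: A_def)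
  qed
  define ks where "ks = Sup A"
  have ks_ub: "\<And>k. k \<in> A \<Longrightarrow> k \<le> ks" unfolding ks_def by (rule cSup_upper[OF _ bdd])
  have ks0: "0 < ks" using ks_ub[OF k0A] k0 by simp
  have "1 \<le> ks"
  proof (rule ccontr)
    assume "\<not> 1 \<le> ks"
    then have ks1: "ks < 1" by simp
    obtain \<eta> where \<eta>: "0 < \<eta>" "\<And>x v. pm \<le> v \<Longrightarrow> v \<le> pM \<Longrightarrow> \<eta> \<le> f x (ks * v) / (ks * v) - f x v / v"
      using f_gap[OF pm(1) ks0 ks1] by metis
    define K where "K = C + 1"
    have K: "0 < K" using C by (simp add: K_def)
    \<comment> \<open>The gain with full memory is the factor 1 + \<eta> / K; half of the excess is
      given up for cutting off the memory. The cap 1 / ks keeps q k \<le> 1.\<close>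
    define q where "q = min (1 + \<eta> / (2 * K)) (1 / ks)"
    have q: "1 < q" "q * ks \<le> 1" "q \<le> 1 + \<eta> / (2 * K)"
    proof -
      show "1 < q" using \<eta> K ks0 ks1 by (simp add: q_def)
      have "q \<le> 1 / ks" by (simp add: q_def)
      then show "q * ks \<le> 1" using ks0 by (simp add: pos_le_divide_eq)
      show "q \<le> 1 + \<eta> / (2 * K)" by (simp add: q_def)
    qed
    have "k * q \<in> A" if kA: "k \<in> A" and kpos: "0 < k" for k
    proof -
      obtain S where S: "\<And>s x. S \<le> s \<Longrightarrow> k * p x \<le> \<psi> s x" using kA unfolding A_def by blast
      have kks: "k \<le> ks" by (rule ks_ub[OF kA])
      \<comment> \<open>The margin 1 in s covers the shifts (x - y).e inside the
        convolution.\<close>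
      have GG: "k * p x * (K + \<eta>) \<le> GG \<psi> s x" if s: "S + 1 \<le> s" for s x
      proof -
        have "k * conv J p x \<le> conv J (\<lambda>y. \<psi> (s - (x - y) \<bullet> e) y) x"
          unfolding conv_cmult[symmetric]
        proof (rule conv_mono[where C=pM])
          fix y assume y: "norm (x - y) \<le> 1"
          have *: "k * p y \<le> \<psi> (s - (x - y) \<bullet> e) y" using inner_e_bound[OF y] s by (intro S) (auto simp: abs_le_iff)
          then show "k * p y \<le> \<psi> (s - (x - y) \<bullet> e) y" .
          have "0 \<le> k * p y" using kpos p(2)[of y] by simp
          then show "\<bar>k * p y\<bar> \<le> pM" using * admD(3)[OF \<psi>(1), of "s - (x - y) \<bullet> e" y] by simp
          show "\<bar>\<psi> (s - (x - y) \<bullet> e) y\<bar> \<le> pM" by (rule admD[OF \<psi>(1)])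
        qed (use C_per_measurable[OF p(1)] slice_measurable[OF \<psi>(1)] in auto)
        moreover have "k * p x \<le> \<psi> s x" using s by (intro S) simp
        then have "C * (k * p x) + f x (k * p x) \<le> C * \<psi> s x + f x (\<psi> s x)"
          using kpos p(2)[of x] by (intro F_mono \<psi>(1)) auto
        moreover have "f x p' / p' + \<eta> \<le> f x (k * p') / (k * p')" if "p' = p x" for p'
        proof -
          have p': "0 < p'" "pm \<le> p'" "p' \<le> pM" using p(2) pm that by auto
          have "f x (ks * p') / (ks * p') \<le> f x (k * p') / (k * p')"
          proof (cases "k = ks")
            case False
            then have "k * p' < ks * p'" using kks p' by simp
            then show ?thesis using f_decr[of "k * p'" "ks * p'" x] kpos p' by simp
          qed simp
          then show ?thesis using \<eta>(2)[OF p'(2,3), of x] by linarith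
        qed
        then have fk: "(f x (p x) / p x + \<eta>) * (k * p x) \<le> f x (k * p x) / (k * p x) * (k * p x)"
          using kpos p(2)[of x] by (intro mult_right_mono) auto
        have f1: "(f x (p x) / p x + \<eta>) * (k * p x) = k * f x (p x) + \<eta> * (k * p x)"
          using p(2)[of x] by (simp add: distrib_right)
        have f2: "f x (k * p x) / (k * p x) * (k * p x) = f x (k * p x)" using kpos p(2)[of x] by simp
        have "k * f x (p x) + \<eta> * (k * p x) \<le> f x (k * p x)" using fk unfolding f1 f2 .
        moreover have "k * conv J p x = k * p x - k * f x (p x)" 
          using arg_cong[OF p(3)[of x], of "(*) k"] by (simp add: algebra_simps)
        ultimately show ?thesis unfolding GG_def K_def by (simp add: algebra_simps)
      qed
      \<comment> \<open>Memory beyond R is estimated by kap K r \<le> exp (- K R / 2) kap (K / 2) r,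
        and kap (K / 2) has integral 2 / K. For large R the truncated gain still exceeds 1 + \<eta>
        / (2 K).\<close>
      have "((\<lambda>R. (K + \<eta>) * (1 / K - exp (- (K * R / 2)) * (2 / K))) \<longlongrightarrow> (K + \<eta>) * (1 / K - 0 * (2 / K))) at_top"
      proof (intro tendsto_intros)
        have "filterlim (\<lambda>R. (K / 2) * R) at_top at_top"
          using K by (intro filterlim_tendsto_pos_mult_at_top[OF tendsto_const _ filterlim_ident]) auto
        then have "filterlim (\<lambda>R. - (K * R / 2)) at_bot at_top" by (simp add: filterlim_uminus_at_bot)
        then show "((\<lambda>R. exp (- (K * R / 2))) \<longlongrightarrow> 0) at_top" by (rule filterlim_compose[OF exp_at_bot])
      qed
      moreover have "1 + \<eta> / (2 * K) < (K + \<eta>) * (1 / K - 0 * (2 / K))" using K \<eta>(1) by (simp add: field_simps)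
      ultimately have "\<forall>\<^sub>F R in at_top. 1 + \<eta> / (2 * K) < (K + \<eta>) * (1 / K - exp (- (K * R / 2)) * (2 / K))"
        by (rule order_tendstoD(1))
      then obtain R0 where R0: "\<And>R. R0 \<le> R \<Longrightarrow> 1 + \<eta> / (2 * K) < (K + \<eta>) * (1 / K - exp (- (K * R / 2)) * (2 / K))"
        unfolding eventually_at_top_linorder by blast
      define R where "R = R0"
      have R: "q \<le> (K + \<eta>) * (1 / K - exp (- (K * R / 2)) * (2 / K))" using R0[of R] q(3) by (simp add: R_def)
      have "k * q * p x \<le> \<psi> s x" if s: "S + 1 + c * R \<le> s" for s x
      proof -
        have kp: "0 < k * p x" using kpos p(2) by simp
        let ?b = "k * p x * (K + \<eta>)"
        have b: "0 \<le> ?b" using kp K \<eta> by simp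
        have K2: "0 < K / 2" using K by simp
        have "k * q * p x = k * p x * q" by simp
        also have "\<dots> \<le> k * p x * ((K + \<eta>) * (1 / K - exp (- (K * R / 2)) * (2 / K)))"
          using kp R by (intro mult_left_mono) auto
        also have "\<dots> = (LINT r|lborel. ?b * (kap K r - exp (- (K * R / 2)) * kap (K / 2) r))"
          using kap_integral[OF K] kap_integral[OF K2] by (simp add: mult.assoc)
        also have "\<dots> \<le> Gam \<psi> s x"
          unfolding Gam_def K_def[symmetric]
        proof (intro integral_mono)
          show "integrable lborel (\<lambda>r. ?b * (kap K r - exp (- (K * R / 2)) * kap (K / 2) r))"
            by (intro integrable_mult_right Bochner_Integration.integrable_diff kap_integral K K2)
          show "integrable lborel (\<lambda>r. kap K r * GG \<psi> (s - c * r) x)" unfolding K_def by (rule Gam_integrable[OF \<psi>(1)])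
          fix r
          show "?b * (kap K r - exp (- (K * R / 2)) * kap (K / 2) r) \<le> kap K r * GG \<psi> (s - c * r) x"
          proof (cases "r \<le> R")
            case True
            then have "c * r \<le> c * R" using c by simp
            then have "?b \<le> GG \<psi> (s - c * r) x" using s by (intro GG) auto
            then have "kap K r * ?b \<le> kap K r * GG \<psi> (s - c * r) x" by (intro mult_left_mono kap_nonneg)
            moreover have "0 \<le> ?b * (exp (- (K * R / 2)) * kap (K / 2) r)" using b kap_nonneg by simp
            ultimately show ?thesis by (simp add: algebra_simps)
          next
            case False
            have "kap K r \<le> exp (- (K * R / 2)) * kap (K / 2) r"
            proof -
              have "- K * r \<le> - (K * R / 2) + - (K / 2) * r" using False K by (simp add: field_simps)
              then have "exp (- K * r) \<le> exp (- (K * R / 2)) * exp (- (K / 2) * r)" unfolding mult_exp_exp exp_le_cancel_iff .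
              then show ?thesis by (auto simp: kap_def indicator_def)
            qed
            then have "?b * (kap K r - exp (- (K * R / 2)) * kap (K / 2) r) \<le> 0" using b by (simp add: mult_nonneg_nonpos)
            also have "0 \<le> kap K r * GG \<psi> (s - c * r) x" using GG_bounds(1)[OF \<psi>(1)] kap_nonneg by simp
            finally show ?thesis .
          qed
        qed
        finally show ?thesis by (simp add: \<psi>(2))
      qed
      moreover have "k * q \<le> 1" using mult_right_mono[OF kks, of q] q mult.commute[of q ks] by linarith
      ultimately show ?thesis unfolding A_def by blast
    qed
    note step = this
    have "ks / q < ks" using q(1) ks0 by (simp add: divide_simps)
    then obtain k where k: "k \<in> A" "ks / q < k" using less_cSupD[of A "ks / q"] k0A unfolding ks_def by blast
    have "0 < k" using k(2) ks0 q(1) by (meson divide_pos_pos less_trans zero_less_one)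
    then have "k * q \<le> ks" using ks_ub[OF step[OF k(1)]] by simp
    moreover have "ks < k * q" using k(2) q(1) by (simp add: divide_simps split: if_splits)
    ultimately show False by simp
  qed
  then obtain k' where k': "k' \<in> A" "k < k'" using less_cSupD[of A k] k0A k unfolding ks_def by force
  then obtain S where S: "\<And>s x. S \<le> s \<Longrightarrow> k' * p x \<le> \<psi> s x" unfolding A_def by blast
  show ?thesis
  proof (rule that[of S])
    fix s x assume "S \<le> s"
    moreover have "k * p x \<le> k' * p x" using k'(2) p(2)[of x] by (intro mult_right_mono) auto
    ultimately show "k * p x \<le> \<psi> s x" using S[of s x] by linarith
  qed
qed

end

lemma (in bump) eigen_scale:
  assumes "eigen a \<nu> \<phi>" "0 < k"
  shows "eigen a \<nu> (\<lambda>x. k * \<phi> x)"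
  using assms unfolding eigen_def by (auto intro!: C_per_cmult simp: conv_cmult)

lemma (in kpp) front_exists:
  assumes c: "0 < c" and l1: "0 < l1" "nu l1 < c * l1"
  obtains u where "pulsating_front J f e c u"
proof -
  obtain l l' where l: "0 < l" "l < l'" "l' \<le> 2 * l" "nu l = c * l" "nu l' < c * l'"
    using nu_crossing[OF \<nu>0 l1] by metis
  have l'0: "0 < l'" using l by simp
  obtain pm pM where pm': "0 < pm" "\<And>x. pm \<le> p x" and pM: "0 < pM" and pM': "\<And>x. p x \<le> pM"
    using C_per_pos_bounds[OF p(1,2)] by metis
  note pm = pm' pM pM'
  obtain C0 where C0: "0 < C0" "\<And>x u v. 0 \<le> u \<Longrightarrow> u \<le> v \<Longrightarrow> v \<le> pM \<Longrightarrow> f x u + C0 * u \<le> f x v + C0 * v"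
    using f_one_sided_lipschitz by metis
  obtain A0 where A0: "0 < A0" "\<And>x. \<bar>f_u f x 0\<bar> \<le> A0" using C_per_bounded[OF f_u_C_per] by metis
  obtain Q where Q: "0 < Q" "\<And>x u. 0 \<le> u \<Longrightarrow> u \<le> pM \<Longrightarrow> f_u f x 0 * u - Q * u\<^sup>2 \<le> f x u"
    using f_ge_quadratic by metis
  interpret kpp_front f J e \<phi>0 \<nu>0 c "C0 + A0" pm pM
  proof
    show "0 \<le> C0 + A0 + f_u f x 0" for x using A0(2)[of x] C0(1) by (simp add: abs_le_iff)
    show "f x u + (C0 + A0) * u \<le> f x v + (C0 + A0) * v" if "0 \<le> u" "u \<le> v" "v \<le> pM" for x u v
      using C0(2)[OF that, of x] mult_left_mono[OF that(2) less_imp_le[OF A0(1)]] unfolding distrib_right by linarith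
  qed (use c C0 A0 pm in auto)
  obtain \<phi>a where "tk.eigen (- l) a (nu (- l)) \<phi>a" using nu_eigen by blast
  then have \<phi>a: "tk.eigen (- l) a (c * l) \<phi>a" by (simp add: nu_uminus l)
  then have \<phi>a': "\<phi>a \<in> C_per" "\<And>x. 0 < \<phi>a x" by (auto simp: tk.eigen_def)
  obtain ma Ma where ma: "0 < ma" "\<And>x. ma \<le> \<phi>a x" "0 < Ma" "\<And>x. \<phi>a x \<le> Ma" using C_per_pos_bounds[OF \<phi>a'] by metis
  \<comment> \<open>Normalized to lie below pm \<le> p, so that for s \<le> 0 the exponential stays
    below p.\<close>
  define \<phi> where "\<phi> x = pm / Ma * \<phi>a x" for x
  have eig: "tk.eigen (- l) a (c * l) \<phi>"
    unfolding \<phi>_def[abs_def] using pm ma by (intro tk.eigen_scale \<phi>a) auto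
  have \<phi>C: "\<phi> \<in> C_per" "\<And>x. 0 < \<phi> x" using eig by (auto simp: tk.eigen_def)
  have \<phi>pm: "\<phi> x \<le> pm" for x
    using mult_left_mono[OF ma(4)[of x], of "pm / Ma"] ma(3) pm(1) by (simp add: \<phi>_def)
  obtain m B where m: "0 < m" "\<And>x. m \<le> \<phi> x" using C_per_pos_bounds[OF \<phi>C] by metis
  obtain \<phi>' where "tk.eigen (- l') a (nu (- l')) \<phi>'" using nu_eigen by blast
  then have eig': "tk.eigen (- l') a (nu l') \<phi>'" by (simp add: nu_uminus)
  then have \<phi>': "\<phi>' \<in> C_per" "\<And>x. 0 < \<phi>' x" by (auto simp: tk.eigen_def)
  obtain m' M' where m': "0 < m'" "\<And>x. m' \<le> \<phi>' x" "0 < M'" "\<And>x. \<phi>' x \<le> M'" using C_per_pos_bounds[OF \<phi>'] by metis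
  define g where "g = c * l' - nu l'"
  have g: "0 < g" using l by (simp add: g_def)
  \<comment> \<open>The first term makes the barrier nonpositive for s \<ge> 0; the second lets the
    gap g = c l' - nu l' absorb the quadratic loss.\<close>
  define A where "A = max (pm / m') (Q * pm\<^sup>2 / (m' * g))"
  have A: "0 < A" "pm \<le> A * m'" "Q * pm\<^sup>2 \<le> A * m' * g"
  proof -
    show "0 < A" using pm m' by (simp add: A_def less_max_iff_disj)
    have "pm / m' \<le> A" "Q * pm\<^sup>2 / (m' * g) \<le> A" by (simp_all add: A_def)
    then show "pm \<le> A * m'" "Q * pm\<^sup>2 \<le> A * m' * g" using m'(1) g by (simp_all add: pos_divide_le_eq mult.assoc)
  qed
  define v where "v s x = exp (l * s) * \<phi> x - exp (l' * s) * (A * \<phi>' x)" for s x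
  have Am': "A * m' \<le> A * \<phi>' x" for x using A(1) m'(2) by simp
  have neg: "s < 0" if "0 < v s x" for s x
  proof (rule ccontr)
    assume "\<not> s < 0"
    then have "exp (l * s) \<le> exp (l' * s)" using l by (simp add: mult_right_mono)
    moreover have "\<phi> x \<le> A * \<phi>' x" using \<phi>pm[of x] A(2) Am'[of x] by linarith
    ultimately have "exp (l * s) * \<phi> x \<le> exp (l' * s) * (A * \<phi>' x)" using \<phi>C(2)[of x] by (intro mult_mono) auto
    then show False using that by (simp add: v_def)
  qed
  have v_le: "v s x \<le> exp (l * s) * \<phi> x" for s x using A(1) \<phi>'(2)[of x] by (simp add: v_def)
  have v0: "v s x \<le> min (exp (l * s) * \<phi> x) (p x)" for s x
  proof (cases "0 < v s x")
    case True
    then have "l * s \<le> 0" using neg[of s x] l(1) by (simp add: mult_nonneg_nonpos)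
    then have "exp (l * s) * \<phi> x \<le> 1 * \<phi> x" using \<phi>C(2)[of x] by (intro mult_right_mono) auto
    then have "v s x \<le> p x" using v_le[of s x] \<phi>pm[of x] pm(2)[of x] by linarith
    then show ?thesis using v_le by simp
  next
    case False
    then have "v s x \<le> p x" using p(2)[of x] by linarith
    then show ?thesis using v_le by simp
  qed
  have Q\<phi>: "Q * (\<phi> x)\<^sup>2 \<le> A * \<phi>' x * (c * l' - nu l')" for x
  proof -
    have "(\<phi> x)\<^sup>2 \<le> pm\<^sup>2" using \<phi>C(2)[of x] \<phi>pm[of x] by (intro power_mono) auto
    then have "Q * (\<phi> x)\<^sup>2 \<le> Q * pm\<^sup>2" using Q(1) by simp
    also have "\<dots> \<le> A * m' * g" by (rule A)
    also have "\<dots> \<le> A * \<phi>' x * g" using Am' g by (intro mult_right_mono) auto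
    finally show ?thesis by (simp add: g_def)
  qed
  have v_step: "v s x \<le> Gam \<psi> s x" if "adm \<psi>" "\<And>s x. v s x \<le> \<psi> s x" for \<psi> s x
    unfolding v_def
    by (rule Gam_ge_barrier[OF that(1) l(1) l'0 l(3) eig eig' Q(2,1) neg[unfolded v_def] A(1) Q\<phi> that(2)[unfolded v_def]])
  obtain \<psi> where \<psi>: "adm \<psi>" "\<And>s x. Gam \<psi> s x = \<psi> s x" "\<And>s s' x. s \<le> s' \<Longrightarrow> \<psi> s x \<le> \<psi> s' x"
    "\<And>s. periodic (\<psi> s)" "\<And>s x. v s x \<le> \<psi> s x" "\<And>s x. \<psi> s x \<le> exp (l * s) * \<phi> x"
    using profile_exists[OF l(1) eig v0 v_step] by metis
  \<comment> \<open>Chosen so that A M' e^((l' - l) s1) = m / 2: at \<open>s1\<close> the subtracted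
    part is at most half of the main part for all x at once. The barrier is uniformly positive
    there, which gives the initial fraction \<open>k0\<close>.\<close>
  define s1 where "s1 = ln (m / (2 * (A * M'))) / (l' - l)"
  define k0 where "k0 = exp (l * s1) * (m / 2) / pM"
  have k0: "0 < k0" using m(1) pM by (simp add: k0_def)
  have k0_le: "k0 * p x \<le> \<psi> s1 x" for x
  proof -
    have AM: "0 < A * M'" using A m' by simp
    have "(l' - l) * s1 = ln (m / (2 * (A * M')))" using l by (simp add: s1_def)
    then have "exp ((l' - l) * s1) = m / (2 * (A * M'))" using AM m by simp
    then have e1: "exp (l' * s1) = exp (l * s1) * (m / (2 * (A * M')))"
      using mult_exp_exp[of "l * s1" "(l' - l) * s1"] by (simp add: algebra_simps)
    have "k0 * p x \<le> k0 * pM" using pm k0 by (intro mult_left_mono) auto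
    also have "\<dots> = exp (l * s1) * m - exp (l' * s1) * (A * M')" using pM A(1) m'(3) unfolding e1 k0_def by (simp add: field_simps)
    also have "\<dots> \<le> v s1 x" unfolding v_def using m(2)[of x] m'(4)[of x] A(1) by (intro diff_mono mult_left_mono) auto
    also have "\<dots> \<le> \<psi> s1 x" by (rule \<psi>)
    finally show ?thesis .
  qed
  have "pulsating_front J f e c (\<lambda>x t. \<psi> (x \<bullet> e + c * t) x)"
    unfolding pulsating_front_def
  proof (intro conjI exI[of _ \<psi>] allI)
    show "entire_solution J f (\<lambda>x t. \<psi> (x \<bullet> e + c * t) x)" by (rule fixed_point_entire_solution[OF \<psi>(1,2)])
    show "periodic (\<psi> s)" for s by (rule \<psi>)
    show "uniform_limit UNIV \<psi> (\<lambda>x. 0) at_bot"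
    proof (rule uniform_limitI)
      fix \<epsilon> :: real assume \<epsilon>: "0 < \<epsilon>"
      have "dist (\<psi> s x) 0 < \<epsilon>" if s: "s \<le> ln (\<epsilon> / (2 * pm)) / l" for s x
      proof -
        have "l * s \<le> ln (\<epsilon> / (2 * pm))" using s l(1) by (simp add: pos_le_divide_eq mult.commute)
        then have "exp (l * s) \<le> exp (ln (\<epsilon> / (2 * pm)))" by simp
        also have "\<dots> = \<epsilon> / (2 * pm)" using \<epsilon> pm by (intro exp_ln) auto
        finally have "exp (l * s) * \<phi> x \<le> \<epsilon> / (2 * pm) * pm" using \<phi>pm[of x] \<phi>C(2)[of x] \<epsilon> pm'(1) by (intro mult_mono) auto
        then have "\<psi> s x \<le> \<epsilon> / 2" using \<psi>(6)[of s x] pm(1) by simp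
        then show ?thesis using admD(1)[OF \<psi>(1), of s x] \<epsilon> by (simp add: dist_real_def)
      qed
      then show "\<forall>\<^sub>F s in at_bot. \<forall>x\<in>UNIV. dist (\<psi> s x) 0 < \<epsilon>"
        unfolding eventually_at_bot_linorder by blast
    qed
    show "uniform_limit UNIV \<psi> (stationary_state J f) at_top"
    proof (rule uniform_limitI)
      fix \<epsilon> :: real assume \<epsilon>: "0 < \<epsilon>"
      define k where "k = 1 - \<epsilon> / (2 * pM)"
      have "k < 1" using \<epsilon> pM by (simp add: k_def)
      then obtain S where S: "\<And>s x. S \<le> s \<Longrightarrow> k * p x \<le> \<psi> s x"
        using profile_limit[OF \<psi>(1,2,3) k0 k0_le] by metis
      have "dist (\<psi> s x) (stationary_state J f x) < \<epsilon>" if "S \<le> s" for s x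
      proof -
        have "p x - \<psi> s x \<le> \<epsilon> / (2 * pM) * p x" using S[OF that, of x] by (simp add: k_def algebra_simps)
        also have "\<dots> \<le> \<epsilon> / (2 * pM) * pM" using \<epsilon> pM pm(3) by (intro mult_left_mono) auto
        also have "\<dots> < \<epsilon>" using \<epsilon> pM by simp
        finally show ?thesis using admD(2)[OF \<psi>(1), of s x] by (simp add: dist_real_def p_def[symmetric])
      qed
      then show "\<forall>\<^sub>F s in at_top. \<forall>x\<in>UNIV. dist (\<psi> s x) (stationary_state J f x) < \<epsilon>"
        unfolding eventually_at_top_linorder by blast
    qed
  qed simp
  then show ?thesis using that by blast
qed

subsection \<open>Positivity and measurability of fronts\<close>

context bump
begin

text \<open>\<open>entire_solution\<close> asks for integrability of J(x - y) u(y), not for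
  measurability of u. Near x the kernel is bounded below, so dividing by it gives measurability on a
  ball, and countably many balls cover the space.\<close>

lemma measurable_of_conv_integrable:
  fixes v :: "real^'n \<Rightarrow> real"
  assumes "\<And>x. integrable lborel (\<lambda>y. K (x - y) * v y)"
  shows "v \<in> borel_measurable borel"
proof -
  obtain \<rho> k0 where r: "0 < \<rho>" "\<rho> \<le> 1" "0 < k0" "\<And>z. norm z \<le> \<rho> \<Longrightarrow> k0 \<le> K z" using K_pos_near_0 by blast
  obtain F where F: "F \<subseteq> range (\<lambda>x::real^'n. ball x \<rho>)" "countable F" "\<Union>F = \<Union>(range (\<lambda>x::real^'n. ball x \<rho>))"
    using Lindelof[of "range (\<lambda>x::real^'n. ball x \<rho>)"] by blast
  show ?thesis
  proof (rule measurable_piecewise_restrict[OF F(2)])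
    fix S assume "S \<in> F"
    then obtain x where S: "S = ball x \<rho>" using F(1) by blast
    then show "S \<inter> space borel \<in> sets borel" by simp
    have "(\<lambda>y. K (x - y) * v y) \<in> borel_measurable borel"
      using borel_measurable_integrable[OF assms[of x]] by simp
    then have "(\<lambda>y. K (x - y) * v y / K (x - y)) \<in> borel_measurable borel" by measurable
    then have "(\<lambda>y. K (x - y) * v y / K (x - y)) \<in> borel_measurable (restrict_space borel S)"
      by (rule measurable_restrict_space1)
    moreover have "K (x - y) * v y / K (x - y) = v y" if "y \<in> S" for y
      using that r(3) r(4)[of "x - y"] by (simp add: S dist_norm)
    ultimately show "v \<in> borel_measurable (restrict_space borel S)"
      by (subst measurable_cong[where g="\<lambda>y. K (x - y) * v y / K (x - y)"]) (auto simp: space_restrict_space)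
  next
    have "x \<in> \<Union>(range (\<lambda>x::real^'n. ball x \<rho>))" for x using r(1) by (intro UnionI[of "ball x \<rho>"]) auto
    then show "space borel \<subseteq> \<Union>F" unfolding F(3) by blast
  qed
qed

lemma conv_zero_AE:
  assumes "integrable lborel (\<lambda>y. K (x - y) * v y)" "\<And>y. 0 \<le> v y" "conv K v x = 0"
    "\<And>z. norm z \<le> \<rho> \<Longrightarrow> k0 \<le> K z" "0 < k0"
  shows "AE y in lborel. y \<in> ball x \<rho> \<longrightarrow> v y = 0"
proof -
  have "AE y in lborel. K (x - y) * v y = 0"
    using integral_nonneg_eq_0_iff_AE[OF assms(1)] assms(2,3) K_nonneg by (simp add: conv_def)
  then show ?thesis
  proof eventually_elim
    case (elim y)
    show ?case
    proof
      assume "y \<in> ball x \<rho>"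
      then have "k0 \<le> K (x - y)" by (intro assms(4)) (simp add: dist_norm)
      then have "K (x - y) \<noteq> 0" using assms(5) by linarith
      then show "v y = 0" using elim by simp
    qed
  qed
qed

end

lemma AE_lborel_exists_in_open:
  fixes S :: "'a::euclidean_space set"
  assumes "AE y in lborel. y \<in> S \<longrightarrow> P y" "open S" "S \<noteq> {}"
  obtains y where "y \<in> S" "P y"
proof -
  have "\<exists>y\<in>S. P y"
  proof (rule ccontr)
    assume "\<not> (\<exists>y\<in>S. P y)"
    then have none: "\<And>y. y \<in> S \<Longrightarrow> \<not> P y" by blast
    from assms(1) have "AE y in lborel. y \<notin> S" by eventually_elim (use none in blast)
    then have "S \<in> null_sets lborel" using assms(2) by (subst (asm) AE_iff_null_sets[symmetric]) auto
    then have "negligible S" by (auto simp: negligible_iff_null_sets intro: null_sets_completionI)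
    then show False using assms(2,3) open_not_negligible by blast
  qed
  then show ?thesis using that by blast
qed

text \<open>The time is approximated from below by multiples of 1 / (n + 1), of which there are
  countably many; continuity in t makes the approximations converge.\<close>

lemma caratheodory_measurable:
  fixes u :: "'a::euclidean_space \<Rightarrow> real \<Rightarrow> real"
  assumes "\<And>t. (\<lambda>y. u y t) \<in> borel_measurable borel" "\<And>y. continuous_on UNIV (u y)"
  shows "(\<lambda>z. u (fst z) (snd z)) \<in> borel_measurable (borel \<Otimes>\<^sub>M borel)"
proof (rule borel_measurable_LIMSEQ_real)
  fix z :: "'a \<times> real"
  define T where "T n = real_of_int \<lfloor>real (Suc n) * snd z\<rfloor> / real (Suc n)" for n
  have lim: "T \<longlonglongrightarrow> snd z"
  proof (rule real_tendsto_sandwich)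
    show "\<forall>\<^sub>F n in sequentially. snd z - inverse (real (Suc n)) \<le> T n"
    proof (intro always_eventually allI)
      fix n
      have "real (Suc n) * snd z - 1 \<le> real_of_int \<lfloor>real (Suc n) * snd z\<rfloor>" by linarith
      then have "(real (Suc n) * snd z - 1) / real (Suc n) \<le> T n" unfolding T_def by (intro divide_right_mono) auto
      then show "snd z - inverse (real (Suc n)) \<le> T n" by (simp add: diff_divide_distrib inverse_eq_divide del: of_nat_Suc)
    qed
    show "\<forall>\<^sub>F n in sequentially. T n \<le> snd z"
    proof (intro always_eventually allI)
      fix n
      have "real_of_int \<lfloor>real (Suc n) * snd z\<rfloor> \<le> real (Suc n) * snd z" by linarith
      then have "T n \<le> (real (Suc n) * snd z) / real (Suc n)" unfolding T_def by (intro divide_right_mono) auto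
      then show "T n \<le> snd z" by (simp del: of_nat_Suc)
    qed
    have "(\<lambda>n. snd z - inverse (real (Suc n))) \<longlonglongrightarrow> snd z - 0" by (intro tendsto_diff tendsto_const LIMSEQ_inverse_real_of_nat)
    then show "(\<lambda>n. snd z - inverse (real (Suc n))) \<longlonglongrightarrow> snd z" by simp
  qed (rule tendsto_const)
  show "(\<lambda>n. u (fst z) (real_of_int \<lfloor>real (Suc n) * snd z\<rfloor> / real (Suc n))) \<longlonglongrightarrow> u (fst z) (snd z)"
    using continuous_on_tendsto_compose[OF assms(2)[of "fst z"] lim] by (simp add: T_def del: of_nat_Suc)
next
  fix n
  have 1: "(\<lambda>z. u (fst z) (real_of_int i / real (Suc n))) \<in> borel_measurable (borel \<Otimes>\<^sub>M borel)" for i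
    by (rule measurable_compose[OF measurable_fst assms(1)])
  have 2: "(\<lambda>z. \<lfloor>real (Suc n) * snd z\<rfloor>) \<in> (borel \<Otimes>\<^sub>M borel) \<rightarrow>\<^sub>M count_space UNIV" for z :: "'a \<times> real"
    by measurable
  show "(\<lambda>z. u (fst z) (real_of_int \<lfloor>real (Suc n) * snd z\<rfloor> / real (Suc n))) \<in> borel_measurable (borel \<Otimes>\<^sub>M borel)"
    by (rule measurable_compose_countable[OF 1 2])
qed

context kpp
begin

text \<open>A zero of u is a minimum in time, so the equation leaves conv J u = 0 there and u
  vanishes almost everywhere on a ball at that time. Zeros spread through overlapping balls at the
  same fixed time, until they reach points far in the direction e, where u is close to p >
  0.\<close>

lemma entire_solution_pos:
  assumes sol: "entire_solution J f u" and c: "0 < c" and u: "\<And>x t. u x t = \<psi> (x \<bullet> e + c * t) x"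
    and lim: "uniform_limit UNIV \<psi> (stationary_state J f) at_top"
  shows "0 < u x t"
proof (rule ccontr)
  assume "\<not> 0 < u x t"
  have nn: "0 \<le> u x t" and int: "integrable lborel (\<lambda>y. J (x - y) * u y t)"
    and der: "((\<lambda>\<tau>. u x \<tau>) has_real_derivative conv J (\<lambda>y. u y t) x - u x t + f x (u x t)) (at t)" for x t
    using sol by (auto simp: entire_solution_def)
  obtain \<rho> k0 where r: "0 < \<rho>" "\<rho> \<le> 1" "0 < k0" "\<And>z. norm z \<le> \<rho> \<Longrightarrow> k0 \<le> J z" using K_pos_near_0 by blast
  have zero: "AE y in lborel. y \<in> ball w \<rho> \<longrightarrow> u y t = 0" if "u w t = 0" for w
  proof -
    have "conv J (\<lambda>y. u y t) w - u w t + f w (u w t) = 0"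
      using DERIV_local_min[OF der[of w t], of 1] nn that by auto
    then show ?thesis by (intro conv_zero_AE[OF int nn _ r(4,3)]) (simp_all add: that)
  qed
  have spread: "AE y in lborel. y \<in> ball w (\<rho>/2) \<longrightarrow> u y t = 0" if "norm (w - x) \<le> real n * (\<rho>/4)" for n w
    using that
  proof (induction n arbitrary: w)
    case 0
    then have "w = x" by simp
    have "u x t = 0" using nn[of x t] \<open>\<not> 0 < u x t\<close> by simp
    from zero[OF this] show ?case unfolding \<open>w = x\<close> by eventually_elim (use r(1) in auto)
  next
    case (Suc n)
    define w' where "w' = x + (real n / real (Suc n)) *\<^sub>R (w - x)"
    have "w' - x = (real n / real (Suc n)) *\<^sub>R (w - x)" by (simp add: w'_def)
    then have "norm (w' - x) = real n / real (Suc n) * norm (w - x)" by simp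
    also have "\<dots> \<le> real n / real (Suc n) * (Suc n * (\<rho>/4))" using Suc.prems by (intro mult_left_mono) auto
    also have "\<dots> = n * (\<rho>/4)" by (simp del: of_nat_Suc)
    finally have IH: "AE y in lborel. y \<in> ball w' (\<rho>/2) \<longrightarrow> u y t = 0" by (rule Suc.IH)
    have "w - w' = (1 / real (Suc n)) *\<^sub>R (w - x)"
      unfolding w'_def by (simp add: vec_eq_iff field_simps)
    then have "norm (w - w') = norm (w - x) / Suc n" by simp
    also have "\<dots> \<le> (Suc n * (\<rho>/4)) / Suc n" using Suc.prems by (intro divide_right_mono) auto
    also have "\<dots> = \<rho>/4" by (simp del: of_nat_Suc)
    finally have ww: "norm (w - w') \<le> \<rho>/4" .
    \<comment> \<open>Vanishing holds only almost everywhere, so a genuine zero must be picked in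
      the overlap before the next step; half radii keep the new ball within reach of it.\<close>
    have "AE y in lborel. y \<in> ball w' (\<rho>/2) \<inter> ball w (\<rho>/2) \<longrightarrow> u y t = 0" using IH by eventually_elim auto
    moreover have "w \<in> ball w' (\<rho>/2) \<inter> ball w (\<rho>/2)" using ww r(1) by (simp add: dist_norm norm_minus_commute)
    then have "ball w' (\<rho>/2) \<inter> ball w (\<rho>/2) \<noteq> {}" by blast
    ultimately obtain y where y: "y \<in> ball w' (\<rho>/2) \<inter> ball w (\<rho>/2)" "u y t = 0"
      by (rule AE_lborel_exists_in_open[OF _ open_Int[OF open_ball open_ball]])
    have sub: "ball w (\<rho>/2) \<subseteq> ball y \<rho>"
    proof
      fix v assume "v \<in> ball w (\<rho>/2)"
      moreover have "dist w y < \<rho>/2" using y(1) by simp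
      ultimately show "v \<in> ball y \<rho>" using dist_triangle[of y v w] by (simp add: dist_commute)
    qed
    from zero[OF y(2)] show ?case by eventually_elim (use sub in auto)
  qed
  obtain m M where m: "0 < m" "\<And>x. m \<le> p x" using C_per_pos_bounds[OF p(1,2)] by metis
  have "\<forall>\<^sub>F s in at_top. \<forall>x\<in>UNIV. dist (\<psi> s x) (p x) < m"
    using uniform_limitD[OF lim m(1)] by (simp add: p_def)
  then obtain S where S: "\<And>s x. S \<le> s \<Longrightarrow> dist (\<psi> s x) (p x) < m" unfolding eventually_at_top_linorder by blast
  define w where "w = (S - c * t + 1) *\<^sub>R e"
  have ee: "e \<bullet> e = 1" using e by (simp add: dot_square_norm)
  obtain n :: nat where "norm (w - x) / (\<rho>/4) \<le> n" using real_arch_simple by blast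
  then have "norm (w - x) \<le> n * (\<rho>/4)" using r(1) by (simp add: pos_divide_le_eq)
  then have "AE y in lborel. y \<in> ball w (\<rho>/2) \<longrightarrow> u y t = 0" by (rule spread)
  moreover have "ball w (\<rho>/2) \<noteq> {}" using r(1) by simp
  ultimately obtain y where y: "y \<in> ball w (\<rho>/2)" "u y t = 0"
    by (rule AE_lborel_exists_in_open[OF _ open_ball])
  have "\<bar>(w - y) \<bullet> e\<bar> \<le> norm (w - y) * norm e" by (rule Cauchy_Schwarz_ineq2)
  also have "\<dots> \<le> 1" using y(1) r(2) e by (simp add: dist_norm)
  finally have "S \<le> y \<bullet> e + c * t" by (simp add: w_def inner_diff_left ee abs_le_iff)
  from S[OF this, of y] have "dist (u y t) (p y) < m" by (simp add: u)
  then show False using y(2) m(2)[of y] by (simp add: dist_real_def)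
qed

end

text \<open>A front far to the left: for s \<le> T the profile is at most \<open>\<eta>\<close>,
  where the reaction lies above its linearization lowered by \<open>\<epsilon>\<close>, so a linear
  differential inequality holds. \<open>N\<close> is J * u in moving coordinates, and
  \<open>K\<close> bounds the coefficient of the zeroth order term.\<close>

locale kpp_wave = kpp f J e \<phi>0 \<nu>0
  for f :: "real^'n \<Rightarrow> real \<Rightarrow> real" and J e \<phi>0 \<nu>0 +
  fixes c \<epsilon> K T \<eta> :: real and \<psi> :: "real \<Rightarrow> real^'n \<Rightarrow> real" and N
  defines "N \<equiv> \<lambda>s x. conv J (\<lambda>y. \<psi> (s - (x - y) \<bullet> e) y) x"
  assumes c: "0 < c" and K: "0 < K" "\<And>x. \<bar>f_u f x 0 - 1 - \<epsilon>\<bar> \<le> K"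
    and lin: "\<And>v x. 0 \<le> v \<Longrightarrow> v \<le> \<eta> \<Longrightarrow> (f_u f x 0 - 1 - \<epsilon>) * v \<le> f x v - v"
    and \<psi>_meas: "(\<lambda>z. \<psi> (fst z) (snd z)) \<in> borel_measurable (borel \<Otimes>\<^sub>M borel)"
    and \<psi>_per: "\<And>s. periodic (\<psi> s)" and \<psi>_pos: "\<And>s x. 0 < \<psi> s x"
    and \<psi>_small: "\<And>s x. s \<le> T \<Longrightarrow> \<psi> s x \<le> \<eta>"
    and \<psi>_lim: "uniform_limit UNIV \<psi> (\<lambda>x. 0) at_bot"
    and \<psi>_deriv: "\<And>s x t. ((\<lambda>t. \<psi> (s + c * t) x) has_real_derivative
        N (s + c * t) x - \<psi> (s + c * t) x + f x (\<psi> (s + c * t) x)) (at t)"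
begin

lemma N_eq: "N s x = conv J (\<lambda>y. \<psi> (s - (x - y) \<bullet> e) y) x" by (simp add: N_def)

lemma \<psi>_measurable:
  assumes [measurable]: "g \<in> borel_measurable M" "h \<in> measurable M borel"
  shows "(\<lambda>w. \<psi> (g w) (h w)) \<in> borel_measurable M"
proof -
  have "(\<lambda>w. (g w, h w)) \<in> M \<rightarrow>\<^sub>M borel \<Otimes>\<^sub>M borel" by measurable
  from measurable_compose[OF this \<psi>_meas] show ?thesis by simp
qed

lemma N_measurable:
  assumes [measurable]: "g \<in> borel_measurable M" "h \<in> measurable M borel"
  shows "(\<lambda>w. N (g w) (h w)) \<in> borel_measurable M"
proof -
  note [measurable] = \<psi>_measurable
  show ?thesis unfolding N_def conv_def by measurable
qed

lemma slice_measurable: "(\<lambda>y. \<psi> (s - (x - y) \<bullet> e) y) \<in> borel_measurable borel"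
  by (rule \<psi>_measurable) measurable

lemma slice_bounded: "s \<le> T - 1 \<Longrightarrow> norm (x - y) \<le> 1 \<Longrightarrow> \<bar>\<psi> (s - (x - y) \<bullet> e) y\<bar> \<le> \<eta>"
  using \<psi>_small[of "s - (x - y) \<bullet> e" y] \<psi>_pos[of "s - (x - y) \<bullet> e" y] inner_e_bound[of "x - y"] by (auto simp: abs_le_iff)

lemma N_nonneg: "0 \<le> N s x"
  unfolding N_def using \<psi>_pos by (intro conv_nonneg) (simp add: less_imp_le)

lemma N_pos: "s \<le> T - 1 \<Longrightarrow> 0 < N s x"
  unfolding N_def by (rule conv_pos'[OF slice_measurable slice_bounded \<psi>_pos])

lemma N_le: 
  assumes "s \<le> T - 1" "\<And>s' y. s' \<le> s + 1 \<Longrightarrow> \<psi> s' y \<le> B"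
  shows "N s x \<le> B"
proof -
  have "N s x \<le> conv J (\<lambda>y. B) x"
    unfolding N_def
  proof (rule conv_mono[where C="max \<eta> \<bar>B\<bar>"])
    fix y assume y: "norm (x - y) \<le> 1"
    show "\<psi> (s - (x - y) \<bullet> e) y \<le> B" using inner_e_bound[OF y] by (intro assms(2)) (simp add: abs_le_iff)
    show "\<bar>\<psi> (s - (x - y) \<bullet> e) y\<bar> \<le> max \<eta> \<bar>B\<bar>" using slice_bounded[OF assms(1) y] by simp
  qed (auto intro: slice_measurable)
  then show ?thesis by simp
qed

text \<open>Dropping N \<ge> 0 from the equation leaves decay in time at rate at most
  \<open>K\<close>.\<close>

lemma \<psi>_growth:
  assumes "0 \<le> h" "s + c * h \<le> T"
  shows "exp (- K * h) * \<psi> s x \<le> \<psi> (s + c * h) x"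
proof -
  let ?D = "\<lambda>r. N (s + c * r) x - \<psi> (s + c * r) x + f x (\<psi> (s + c * r) x)"
  have "exp (K * 0) * \<psi> (s + c * 0) x \<le> exp (K * h) * \<psi> (s + c * h) x"
  proof (rule DERIV_nonneg_imp_nondecreasing[OF assms(1)])
    fix r assume r: "0 \<le> r" "r \<le> h"
    have "s + c * r \<le> s + c * h" using r c by simp
    then have b: "\<psi> (s + c * r) x \<le> \<eta>" using assms(2) by (intro \<psi>_small) simp
    have "- K * \<psi> (s + c * r) x \<le> (f_u f x 0 - 1 - \<epsilon>) * \<psi> (s + c * r) x"
      using K(2)[of x] \<psi>_pos[of "s + c * r" x] by (intro mult_right_mono) (auto simp: abs_le_iff)
    also have "\<dots> \<le> f x (\<psi> (s + c * r) x) - \<psi> (s + c * r) x"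
      by (rule lin[OF less_imp_le[OF \<psi>_pos] b])
    finally have "0 \<le> K * \<psi> (s + c * r) x + ?D r" using N_nonneg[of "s + c * r" x] by simp
    then have "0 \<le> exp (K * r) * (K * \<psi> (s + c * r) x + ?D r)" by simp
    moreover have "((\<lambda>r. exp (K * r) * \<psi> (s + c * r) x) has_real_derivative
        exp (K * r) * ?D r + (exp (K * r) * (K * 1)) * \<psi> (s + c * r) x) (at r)"
      by (intro DERIV_mult' DERIV_fun_exp DERIV_cmult DERIV_ident \<psi>_deriv)
    ultimately show "\<exists>y. ((\<lambda>r. exp (K * r) * \<psi> (s + c * r) x) has_real_derivative y) (at r) \<and> 0 \<le> y"
      by (intro exI conjI) (auto simp: algebra_simps)
  qed
  then have "exp (- K * h) * \<psi> s x \<le> exp (- K * h) * (exp (K * h) * \<psi> (s + c * h) x)" by (intro mult_left_mono) auto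
  then show ?thesis by (simp add: mult.assoc[symmetric] mult_exp_exp)
qed

lemma N_growth:
  assumes "0 \<le> h" "s + c * h \<le> T - 1"
  shows "exp (- K * h) * N s x \<le> N (s + c * h) x"
  unfolding N_def conv_cmult[symmetric]
proof (rule conv_mono[where C=\<eta>])
  have sT: "s \<le> T - 1" using assms c mult_nonneg_nonneg[of c h] by linarith
  fix y assume y: "norm (x - y) \<le> 1"
  have "exp (- K * h) * \<psi> (s - (x - y) \<bullet> e) y \<le> \<psi> (s - (x - y) \<bullet> e + c * h) y"
    using assms(2) inner_e_bound[OF y] by (intro \<psi>_growth assms(1)) (simp add: abs_le_iff)
  then show "exp (- K * h) * \<psi> (s - (x - y) \<bullet> e) y \<le> \<psi> (s + c * h - (x - y) \<bullet> e) y" by (simp add: algebra_simps)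
  have "exp (- K * h) * \<bar>\<psi> (s - (x - y) \<bullet> e) y\<bar> \<le> 1 * \<eta>"
    using slice_bounded[OF sT y] K assms(1) by (intro mult_mono) auto
  then show "\<bar>exp (- K * h) * \<psi> (s - (x - y) \<bullet> e) y\<bar> \<le> \<eta>" by (simp add: abs_mult)
  show "\<bar>\<psi> (s + c * h - (x - y) \<bullet> e) y\<bar> \<le> \<eta>" by (rule slice_bounded[OF assms(2) y])
qed (use slice_measurable in auto)

text \<open>Duhamel's formula over one time step, with \<open>N\<close> replaced by its initial
  value at the price of exp (- K h) through \<open>N_growth\<close>.\<close>

lemma \<psi>_duhamel_step:
  assumes "0 \<le> h" "s + c * h \<le> T - 1"
  shows "exp ((f_u f x 0 - 1 - \<epsilon>) * h) * \<psi> s x + h * exp (- K * h) * N s x \<le> \<psi> (s + c * h) x"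
proof -
  define b where "b = f_u f x 0 - 1 - \<epsilon>"
  have bK: "0 \<le> b + K" using K(2)[of x] by (simp add: b_def abs_le_iff)
  define n0 where "n0 = exp (- (b + K) * h) * N s x"
  let ?D = "\<lambda>r. N (s + c * r) x - \<psi> (s + c * r) x + f x (\<psi> (s + c * r) x)"
  have "exp (- b * 0) * \<psi> (s + c * 0) x - n0 * 0 \<le> exp (- b * h) * \<psi> (s + c * h) x - n0 * h"
  proof (rule DERIV_nonneg_imp_nondecreasing[OF assms(1)])
    fix r assume r: "0 \<le> r" "r \<le> h"
    have le: "s + c * r \<le> s + c * h" using r c by simp
    then have "\<psi> (s + c * r) x \<le> \<eta>" using assms(2) by (intro \<psi>_small) simp
    then have 1: "b * \<psi> (s + c * r) x \<le> f x (\<psi> (s + c * r) x) - \<psi> (s + c * r) x"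
      unfolding b_def by (rule lin[OF less_imp_le[OF \<psi>_pos]])
    have "exp (- K * r) * N s x \<le> N (s + c * r) x" using le assms(2) by (intro N_growth r) simp
    then have "exp (- b * r) * (exp (- K * r) * N s x) \<le> exp (- b * r) * N (s + c * r) x" by (intro mult_left_mono) auto
    moreover have "n0 \<le> exp (- b * r) * (exp (- K * r) * N s x)"
    proof -
      have "(b + K) * r \<le> (b + K) * h" using r bK by (intro mult_left_mono)
      then have "exp (- (b + K) * h) \<le> exp (- b * r + - K * r)" by (simp add: algebra_simps)
      then have "exp (- (b + K) * h) * N s x \<le> exp (- b * r + - K * r) * N s x" by (intro mult_right_mono N_nonneg)
      then show ?thesis unfolding n0_def exp_add by (simp add: mult.assoc)
    qed
    ultimately have 2: "n0 \<le> exp (- b * r) * N (s + c * r) x" by linarith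
    have "exp (- b * r) * (b * \<psi> (s + c * r) x) \<le> exp (- b * r) * (f x (\<psi> (s + c * r) x) - \<psi> (s + c * r) x)"
      using 1 by (intro mult_left_mono) auto
    then have "0 \<le> exp (- b * r) * ?D r + (exp (- b * r) * (- b * 1)) * \<psi> (s + c * r) x - n0 * 1"
      using 2 by (simp add: algebra_simps)
    moreover have "((\<lambda>r. exp (- b * r) * \<psi> (s + c * r) x - n0 * r) has_real_derivative
        exp (- b * r) * ?D r + (exp (- b * r) * (- b * 1)) * \<psi> (s + c * r) x - n0 * 1) (at r)"
      by (intro DERIV_diff DERIV_mult' DERIV_fun_exp DERIV_cmult DERIV_ident \<psi>_deriv)
    ultimately show "\<exists>y. ((\<lambda>r. exp (- b * r) * \<psi> (s + c * r) x - n0 * r) has_real_derivative y) (at r) \<and> 0 \<le> y"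
      by blast
  qed
  then have le: "exp (b * h) * (\<psi> s x + n0 * h) \<le> exp (b * h) * (exp (- b * h) * \<psi> (s + c * h) x)" by (intro mult_left_mono) auto
  have e1: "exp (b * h) * (exp (- b * h) * \<psi> (s + c * h) x) = \<psi> (s + c * h) x"
    by (simp add: mult.assoc[symmetric] mult_exp_exp)
  have e2: "exp (b * h) * (n0 * h) = h * exp (- K * h) * N s x"
  proof -
    have "exp (b * h) * exp (- (b + K) * h) = exp (- K * h)" by (simp add: mult_exp_exp algebra_simps)
    then have "exp (b * h) * exp (- (b + K) * h) * (N s x * h) = exp (- K * h) * (N s x * h)" by simp
    then show ?thesis by (simp add: n0_def mult_ac)
  qed
  show ?thesis using le unfolding distrib_left e1 e2 by (simp only: b_def)
qed

text \<open>Iterates the single step backward in time. A finite sum in place of the integral over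
  the past keeps all time shifts on the grid of mesh c h.\<close>

lemma \<psi>_duhamel:
  assumes "0 \<le> h" "s \<le> T - 1"
  shows "(\<Sum>j<m. h * exp (- K * h) * exp ((f_u f x 0 - 1 - \<epsilon>) * h) ^ j * N (s - c * h * (real j + 1)) x) 
    + exp ((f_u f x 0 - 1 - \<epsilon>) * h) ^ m * \<psi> (s - c * h * m) x \<le> \<psi> s x"
proof (induction m)
  case (Suc m)
  let ?q = "exp ((f_u f x 0 - 1 - \<epsilon>) * h)"
  have e: "s - c * h * real (Suc m) + c * h = s - c * h * m" by (simp add: algebra_simps)
  have "0 \<le> c * h * m" using c assms(1) by simp
  then have "s - c * h * real (Suc m) + c * h \<le> T - 1" unfolding e using assms(2) by linarith
  then have "?q * \<psi> (s - c * h * real (Suc m)) x + h * exp (- K * h) * N (s - c * h * real (Suc m)) x \<le> \<psi> (s - c * h * m) x"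
    using \<psi>_duhamel_step[OF assms(1)] unfolding e[symmetric] by blast
  then have "?q ^ m * (?q * \<psi> (s - c * h * real (Suc m)) x + h * exp (- K * h) * N (s - c * h * real (Suc m)) x) \<le> ?q ^ m * \<psi> (s - c * h * m) x"
    by (intro mult_left_mono) auto
  then show ?case using Suc by (simp add: algebra_simps)
qed simp

definition duhamel_sum :: "real \<Rightarrow> nat \<Rightarrow> real \<Rightarrow> real^'n \<Rightarrow> real^'n \<Rightarrow> real" where
  "duhamel_sum h m s x y = (\<Sum>j<m. h * exp (- K * h) * exp ((f_u f y 0 - 1 - \<epsilon>) * h) ^ j
     * N (s - (x - y) \<bullet> e - c * h * (real j + 1)) y)"

lemma duhamel_sum_measurable: "duhamel_sum h m s x \<in> borel_measurable borel"
proof -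
  have [measurable]: "(\<lambda>y. f_u f y 0) \<in> borel_measurable borel" by (rule C_per_measurable[OF f_u_C_per])
  note [measurable] = N_measurable
  show ?thesis unfolding duhamel_sum_def by measurable
qed

lemma duhamel_sum_bounds:
  assumes "0 \<le> h" "s \<le> T - 2" "norm (x - y) \<le> 1"
  shows "duhamel_sum h m s x y \<le> \<psi> (s - (x - y) \<bullet> e) y" "\<bar>duhamel_sum h m s x y\<bar> \<le> \<eta>"
proof -
  have le: "s - (x - y) \<bullet> e \<le> T - 1" using assms(2) inner_e_bound[OF assms(3)] by (simp add: abs_le_iff)
  have "0 \<le> exp ((f_u f y 0 - 1 - \<epsilon>) * h) ^ m * \<psi> (s - (x - y) \<bullet> e - c * h * m) y" using \<psi>_pos by (simp add: less_imp_le)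
  then show *: "duhamel_sum h m s x y \<le> \<psi> (s - (x - y) \<bullet> e) y"
    using \<psi>_duhamel[OF assms(1) le, of y m] unfolding duhamel_sum_def by linarith
  have b: "\<bar>\<psi> (s - (x - y) \<bullet> e) y\<bar> \<le> \<eta>" using assms(2) by (intro slice_bounded assms(3)) simp
  have "0 \<le> duhamel_sum h m s x y" unfolding duhamel_sum_def using assms(1) N_nonneg by (intro sum_nonneg) simp
  then show "\<bar>duhamel_sum h m s x y\<bar> \<le> \<eta>" using * b by linarith
qed

text \<open>Dropping the positive remainder in \<open>\<psi>_duhamel\<close> and convolving yields
  an inequality for \<open>N\<close> alone, the function to which the Harnack inequality
  applies.\<close>

lemma N_duhamel:
  assumes "0 \<le> h" "s \<le> T - 2"
  shows "conv J (duhamel_sum h m s x) x \<le> N s x"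
  unfolding N_eq[of s x]
  by (rule conv_mono[where C=\<eta>])
     (use assms in \<open>auto intro: duhamel_sum_measurable slice_measurable duhamel_sum_bounds slice_bounded\<close>)

end

subsection \<open>A Harnack inequality\<close>

context kpp_wave
begin

text \<open>The mass of the front on a ball at one fixed time; despite the name it is not divided by
  the volume.\<close>

definition ball_avg :: "real \<Rightarrow> real \<Rightarrow> real^'n \<Rightarrow> real" where
  "ball_avg \<rho> s x = (LINT y|lborel. indicator (cball x \<rho>) y * \<psi> (s - (x - y) \<bullet> e) y)"

lemma ball_integrable:
  assumes "s \<le> T - 1" "\<rho> \<le> 1"
  shows "integrable lborel (\<lambda>y. indicator (cball x \<rho>) y * \<psi> (s - (x - y) \<bullet> e) y)"
proof (rule Bochner_Integration.integrable_bound[OF integrable_indicator_cball[of x \<rho> \<eta>]])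
  have "(\<lambda>y. indicator (cball x \<rho>) y * \<psi> (s - (x - y) \<bullet> e) y) \<in> borel_measurable borel"
    by (intro borel_measurable_times borel_measurable_indicator slice_measurable) simp
  then show "(\<lambda>y. indicator (cball x \<rho>) y * \<psi> (s - (x - y) \<bullet> e) y) \<in> borel_measurable lborel" by simp
  show "AE y in lborel. norm (indicator (cball x \<rho>) y * \<psi> (s - (x - y) \<bullet> e) y) \<le> norm (indicator (cball x \<rho>) y * \<eta>)"
  proof (intro always_eventually allI)
    fix y
    show "norm (indicator (cball x \<rho>) y * \<psi> (s - (x - y) \<bullet> e) y) \<le> norm (indicator (cball x \<rho>) y * \<eta>)"
      using slice_bounded[OF assms(1), of x y] assms(2) by (auto simp: indicator_def dist_norm)
  qed
qed

lemma ball_avg_nonneg: "0 \<le> ball_avg \<rho> s x"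
  unfolding ball_avg_def using \<psi>_pos by (intro Bochner_Integration.integral_nonneg) (simp add: less_imp_le)

lemma ball_avg_periodic: "(\<And>i. k $ i \<in> \<int>) \<Longrightarrow> ball_avg \<rho> s (x + k) = ball_avg \<rho> s x"
proof -
  assume k: "\<And>i. k $ i \<in> \<int>"
  have eq: "ball_avg \<rho> s x = (LINT z|lborel. indicator (cball 0 \<rho>) z * \<psi> (s - z \<bullet> e) (x - z))" for x
  proof -
    have "(LINT z|lborel. indicator (cball 0 \<rho>) z * \<psi> (s - z \<bullet> e) (x - z)) 
       = (LINT y|lborel. indicator (cball 0 \<rho>) (x - y) * \<psi> (s - (x - y) \<bullet> e) (x - (x - y)))"
      by (rule lborel_integral_reflect[symmetric])
    also have "\<dots> = ball_avg \<rho> s x"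
      unfolding ball_avg_def
      by (intro Bochner_Integration.integral_cong) (auto simp: indicator_def dist_norm norm_minus_commute)
    finally show ?thesis by simp
  qed
  have "\<psi> s (x + k - z) = \<psi> s (x - z)" for s z
    using periodicD[OF \<psi>_per, of k s "x - z"] k by (simp add: algebra_simps)
  then show "ball_avg \<rho> s (x + k) = ball_avg \<rho> s x" by (simp add: eq)
qed

lemma N_ge_ball_avg:
  assumes "\<And>z. norm z \<le> \<sigma> \<Longrightarrow> k0 \<le> J z" "\<sigma> \<le> 1" "0 < k0" "s \<le> T - 1" "cball x \<rho> \<subseteq> cball y \<sigma>"
  shows "k0 * ball_avg \<rho> s x \<le> N (s - (x - y) \<bullet> e) y \<or> \<not> s - (x - y) \<bullet> e \<le> T - 1"
proof (cases "s - (x - y) \<bullet> e \<le> T - 1")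
  case True
  have eq: "s - (x - y) \<bullet> e - (y - w) \<bullet> e = s - (x - w) \<bullet> e" for w by (simp add: inner_diff_left)
  have "k0 * (LINT w|lborel. indicator (cball x \<rho>) w * \<psi> (s - (x - y) \<bullet> e - (y - w) \<bullet> e) w) \<le> N (s - (x - y) \<bullet> e) y"
    unfolding N_eq
    by (rule conv_lower_ball[where C=\<eta> and \<rho>=\<sigma>])
       (use assms slice_measurable slice_bounded[OF True] \<psi>_pos in \<open>auto simp: less_imp_le\<close>)
  then show ?thesis unfolding eq by (simp add: ball_avg_def)
qed simp

text \<open>With \<open>J\<close> bounded below up to distance 3 \<rho>, each point of a ball of
  radius \<rho> sees the whole of any ball of radius \<rho> whose centre is within \<rho> of the
  first centre.\<close>

context
  fixes \<rho> k0 :: real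
  assumes \<rho>: "0 < \<rho>" "3 * \<rho> \<le> 1" and k0: "0 < k0" "\<And>z. norm z \<le> 3 * \<rho> \<Longrightarrow> k0 \<le> J z"
begin

definition "V = measure lborel (cball (0::real^'n) \<rho>)"

lemma V_pos: "0 < V"
  using \<rho> by (simp add: V_def content_cball)

text \<open>Mass in one ball bounds \<open>N\<close> from below on a neighbouring ball at the same
  time, and the source term of the Duhamel step turns this into mass there a time h later. The new
  coordinate records both the displacement and the elapsed time.\<close>

lemma ball_avg_step:
  assumes "norm (x'' - x') \<le> \<rho>" "0 \<le> h" "s' \<le> T - 3" "s' + (x'' - x') \<bullet> e + c * h \<le> T - 3"
  shows "V * k0 * h * exp (- K * h) * ball_avg \<rho> s' x' \<le> ball_avg \<rho> (s' + (x'' - x') \<bullet> e + c * h) x''"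
proof -
  define s'' where "s'' = s' + (x'' - x') \<bullet> e + c * h"
  define b where "b = h * exp (- K * h) * (k0 * ball_avg \<rho> s' x')"
  have *: "b \<le> \<psi> (s'' - (x'' - y) \<bullet> e) y" if y: "y \<in> cball x'' \<rho>" for y
  proof -
    have y1: "norm (x'' - y) \<le> 1" using y \<rho> by (simp add: dist_norm)
    have xy: "norm (x' - y) \<le> 2 * \<rho>"
      using norm_triangle_ineq[of "x' - x''" "x'' - y"] y assms(1) by (simp add: dist_norm norm_minus_commute)
    then have "norm (x' - y) \<le> 1" using \<rho> by linarith
    then have sT: "s' - (x' - y) \<bullet> e \<le> T - 1" using inner_e_bound[of "x' - y"] assms(3) by (auto simp: abs_le_iff)
    have sub: "cball x' \<rho> \<subseteq> cball y (3 * \<rho>)"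
    proof
      fix w assume "w \<in> cball x' \<rho>"
      then show "w \<in> cball y (3 * \<rho>)"
        using norm_triangle_ineq[of "y - x'" "x' - w"] xy by (simp add: dist_norm norm_minus_commute)
    qed
    have "s' \<le> T - 1" using assms(3) by simp
    then have N: "k0 * ball_avg \<rho> s' x' \<le> N (s' - (x' - y) \<bullet> e) y"
      using N_ge_ball_avg[OF k0(2) \<rho>(2) k0(1) _ sub, of s'] sT by blast
    have eq: "s' - (x' - y) \<bullet> e + c * h = s'' - (x'' - y) \<bullet> e" by (simp add: s''_def inner_diff_left)
    have "s'' - (x'' - y) \<bullet> e \<le> T - 1" using inner_e_bound[OF y1] assms(4) by (simp add: s''_def abs_le_iff)
    then have "exp ((f_u f y 0 - 1 - \<epsilon>) * h) * \<psi> (s' - (x' - y) \<bullet> e) y + h * exp (- K * h) * N (s' - (x' - y) \<bullet> e) y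
      \<le> \<psi> (s'' - (x'' - y) \<bullet> e) y"
      using \<psi>_duhamel_step[OF assms(2), of "s' - (x' - y) \<bullet> e" y] unfolding eq by blast
    moreover have "0 \<le> exp ((f_u f y 0 - 1 - \<epsilon>) * h) * \<psi> (s' - (x' - y) \<bullet> e) y" using \<psi>_pos by (simp add: less_imp_le)
    moreover have "b \<le> h * exp (- K * h) * N (s' - (x' - y) \<bullet> e) y"
      unfolding b_def using N assms(2) by (intro mult_left_mono) auto
    ultimately show ?thesis by linarith
  qed
  have "V * b = (LINT y|lborel. indicator (cball x'' \<rho>) y * b)"
    using \<rho> by (simp add: V_def content_cball)
  also have "\<dots> \<le> ball_avg \<rho> s'' x''"
    unfolding ball_avg_def
    by (intro integral_mono integrable_indicator_cball ball_integrable)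
       (use * \<rho> assms(4) in \<open>auto simp: s''_def indicator_def\<close>)
  finally show ?thesis by (simp add: b_def s''_def mult_ac)
qed

lemma ball_avg_chain:
  assumes "0 \<le> h" "s' \<le> T - 3"
  shows "norm (x'' - x') \<le> m * \<rho> \<Longrightarrow> s' + (x'' - x') \<bullet> e + c * (m * h) \<le> T - 3 \<Longrightarrow>
    (V * k0 * h * exp (- K * h)) ^ m * ball_avg \<rho> s' x' \<le> ball_avg \<rho> (s' + (x'' - x') \<bullet> e + c * (m * h)) x''"
proof (induction m arbitrary: x'')
  case 0
  then show ?case by simp
next
  case (Suc m)
  define \<theta> where "\<theta> = real m / real (Suc m)"
  have \<theta>: "0 \<le> \<theta>" "\<theta> \<le> 1" "\<theta> * real (Suc m) = m" by (simp_all add: \<theta>_def)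
  define w where "w = x' + \<theta> *\<^sub>R (x'' - x')"
  have wx: "w - x' = \<theta> *\<^sub>R (x'' - x')" by (simp add: w_def)
  have "norm (w - x') \<le> \<theta> * (Suc m * \<rho>)" unfolding wx using Suc.prems(1) \<theta> by (simp add: mult_left_mono)
  also have "\<dots> = m * \<rho>" using \<theta>(3) by (metis mult.assoc)
  finally have nw: "norm (w - x') \<le> m * \<rho>" .
  have xw: "x'' - w = (1 - \<theta>) *\<^sub>R (x'' - x')" by (simp add: w_def algebra_simps)
  have "1 - \<theta> = 1 / real (Suc m)" by (simp add: \<theta>_def field_simps)
  then have "norm (x'' - w) = norm (x'' - x') / Suc m" unfolding xw by simp
  also have "\<dots> \<le> Suc m * \<rho> / Suc m" using Suc.prems(1) by (intro divide_right_mono) auto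
  also have "\<dots> = \<rho>" by (simp del: of_nat_Suc)
  finally have nx: "norm (x'' - w) \<le> \<rho>" .
  define s1 where "s1 = s' + (w - x') \<bullet> e + c * (m * h)"
  \<comment> \<open>The intermediate coordinate is a convex combination of the end coordinates,
    hence also at most T - 3.\<close>
  have "s1 = (1 - \<theta>) * s' + \<theta> * (s' + (x'' - x') \<bullet> e + c * (Suc m * h))"
  proof -
    have "c * (m * h) = \<theta> * (c * (Suc m * h))" using \<theta>(3) by (simp add: mult_ac del: of_nat_Suc)
    then show ?thesis by (simp add: s1_def wx algebra_simps del: of_nat_Suc)
  qed
  also have "\<dots> \<le> (1 - \<theta>) * (T - 3) + \<theta> * (T - 3)"
    using \<theta> assms(2) Suc.prems(2) by (intro add_mono mult_left_mono) auto
  finally have s1: "s1 \<le> T - 3" by (simp add: algebra_simps)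
  have IH: "(V * k0 * h * exp (- K * h)) ^ m * ball_avg \<rho> s' x' \<le> ball_avg \<rho> s1 w"
    using Suc.IH[OF nw] s1 by (simp add: s1_def)
  have eq: "s1 + (x'' - w) \<bullet> e + c * h = s' + (x'' - x') \<bullet> e + c * (Suc m * h)"
    by (simp add: s1_def inner_diff_left algebra_simps)
  have step: "V * k0 * h * exp (- K * h) * ball_avg \<rho> s1 w \<le> ball_avg \<rho> (s' + (x'' - x') \<bullet> e + c * (Suc m * h)) x''"
    using ball_avg_step[OF nx assms(1) s1] Suc.prems(2) unfolding eq by blast
  have "V * k0 * h * exp (- K * h) * ((V * k0 * h * exp (- K * h)) ^ m * ball_avg \<rho> s' x') \<le> V * k0 * h * exp (- K * h) * ball_avg \<rho> s1 w"
    using IH V_pos k0(1) assms(1) by (intro mult_left_mono) auto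
  then show ?case using step by (simp add: mult.assoc)
qed

text \<open>Replacing the point \<open>x'\<close> by a lattice translate far ahead in direction \<open>e\<close> turns a
  comparison at arbitrary nearby values of \<open>s\<close> into a comparison from earlier to later times.\<close>

lemma ball_avg_harnack:
  assumes "0 \<le> S0"
  obtains C where "0 < C" "\<And>s s' x x'. s \<le> T - 3 \<Longrightarrow> s' \<le> T - 3 \<Longrightarrow> \<bar>s - s'\<bar> \<le> S0 \<Longrightarrow> ball_avg \<rho> s' x' \<le> C * ball_avg \<rho> s x"
proof -
  define n where "n = real CARD('n)"
  \<comment> \<open>For a translate z within n of x + R e, the elapsed time multiplied by c is s -
    s' + (z - x).e. This choice of R makes it at least 1, and \<open>H\<close> is the resulting
    upper bound.\<close>
  define R where "R = S0 + n + 1"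
  define H where "H = 2 * S0 + 2 * n + 1"
  have n0: "0 \<le> n" by (simp add: n_def)
  obtain m0 :: nat where m0: "(R + n) / \<rho> \<le> m0" using real_arch_simple by blast
  define m where "m = Suc m0"
  have m: "R + n \<le> m * \<rho>" "0 < real m"
  proof -
    have "R + n \<le> m0 * \<rho>" using m0 \<rho>(1) by (simp add: pos_divide_le_eq)
    then show "R + n \<le> m * \<rho>" using \<rho>(1) by (simp add: m_def distrib_right)
  qed (simp add: m_def)
  define \<delta> where "\<delta> = V * k0 * (1 / (c * m)) * exp (- K * (H / (c * m)))"
  have cm: "0 < c * m" using c m by simp
  have \<delta>: "0 < \<delta>" using V_pos k0 cm by (simp add: \<delta>_def)
  show ?thesis
  proof (rule that[of "1 / \<delta> ^ m"])
    show "0 < 1 / \<delta> ^ m" using \<delta> by simp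
    fix s s' x x' assume s: "s \<le> T - 3" "s' \<le> T - 3" "\<bar>s - s'\<bar> \<le> S0"
    obtain k where k: "\<And>i. k $ i \<in> \<int>" "norm (x' + k - (x + R *\<^sub>R e)) \<le> n"
      by (rule lattice_translate_near[of x' "x + R *\<^sub>R e", folded n_def]) (rule that)
    define z where "z = x' + k"
    define d where "d = z - (x + R *\<^sub>R e)"
    have d: "norm d \<le> n" using k(2) by (simp add: d_def z_def)
    have zx: "z - x = d + R *\<^sub>R e" by (simp add: d_def)
    have ee: "e \<bullet> e = 1" using e by (simp add: dot_square_norm)
    have "\<bar>d \<bullet> e\<bar> \<le> norm d * norm e" by (rule Cauchy_Schwarz_ineq2)
    then have de: "\<bar>d \<bullet> e\<bar> \<le> n" using d e by simp
    have ze: "(z - x) \<bullet> e = d \<bullet> e + R" by (simp add: zx inner_add_left ee)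
    have "norm (x - z) \<le> norm d + norm (R *\<^sub>R e)" unfolding norm_minus_commute[of x z] zx by (rule norm_triangle_ineq)
    also have "\<dots> \<le> n + R" using d e assms n0 by (simp add: R_def)
    finally have nxz: "norm (x - z) \<le> m * \<rho>" using m(1) by linarith
    define g where "g = s - s' + (z - x) \<bullet> e"
    have g: "1 \<le> g" "g \<le> H" using s(3) de by (auto simp: g_def ze R_def H_def abs_le_iff)
    define h where "h = g / (c * m)"
    have ch: "c * (m * h) = g" using c m(2) by (simp add: h_def)
    have h0: "0 \<le> h" using g cm by (simp add: h_def)
    have seq: "s' + (x - z) \<bullet> e + c * (m * h) = s" unfolding ch by (simp add: g_def inner_diff_left)
    have chain: "(V * k0 * h * exp (- K * h)) ^ m * ball_avg \<rho> s' z \<le> ball_avg \<rho> s x"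
      using ball_avg_chain[OF h0 s(2) nxz] s(1) unfolding seq by blast
    have hb: "1 / (c * m) \<le> h" "h \<le> H / (c * m)" unfolding h_def using g cm by (auto intro: divide_right_mono)
    have "K * h \<le> K * (H / (c * m))" using hb(2) K(1) by (intro mult_left_mono) auto
    then have ma: "exp (- K * (H / (c * m))) \<le> exp (- K * h)" by simp
    have mb: "V * k0 * (1 / (c * m)) \<le> V * k0 * h" using hb(1) V_pos k0(1) by (intro mult_left_mono) auto
    have mc: "0 \<le> V * k0 * h" using h0 V_pos k0(1) by simp
    have "\<delta> \<le> V * k0 * h * exp (- K * h)"
      unfolding \<delta>_def by (rule mult_mono[OF mb ma mc]) simp
    then have "\<delta> ^ m \<le> (V * k0 * h * exp (- K * h)) ^ m" using \<delta> by (intro power_mono) auto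
    then have "\<delta> ^ m * ball_avg \<rho> s' z \<le> (V * k0 * h * exp (- K * h)) ^ m * ball_avg \<rho> s' z"
      by (intro mult_right_mono ball_avg_nonneg)
    then have "\<delta> ^ m * ball_avg \<rho> s' z \<le> ball_avg \<rho> s x" using chain by linarith
    moreover have "ball_avg \<rho> s' z = ball_avg \<rho> s' x'" unfolding z_def using k(1) by (rule ball_avg_periodic)
    ultimately show "ball_avg \<rho> s' x' \<le> 1 / \<delta> ^ m * ball_avg \<rho> s x"
      using \<delta> by (simp add: pos_le_divide_eq mult.commute)
  qed
qed

text \<open>Finitely many balls of radius \<rho> cover the unit ball, which contains the support of
  \<open>J\<close>, and \<open>J\<close> is bounded.\<close>

lemma N_le_ball_avg_sum:
  obtains F B where "finite F" "F \<subseteq> cball (0::real^'n) 1" "0 < B"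
    "\<And>s x. s \<le> T - 2 \<Longrightarrow> N s x \<le> B * (\<Sum>z\<in>F. ball_avg \<rho> (s + z \<bullet> e) (x + z))"
proof -
  obtain F where F: "finite F" "F \<subseteq> cball (0::real^'n) 1" "cball 0 1 \<subseteq> (\<Union>z\<in>F. ball z \<rho>)"
  proof -
    have "seq_compact (cball (0::real^'n) 1)" by (rule compact_imp_seq_compact) simp
    from seq_compact_imp_totally_bounded[OF this, rule_format, OF \<rho>(1)] show ?thesis
      by (elim exE conjE) (rule that)
  qed
  obtain B where B: "0 < B" "\<And>x. J x \<le> B" using K_bounded by blast
  show ?thesis
  proof (rule that[OF F(1,2) B(1)])
    fix s x assume s: "s \<le> T - 2"
    have sT: "s \<le> T - 1" using s by simp
    let ?g = "\<lambda>z y. indicator (cball (x + z) \<rho>) y * \<psi> (s + z \<bullet> e - (x + z - y) \<bullet> e) y"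
    have int: "integrable lborel (?g z)" if "z \<in> F" for z
    proof (rule ball_integrable)
      have "norm z \<le> 1" using F(2) that by auto
      then show "s + z \<bullet> e \<le> T - 1" using s inner_e_bound[of z] by (auto simp: abs_le_iff)
    qed (use \<rho> in linarith)
    have le: "J (x - y) * \<psi> (s - (x - y) \<bullet> e) y \<le> B * (\<Sum>z\<in>F. ?g z y)" for y
    proof (cases "norm (x - y) \<le> 1")
      case True
      then have "y - x \<in> cball 0 1" by (simp add: norm_minus_commute)
      then obtain z where z: "z \<in> F" "y - x \<in> ball z \<rho>" using F(3) by blast
      have "?g z y = \<psi> (s - (x - y) \<bullet> e) y"
      proof -
        have i: "indicator (cball (x + z) \<rho>) y = (1::real)" using z(2) by (simp add: dist_norm algebra_simps)
        have eq: "s + z \<bullet> e - (x + z - y) \<bullet> e = s - (x - y) \<bullet> e" by (simp add: inner_diff_left inner_add_left)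
        show ?thesis unfolding i eq by simp
      qed
      moreover have "?g z y \<le> (\<Sum>z\<in>F. ?g z y)" using \<psi>_pos by (intro member_le_sum F z) (simp add: less_imp_le)
      ultimately show ?thesis using B \<psi>_pos J_nonneg by (intro mult_mono) (auto simp: less_imp_le)
    next
      case False
      have "0 \<le> B * (\<Sum>z\<in>F. ?g z y)" using B(1) \<psi>_pos by (intro mult_nonneg_nonneg sum_nonneg) (auto simp: less_imp_le)
      then show ?thesis using False K_supp[of "x - y"] by simp
    qed
    have "integrable lborel (\<lambda>z. J z * \<psi> (s - (x - (x - z)) \<bullet> e) (x - z))"
      by (rule integrable_conv[where v="\<lambda>y. \<psi> (s - (x - y) \<bullet> e) y", OF slice_measurable slice_bounded[OF sT]])
    from lborel_integrable_reflect[OF this, of x]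
    have "integrable lborel (\<lambda>y. J (x - y) * \<psi> (s - (x - y) \<bullet> e) y)" by simp
    then have "N s x \<le> (LINT y|lborel. B * (\<Sum>z\<in>F. ?g z y))"
      unfolding N_eq conv_def
      by (intro integral_mono le integrable_mult_right Bochner_Integration.integrable_sum int)
    also have "\<dots> = B * (\<Sum>z\<in>F. ball_avg \<rho> (s + z \<bullet> e) (x + z))"
      using int by (simp add: ball_avg_def)
    finally show "N s x \<le> B * (\<Sum>z\<in>F. ball_avg \<rho> (s + z \<bullet> e) (x + z))" .
  qed
qed

text \<open>\<open>N\<close> lies between multiples of ball averages: below a sum of them by the
  covering, above one of them because J \<ge> k0 near 0. The covering shifts s by at most 1, whence
  S0 + 1 and T - 4.\<close>

lemma N_harnack_aux:
  assumes "0 \<le> S0"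
  obtains C where "0 < C" "\<And>s s' x x'. s \<le> T - 4 \<Longrightarrow> s' \<le> T - 4 \<Longrightarrow> \<bar>s - s'\<bar> \<le> S0 \<Longrightarrow> N s' x' \<le> C * N s x"
proof -
  obtain F B where F: "finite F" "F \<subseteq> cball (0::real^'n) 1" "0 < B"
    "\<And>s x. s \<le> T - 2 \<Longrightarrow> N s x \<le> B * (\<Sum>z\<in>F. ball_avg \<rho> (s + z \<bullet> e) (x + z))"
    by (rule N_le_ball_avg_sum) (rule that)
  have "0 \<le> S0 + 1" using assms by simp
  then obtain C where C: "0 < C" "\<And>s s' x x'. s \<le> T - 3 \<Longrightarrow> s' \<le> T - 3 \<Longrightarrow> \<bar>s - s'\<bar> \<le> S0 + 1 \<Longrightarrow> ball_avg \<rho> s' x' \<le> C * ball_avg \<rho> s x"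
    by (rule ball_avg_harnack) (rule that)
  show ?thesis
  proof (rule that[of "B * (real (card F) + 1) * C / k0"])
    show "0 < B * (real (card F) + 1) * C / k0" using F C k0 by simp
    fix s s' x x' assume s: "s \<le> T - 4" "s' \<le> T - 4" "\<bar>s - s'\<bar> \<le> S0"
    have "N s' x' \<le> B * (\<Sum>z\<in>F. ball_avg \<rho> (s' + z \<bullet> e) (x' + z))" using s by (intro F) simp
    also have "\<dots> \<le> B * (\<Sum>z\<in>F. C * ball_avg \<rho> s x)"
    proof (intro mult_left_mono sum_mono)
      fix z assume "z \<in> F"
      then have "norm z \<le> 1" using F(2) by auto
      then have "\<bar>z \<bullet> e\<bar> \<le> 1" by (rule inner_e_bound)
      then show "ball_avg \<rho> (s' + z \<bullet> e) (x' + z) \<le> C * ball_avg \<rho> s x" using s by (intro C) (auto simp: abs_le_iff)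
    qed (use F in simp)
    also have "\<dots> = B * card F * C * ball_avg \<rho> s x" by simp
    also have "\<dots> \<le> B * (card F + 1) * C * ball_avg \<rho> s x"
      using F C ball_avg_nonneg by (intro mult_right_mono mult_left_mono) auto
    also have "\<dots> \<le> B * (card F + 1) * C * (N s x / k0)"
    proof (intro mult_left_mono)
      have "k0 * ball_avg \<rho> s x \<le> N (s - (x - x) \<bullet> e) x"
        using N_ge_ball_avg[OF k0(2) \<rho>(2) k0(1), of s x \<rho> x] s \<rho> by (auto simp: subset_cball)
      then show "ball_avg \<rho> s x \<le> N s x / k0" using k0(1) by (simp add: pos_le_divide_eq mult.commute)
    qed (use F C in auto)
    finally show "N s' x' \<le> B * (real (card F) + 1) * C / k0 * N s x" by (simp add: add.commute)
  qed
qed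

end

lemma N_harnack:
  assumes "0 \<le> S0"
  obtains C where "0 < C" "\<And>s s' x x'. s \<le> T - 4 \<Longrightarrow> s' \<le> T - 4 \<Longrightarrow> \<bar>s - s'\<bar> \<le> S0 \<Longrightarrow> N s' x' \<le> C * N s x"
proof -
  obtain \<sigma> k0 where r: "0 < \<sigma>" "\<sigma> \<le> 1" "0 < k0" "\<And>z. norm z \<le> \<sigma> \<Longrightarrow> k0 \<le> J z" using K_pos_near_0 by blast
  have 1: "0 < \<sigma> / 3" "3 * (\<sigma> / 3) \<le> 1" and 2: "\<And>z. norm z \<le> 3 * (\<sigma> / 3) \<Longrightarrow> k0 \<le> J z" using r by auto
  show ?thesis by (rule N_harnack_aux[OF 1 r(3) 2 assms]) (use that in blast)+
qed

end

subsection \<open>Geometric means of fronts\<close>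

text \<open>Moving the window of summation by one exchanges a single pair of boundary terms, whose
  difference is -w up to d. A shift by k therefore changes the sum by -k w with an error
  proportional to |k|, whatever the length of the window.\<close>

lemma sum_shift_lower:
  fixes lg :: "int \<Rightarrow> real"
  assumes "\<And>i. \<bar>i\<bar> \<le> \<kappa> \<Longrightarrow> \<bar>lg (int n + i) - lg i + w\<bar> \<le> d" "\<bar>k\<bar> \<le> \<kappa>"
  shows "(\<Sum>l<n. lg (int l)) - of_int k * w - of_int \<bar>k\<bar> * d \<le> (\<Sum>l<n. lg (int l + k))"
proof -
  define S where "S k = (\<Sum>l<n. lg (int l + k))" for k
  have step: "S (k + 1) = S k + (lg (int n + k) - lg k)" for k
  proof -
    have "S (k + 1) - S k = (\<Sum>l<n. lg (int (Suc l) + k) - lg (int l + k))"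
      unfolding S_def sum_subtractf[symmetric] by (intro sum.cong) (auto simp: algebra_simps)
    also have "\<dots> = lg (int n + k) - lg (int 0 + k)" by (rule sum_lessThan_telescope)
    finally show ?thesis by simp
  qed
  have pos: "int i \<le> \<kappa> \<Longrightarrow> S 0 - real i * w - real i * d \<le> S (int i)" for i
  proof (induction i)
    case (Suc i)
    have "\<bar>lg (int n + int i) - lg (int i) + w\<bar> \<le> d" using Suc.prems by (intro assms) auto
    then have "- w - d \<le> lg (int n + int i) - lg (int i)" by (simp add: abs_le_iff)
    then show ?case using Suc.IH Suc.prems step[of "int i"] by (simp add: algebra_simps)
  qed simp
  have neg: "int i \<le> \<kappa> \<Longrightarrow> S 0 + real i * w - real i * d \<le> S (- int i)" for i
  proof (induction i)
    case (Suc i)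
    have "\<bar>lg (int n + (- int (Suc i))) - lg (- int (Suc i)) + w\<bar> \<le> d" using Suc.prems by (intro assms) auto
    then have "lg (int n + (- int (Suc i))) - lg (- int (Suc i)) \<le> - w + d" by (simp add: abs_le_iff)
    then show ?case using Suc.IH Suc.prems step[of "- int (Suc i)"] by (simp add: algebra_simps)
  qed simp
  show ?thesis
  proof (cases "0 \<le> k")
    case True
    then show ?thesis using pos[of "nat k"] assms(2) by (simp add: S_def)
  next
    case False
    then show ?thesis using neg[of "nat (- k)"] assms(2) by (simp add: S_def)
  qed
qed

text \<open>Jensen's inequality for exp, from the tangent line at M / n.\<close>

lemma exp_mean_le_mean_exp:
  fixes Y :: "nat \<Rightarrow> real"
  assumes "M \<le> (\<Sum>l<n. Y l)" "0 < n"
  shows "real n * exp (M / n) \<le> (\<Sum>l<n. exp (Y l))"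
proof -
  let ?m = "M / n"
  have "exp ?m * (1 + (Y l - ?m)) \<le> exp (Y l)" for l
  proof -
    have "exp ?m * (1 + (Y l - ?m)) \<le> exp ?m * exp (Y l - ?m)" by (intro mult_left_mono exp_ge_add_one_self) auto
    then show ?thesis by (simp add: mult_exp_exp)
  qed
  then have "(\<Sum>l<n. exp ?m * (1 + (Y l - ?m))) \<le> (\<Sum>l<n. exp (Y l))" by (intro sum_mono)
  moreover have "(\<Sum>l<n. exp ?m * (1 + (Y l - ?m))) = exp ?m * (real n + ((\<Sum>l<n. Y l) - M))"
    using assms(2) by (simp add: sum_distrib_left[symmetric] sum.distrib sum_subtractf)
  moreover have "exp ?m * real n \<le> exp ?m * (real n + ((\<Sum>l<n. Y l) - M))"
    using assms(1) by (intro mult_left_mono) auto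
  ultimately have "exp ?m * real n \<le> (\<Sum>l<n. exp (Y l))" by linarith
  then show ?thesis by (simp only: mult.commute)
qed

text \<open>The sum equals (1 - exp (- D h m)) / (1 - exp (- D h)), and 1 - exp (- D h) \<le> D
  h.\<close>

lemma geometric_sum_lower:
  assumes "0 < D" "0 < h" "r \<le> 1 - exp (- (D * h * real m))"
  shows "r / (D * h) \<le> (\<Sum>j<m. exp (- (D * h)) ^ j)"
proof -
  have Dh: "0 < D * h" using assms by simp
  then have ne: "exp (- (D * h)) \<noteq> 1" "0 < 1 - exp (- (D * h))" using assms(1,2) by simp_all
  have "1 - exp (- (D * h)) \<le> D * h" using exp_ge_add_one_self[of "- (D * h)"] by simp
  have "exp (- (D * h)) ^ m = exp (- (D * h * real m))" by (simp add: exp_of_nat_mult[symmetric] mult.commute)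
  then have eq: "(\<Sum>j<m. exp (- (D * h)) ^ j) = (1 - exp (- (D * h * real m))) / (1 - exp (- (D * h)))"
    using ne by (simp add: sum_gp_strict)
  have "0 \<le> 1 - exp (- (D * h * real m))" using Dh by simp
  then have "(1 - exp (- (D * h * real m))) / (D * h) \<le> (1 - exp (- (D * h * real m))) / (1 - exp (- (D * h)))"
    using ne(2) \<open>1 - exp (- (D * h)) \<le> D * h\<close> by (intro divide_left_mono) auto
  moreover have "r / (D * h) \<le> (1 - exp (- (D * h * real m))) / (D * h)" using assms(3) Dh by (intro divide_right_mono) auto
  ultimately show ?thesis unfolding eq by linarith
qed

lemma (in bump) conv_weighted_sum:
  assumes "\<And>l. l \<in> S \<Longrightarrow> v l \<in> borel_measurable borel" "\<And>l y. l \<in> S \<Longrightarrow> norm (x - y) \<le> 1 \<Longrightarrow> \<bar>v l y\<bar> \<le> C"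
  shows "conv K (\<lambda>y. \<Sum>l\<in>S. g l * v l y) x = (\<Sum>l\<in>S. g l * conv K (v l) x)"
proof -
  have int: "integrable lborel (\<lambda>z. g l * (K z * v l (x - z)))" if "l \<in> S" for l
    using integrable_conv[OF assms(1)[OF that] assms(2)[OF that]] by (intro integrable_mult_right)
  have "conv K (\<lambda>y. \<Sum>l\<in>S. g l * v l y) x = (LINT z|lborel. (\<Sum>l\<in>S. g l * (K z * v l (x - z))))"
    unfolding conv_eq by (simp add: sum_distrib_left mult.left_commute)
  also have "\<dots> = (\<Sum>l\<in>S. (LINT z|lborel. g l * (K z * v l (x - z))))" by (rule Bochner_Integration.integral_sum[OF int])
  finally show ?thesis by (simp add: conv_eq)
qed

section \<open>Geometric means of \<open>N\<close> and the lower bound for the speed\<close>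

context kpp_wave
begin

abbreviation L :: "real \<Rightarrow> real^'n \<Rightarrow> real" where "L s x \<equiv> ln (N s x)"

lemma L_harnack:
  assumes "0 \<le> S0"
  obtains C where "0 \<le> C" "\<And>s s' x x'. s \<le> T - 4 \<Longrightarrow> s' \<le> T - 4 \<Longrightarrow> \<bar>s - s'\<bar> \<le> S0 \<Longrightarrow> \<bar>L s' x' - L s x\<bar> \<le> C"
proof -
  obtain C where C: "0 < C" "\<And>s s' x x'. s \<le> T - 4 \<Longrightarrow> s' \<le> T - 4 \<Longrightarrow> \<bar>s - s'\<bar> \<le> S0 \<Longrightarrow> N s' x' \<le> C * N s x"
    by (rule N_harnack[OF assms]) (rule that)
  have le: "L s' x' - L s x \<le> \<bar>ln C\<bar>" if s: "s \<le> T - 4" "s' \<le> T - 4" "\<bar>s - s'\<bar> \<le> S0" for s s' x x'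
  proof -
    have p: "0 < N s' x'" "0 < N s x" using s by (auto intro!: N_pos)
    have "ln (N s' x') \<le> ln (C * N s x)" using C(2)[OF s] p C(1) by simp
    also have "\<dots> = ln C + ln (N s x)" using C(1) p by (simp add: ln_mult)
    finally show ?thesis by simp
  qed
  show ?thesis
  proof (rule that[of "\<bar>ln C\<bar>"])
    fix s s' x x' assume s: "s \<le> T - 4" "s' \<le> T - 4" "\<bar>s - s'\<bar> \<le> S0"
    show "\<bar>L s' x' - L s x\<bar> \<le> \<bar>ln C\<bar>"
      using le[OF s, of x' x] le[of s' s x x'] s by (simp add: abs_le_iff abs_minus_commute)
  qed simp
qed

text \<open>Chains the Harnack inequality over unit steps, so that the mean slope of
  \<open>L\<close> over long intervals has a bound independent of their length.\<close>

lemma L_growth_bound: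
  assumes "\<And>s s' x x'. s \<le> T - 4 \<Longrightarrow> s' \<le> T - 4 \<Longrightarrow> \<bar>s - s'\<bar> \<le> 1 \<Longrightarrow> \<bar>L s' x' - L s x\<bar> \<le> C" "0 \<le> C"
  shows "b \<le> T - 4 \<Longrightarrow> 0 \<le> D \<Longrightarrow> D \<le> real k \<Longrightarrow> L b x - L (b - D) x \<le> k * C"
proof (induction k arbitrary: b D)
  case (Suc k)
  show ?case
  proof (cases "D \<le> 1")
    case True
    have "L b x - L (b - D) x \<le> 1 * C" using assms(1)[of "b - D" b x x] Suc.prems True by (simp add: abs_le_iff)
    also have "\<dots> \<le> real (Suc k) * C" using assms(2) by (intro mult_right_mono) auto
    finally show ?thesis .
  next
    case False
    have "L (b - 1) x - L (b - 1 - (D - 1)) x \<le> k * C" using Suc.prems False by (intro Suc.IH) auto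
    moreover have "L b x - L (b - 1) x \<le> C" using assms(1)[of "b - 1" b x x] Suc.prems by (simp add: abs_le_iff)
    ultimately show ?thesis by (simp add: algebra_simps)
  qed
qed simp

text \<open>The geometric mean over time shifts of the positive supersolution \<open>N\<close> of the linearized
  equation is, by Jensen's inequality, again a supersolution. Under a shift it only picks up an
  exponential factor, up to boundary terms that Harnack's inequality controls.\<close>

lemma geometric_mean_supersolution:
  fixes h \<tau> \<beta> b C :: real and m n :: nat and \<kappa> :: int and x0 :: "real^'n"
  assumes h: "0 < h" and n: "0 < n" and \<beta>: "0 < \<beta>" and C: "0 \<le> C"
  defines "\<tau> \<equiv> c * h"
  defines "\<kappa> \<equiv> \<lceil>1 / \<tau>\<rceil> + int m + 2"
  assumes b: "b + of_int \<kappa> * \<tau> \<le> T - 4"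
    and harnack: "\<And>s s' x x'. s \<le> T - 4 \<Longrightarrow> s' \<le> T - 4 \<Longrightarrow> \<bar>s - s'\<bar> \<le> of_int \<kappa> * \<tau> \<Longrightarrow> \<bar>L s' x' - L s x\<bar> \<le> C"
    and slope: "L b x0 - L (b - n * \<tau>) x0 = \<beta> * (n * \<tau>)"
  defines "A \<equiv> \<lambda>y. (\<Sum>l<n. L (b - real l * \<tau>) y) / n"
  defines "kk \<equiv> \<lambda>y. \<Sum>j<m. h * exp (- K * h) * exp ((f_u f y 0 - 1 - \<epsilon>) * h) ^ j * exp (- (\<beta> * \<tau> * (real j + 1)))"
  shows "exp (- K * h - \<beta> * \<tau> - 2 * of_int \<kappa> * C / n) * conv (Jt (- \<beta>)) (\<lambda>y. kk y * exp (A y)) x \<le> exp (A x)"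
proof -
  have \<tau>: "0 < \<tau>" using c h by (simp add: \<tau>_def)
  have c1: "0 < 1 / \<tau>" using \<tau> by simp
  then have "0 \<le> \<lceil>1 / \<tau>\<rceil>" by linarith
  then have \<kappa>0: "0 \<le> \<kappa>" by (simp add: \<kappa>_def)
  define lg where "lg y i = L (b - of_int i * \<tau>) y" for y and i :: int
  have low: "b - of_int i * \<tau> \<le> T - 4" if "- \<kappa> \<le> i" for i :: int
  proof -
    have "- of_int i \<le> (of_int \<kappa> :: real)" using that by linarith
    then have "- of_int i * \<tau> \<le> of_int \<kappa> * \<tau>" using \<tau> by (intro mult_right_mono) auto
    then show ?thesis using b by simp
  qed
  have lgN: "exp (lg y i) = N (b - of_int i * \<tau>) y" if "- \<kappa> \<le> i" for y i
    using low[OF that] unfolding lg_def by (intro exp_ln N_pos) simp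
  \<comment> \<open>Both logarithms are compared by Harnack with the reference values at
    \<open>x0\<close>, whose difference is prescribed by \<open>slope\<close>; hence the error 2 C,
    whatever n is.\<close>
  have near: "\<bar>lg y (int n + i) - lg y i + \<beta> * (n * \<tau>)\<bar> \<le> 2 * C" if i: "\<bar>i\<bar> \<le> \<kappa>" for y i
  proof -
    have i': "\<bar>of_int i\<bar> * \<tau> \<le> of_int \<kappa> * \<tau>" using i \<tau> by (intro mult_right_mono) linarith+
    have it: "\<bar>of_int i * \<tau>\<bar> = \<bar>of_int i\<bar> * \<tau>" using \<tau> by (simp add: abs_mult)
    have "\<bar>lg y i - L b x0\<bar> \<le> C"
      unfolding lg_def using low[of i] low[of 0] \<kappa>0 i i' it by (intro harnack) auto
    moreover have "\<bar>lg y (int n + i) - L (b - n * \<tau>) x0\<bar> \<le> C"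
      unfolding lg_def using low[of "int n + i"] low[of "int n"] \<kappa>0 i i' it
      by (intro harnack) (auto simp: algebra_simps)
    ultimately show ?thesis using slope by (auto simp: abs_le_iff)
  qed
  define E where "E = exp (- K * h - \<beta> * \<tau> - 2 * of_int \<kappa> * C / n)"
  \<comment> \<open>The estimate pointwise in y, before convolving. \<open>E\<close> gathers the
    losses: exp (- K h) from \<open>N_growth\<close>, exp (- \<beta> \<tau>) from rounding, the rest
    from the boundary terms of the shifted sums.\<close>
  have key: "real n * (E * exp (- A x)) * (exp (- \<beta> * ((x - y) \<bullet> e)) * (kk y * exp (A y)))
      \<le> (\<Sum>l<n. exp (- lg x (int l)) * duhamel_sum h m (b - real l * \<tau>) x y)" if y: "norm (x - y) \<le> 1" for y
  proof -
    \<comment> \<open>The shift (x - y).e is rounded up to a multiple of \<open>\<tau>\<close>, so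
      that it acts as an index shift on the grid. The remainder is a time h' \<le> h, over which
      \<open>N_growth\<close> loses at most exp (- K h).\<close>
    define i where "i = \<lceil>(x - y) \<bullet> e / \<tau>\<rceil>"
    have xy: "\<bar>(x - y) \<bullet> e\<bar> \<le> 1" by (rule inner_e_bound[OF y])
    have i1: "(x - y) \<bullet> e \<le> of_int i * \<tau>" "of_int i * \<tau> \<le> (x - y) \<bullet> e + \<tau>"
    proof -
      have "(x - y) \<bullet> e / \<tau> \<le> of_int i" unfolding i_def by linarith
      then show "(x - y) \<bullet> e \<le> of_int i * \<tau>" using \<tau> by (simp add: pos_divide_le_eq)
      have "of_int i \<le> (x - y) \<bullet> e / \<tau> + 1" unfolding i_def by linarith
      then have "of_int i * \<tau> \<le> ((x - y) \<bullet> e / \<tau> + 1) * \<tau>" using \<tau> by (intro mult_right_mono) auto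
      then show "of_int i * \<tau> \<le> (x - y) \<bullet> e + \<tau>" using \<tau> by (simp add: distrib_right)
    qed
    have ib: "\<bar>i\<bar> \<le> \<lceil>1 / \<tau>\<rceil> + 1"
    proof -
      have "\<bar>(x - y) \<bullet> e / \<tau>\<bar> \<le> 1 / \<tau>" using xy \<tau> by (simp add: abs_divide divide_right_mono)
      then have "(x - y) \<bullet> e / \<tau> \<le> 1 / \<tau>" "- (1 / \<tau>) \<le> (x - y) \<bullet> e / \<tau>" by linarith+
      then show ?thesis unfolding i_def by linarith
    qed
    define P where "P j = h * exp (- K * h) * exp ((f_u f y 0 - 1 - \<epsilon>) * h) ^ j" for j
    have P0: "0 \<le> P j" for j using h by (simp add: P_def)
    \<comment> \<open>Total index shift: i from the displacement and j + 1 from the Duhamel sum.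
      \<open>\<kappa>\<close> is large enough to bound it for all j < m.\<close>
    define k where "k j = i + int j + 1" for j
    have kb: "\<bar>k j\<bar> \<le> \<kappa>" if "j < m" for j using ib that by (auto simp: k_def \<kappa>_def abs_le_iff)
    have term_le: "real n * (E * exp (- A x)) * (exp (- \<beta> * ((x - y) \<bullet> e)) * (exp (- (\<beta> * \<tau> * (real j + 1))) * exp (A y)))
      \<le> (\<Sum>l<n. exp (- lg x (int l)) * N (b - real l * \<tau> - (x - y) \<bullet> e - \<tau> * (real j + 1)) y)" if j: "j < m" for j
    proof -
      have l_le: "exp (- K * h) * exp (lg y (int l + k j) - lg x (int l)) 
          \<le> exp (- lg x (int l)) * N (b - real l * \<tau> - (x - y) \<bullet> e - \<tau> * (real j + 1)) y" if l: "l < n" for l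
      proof -
        have kl: "- \<kappa> \<le> int l + k j" using kb[OF j] by linarith
        define h' where "h' = (of_int i * \<tau> - (x - y) \<bullet> e) / c"
        have h'0: "0 \<le> h'" using i1 c by (simp add: h'_def)
        have "of_int i * \<tau> - (x - y) \<bullet> e \<le> c * h" using i1(2) by (simp add: \<tau>_def)
        then have h'h: "h' \<le> h" using c by (simp add: h'_def pos_divide_le_eq mult.commute)
        have eq: "b - of_int (int l + k j) * \<tau> + c * h' = b - real l * \<tau> - (x - y) \<bullet> e - \<tau> * (real j + 1)"
        proof -
          have "c * h' = of_int i * \<tau> - (x - y) \<bullet> e" using c by (simp add: h'_def)
          then show ?thesis by (simp add: k_def algebra_simps)
        qed
        have "(real j + 1) * \<tau> + real l * \<tau> \<ge> 0" using \<tau> by simp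
        moreover have "1 \<le> of_int \<kappa> * \<tau>"
        proof -
          have "1 / \<tau> \<le> of_int \<kappa>" unfolding \<kappa>_def by linarith
          then show ?thesis using \<tau> by (simp add: pos_divide_le_eq)
        qed
        ultimately have sT: "b - of_int (int l + k j) * \<tau> + c * h' \<le> T - 1"
          unfolding eq using b xy by (auto simp: abs_le_iff algebra_simps)
        have "exp (- K * h) * exp (lg y (int l + k j)) \<le> exp (- K * h') * exp (lg y (int l + k j))"
          using h'h K(1) by (intro mult_right_mono) auto
        also have "\<dots> \<le> N (b - of_int (int l + k j) * \<tau> + c * h') y"
          unfolding lgN[OF kl] by (rule N_growth[OF h'0 sT])
        finally have "exp (- K * h) * exp (lg y (int l + k j)) \<le> N (b - real l * \<tau> - (x - y) \<bullet> e - \<tau> * (real j + 1)) y"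
          unfolding eq .
        then have le: "exp (- lg x (int l)) * (exp (- K * h) * exp (lg y (int l + k j)))
          \<le> exp (- lg x (int l)) * N (b - real l * \<tau> - (x - y) \<bullet> e - \<tau> * (real j + 1)) y" by (intro mult_left_mono) auto
        have eq': "exp (- lg x (int l)) * (exp (- K * h) * exp (lg y (int l + k j)))
          = exp (- K * h) * exp (lg y (int l + k j) - lg x (int l))" by (simp add: exp_diff exp_minus field_simps)
        show ?thesis using le unfolding eq' .
      qed
      \<comment> \<open>Lower bound for the sum of logarithmic differences after the shift by
        \<open>k j\<close>; Jensen's inequality turns its mean into a factor.\<close>
      let ?M = "n * A y - n * A x - of_int (k j) * (\<beta> * (n * \<tau>)) - of_int \<kappa> * (2 * C)"
      have nA: "n * A y = (\<Sum>l<n. lg y (int l))" for y using n by (simp add: A_def lg_def)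
      have M: "?M \<le> (\<Sum>l<n. lg y (int l + k j) - lg x (int l))"
      proof -
        have "(\<Sum>l<n. lg y (int l)) - of_int (k j) * (\<beta> * (n * \<tau>)) - of_int \<bar>k j\<bar> * (2 * C) \<le> (\<Sum>l<n. lg y (int l + k j))"
          by (rule sum_shift_lower[where lg="lg y" and n=n and k="k j", OF near kb[OF j]])
        moreover have "of_int \<bar>k j\<bar> * (2 * C) \<le> of_int \<kappa> * (2 * C)" using kb[OF j] C by (intro mult_right_mono) auto
        ultimately show ?thesis by (simp add: nA sum_subtractf)
      qed
      have "exp (- K * h) * (real n * exp (?M / n)) \<le> exp (- K * h) * (\<Sum>l<n. exp (lg y (int l + k j) - lg x (int l)))"
        using exp_mean_le_mean_exp[OF M n] by (intro mult_left_mono) auto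
      also have "\<dots> \<le> (\<Sum>l<n. exp (- lg x (int l)) * N (b - real l * \<tau> - (x - y) \<bullet> e - \<tau> * (real j + 1)) y)"
        unfolding sum_distrib_left by (intro sum_mono l_le) simp
      finally have 1: "exp (- K * h) * (real n * exp (?M / n)) \<le> \<dots>" .
      have "?M / n = A y - A x - of_int (k j) * \<beta> * \<tau> - 2 * of_int \<kappa> * C / n"
        using n by (simp add: diff_divide_distrib)
      moreover have "of_int (k j) * \<beta> * \<tau> \<le> \<beta> * ((x - y) \<bullet> e) + \<beta> * \<tau> + \<beta> * \<tau> * (real j + 1)"
      proof -
        have "\<beta> * (of_int i * \<tau>) \<le> \<beta> * ((x - y) \<bullet> e + \<tau>)" using i1(2) \<beta> by (intro mult_left_mono) auto
        then show ?thesis by (simp add: k_def algebra_simps)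
      qed
      ultimately have "(- K * h - \<beta> * \<tau> - 2 * of_int \<kappa> * C / n) + (- A x) + (- \<beta> * ((x - y) \<bullet> e)) + (- (\<beta> * \<tau> * (real j + 1))) + A y
        \<le> - K * h + ?M / n" by simp
      then have "exp ((- K * h - \<beta> * \<tau> - 2 * of_int \<kappa> * C / n) + (- A x) + (- \<beta> * ((x - y) \<bullet> e)) + (- (\<beta> * \<tau> * (real j + 1))) + A y)
        \<le> exp (- K * h + ?M / n)" by (simp only: exp_le_cancel_iff)
      then have "E * exp (- A x) * (exp (- \<beta> * ((x - y) \<bullet> e)) * (exp (- (\<beta> * \<tau> * (real j + 1))) * exp (A y))) \<le> exp (- K * h) * exp (?M / n)"
        unfolding exp_add E_def by (simp only: mult.assoc)
      then have "real n * (E * exp (- A x) * (exp (- \<beta> * ((x - y) \<bullet> e)) * (exp (- (\<beta> * \<tau> * (real j + 1))) * exp (A y)))) \<le> real n * (exp (- K * h) * exp (?M / n))"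
        by (intro mult_left_mono) auto
      then show ?thesis using 1 by (simp only: mult_ac) 
    qed
    have "real n * (E * exp (- A x)) * (exp (- \<beta> * ((x - y) \<bullet> e)) * (kk y * exp (A y)))
      = (\<Sum>j<m. P j * (real n * (E * exp (- A x)) * (exp (- \<beta> * ((x - y) \<bullet> e)) * (exp (- (\<beta> * \<tau> * (real j + 1))) * exp (A y)))))"
      unfolding kk_def P_def[symmetric] sum_distrib_left sum_distrib_right by (intro sum.cong refl) (simp only: mult_ac)
    also have "\<dots> \<le> (\<Sum>j<m. P j * (\<Sum>l<n. exp (- lg x (int l)) * N (b - real l * \<tau> - (x - y) \<bullet> e - \<tau> * (real j + 1)) y))"
      by (intro sum_mono mult_left_mono P0 term_le) simp
    also have "\<dots> = (\<Sum>l<n. exp (- lg x (int l)) * duhamel_sum h m (b - real l * \<tau>) x y)"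
      unfolding duhamel_sum_def P_def[symmetric] sum_distrib_left \<tau>_def[symmetric]
      by (subst sum.swap) (intro sum.cong refl, simp only: mult_ac)
    finally show ?thesis .
  qed
  have bl: "b - real l * \<tau> \<le> T - 4" for l using low[of "int l"] \<kappa>0 by simp
  have bl2: "b - real l * \<tau> \<le> T - 2" for l using bl[of l] by simp
  have h0: "0 \<le> h" using h by simp
  have "conv J (\<lambda>y. real n * (E * exp (- A x)) * (exp (- \<beta> * ((x - y) \<bullet> e)) * (kk y * exp (A y)))) x
    \<le> conv J (\<lambda>y. \<Sum>l<n. exp (- lg x (int l)) * duhamel_sum h m (b - real l * \<tau>) x y) x"
  proof (rule conv_mono[where C="\<Sum>l<n. exp (- lg x (int l)) * \<eta>"])
    have [measurable]: "(\<lambda>y. f_u f y 0) \<in> borel_measurable borel" by (rule C_per_measurable[OF f_u_C_per])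
    note [measurable] = N_measurable duhamel_sum_measurable
    show "(\<lambda>y. real n * (E * exp (- A x)) * (exp (- \<beta> * ((x - y) \<bullet> e)) * (kk y * exp (A y)))) \<in> borel_measurable borel"
      unfolding kk_def A_def by measurable
    show "(\<lambda>y. \<Sum>l<n. exp (- lg x (int l)) * duhamel_sum h m (b - real l * \<tau>) x y) \<in> borel_measurable borel" by measurable
    fix y assume y: "norm (x - y) \<le> 1"
    show "real n * (E * exp (- A x)) * (exp (- \<beta> * ((x - y) \<bullet> e)) * (kk y * exp (A y)))
      \<le> (\<Sum>l<n. exp (- lg x (int l)) * duhamel_sum h m (b - real l * \<tau>) x y)" by (rule key[OF y])
    have "\<bar>\<Sum>l<n. exp (- lg x (int l)) * duhamel_sum h m (b - real l * \<tau>) x y\<bar> \<le> (\<Sum>l<n. \<bar>exp (- lg x (int l)) * duhamel_sum h m (b - real l * \<tau>) x y\<bar>)"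
      by (rule sum_abs)
    also have "\<dots> \<le> (\<Sum>l<n. exp (- lg x (int l)) * \<eta>)"
      unfolding abs_mult abs_exp_cancel by (intro sum_mono mult_left_mono duhamel_sum_bounds(2)[OF h0 bl2 y]) simp
    finally show B: "\<bar>\<Sum>l<n. exp (- lg x (int l)) * duhamel_sum h m (b - real l * \<tau>) x y\<bar> \<le> (\<Sum>l<n. exp (- lg x (int l)) * \<eta>)" .
    have "0 \<le> kk y" unfolding kk_def using h by (intro sum_nonneg) simp
    then have "0 \<le> real n * (E * exp (- A x)) * (exp (- \<beta> * ((x - y) \<bullet> e)) * (kk y * exp (A y)))" by (simp add: E_def)
    then show "\<bar>real n * (E * exp (- A x)) * (exp (- \<beta> * ((x - y) \<bullet> e)) * (kk y * exp (A y)))\<bar> \<le> (\<Sum>l<n. exp (- lg x (int l)) * \<eta>)"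
      using key[OF y] B by linarith
  qed
  also have "\<dots> = (\<Sum>l<n. exp (- lg x (int l)) * conv J (duhamel_sum h m (b - real l * \<tau>) x) x)"
    by (rule conv_weighted_sum[where C=\<eta>]) (use duhamel_sum_measurable duhamel_sum_bounds(2)[OF h0 bl2] in auto)
  also have "\<dots> \<le> (\<Sum>l<n. exp (- lg x (int l)) * exp (lg x (int l)))"
  proof (intro sum_mono mult_left_mono)
    fix l
    have "exp (lg x (int l)) = N (b - real l * \<tau>) x" using lgN[of "int l" x] \<kappa>0 by simp
    then show "conv J (duhamel_sum h m (b - real l * \<tau>) x) x \<le> exp (lg x (int l))" using N_duhamel[OF h0 bl2] by simp
  qed simp
  also have "\<dots> = real n" by (simp add: mult_exp_exp)
  finally have "real n * (E * exp (- A x)) * conv J (\<lambda>y. exp (- \<beta> * ((x - y) \<bullet> e)) * (kk y * exp (A y))) x \<le> real n * 1"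
    unfolding conv_cmult by simp
  then have "E * exp (- A x) * conv J (\<lambda>y. exp (- \<beta> * ((x - y) \<bullet> e)) * (kk y * exp (A y))) x \<le> 1"
    using n by (simp only: mult.assoc) simp
  moreover have "conv J (\<lambda>y. exp (- \<beta> * ((x - y) \<bullet> e)) * (kk y * exp (A y))) x = conv (Jt (- \<beta>)) (\<lambda>y. kk y * exp (A y)) x"
    by (simp add: conv_def tilted_kernel_def mult_ac)
  ultimately have "exp (A x) * (E * exp (- A x) * conv (Jt (- \<beta>)) (\<lambda>y. kk y * exp (A y)) x) \<le> exp (A x) * 1"
    by (intro mult_left_mono) auto
  then show ?thesis by (simp add: E_def exp_minus field_simps)
qed

text \<open>The proof compares the geometric mean of \<open>N\<close> with the principal eigenfunction. The
  parameters are chosen in the order \<open>h\<close> (small), \<open>m\<close> (large), \<open>n\<close> (large), so that the three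
  error factors are each at least \<open>r\<close>, where \<open>r\<^sup>3 g > 1\<close>.\<close>

lemma wave_speed_bound:
  assumes \<epsilon>: "0 < \<epsilon>" and d: "0 < d" "\<And>x. d \<le> \<nu>0 - (f_u f x 0 - 1)" "4 * \<epsilon> \<le> d"
  shows "\<exists>\<beta>>0. nu \<beta> < c * \<beta> + 3 * \<epsilon>"
proof (rule ccontr)
  assume "\<not> ?thesis"
  then have ge: "c * \<beta> + 3 * \<epsilon> \<le> nu \<beta>" if "0 < \<beta>" for \<beta> using that by (meson not_less)
  define a where "a x = f_u f x 0 - 1" for x
  have aC: "a \<in> C_per" unfolding a_def[abs_def] by (rule a_C_per)
  obtain A0 where A0: "0 < A0" "\<And>x. \<bar>a x\<bar> \<le> A0" using C_per_bounded[OF aC] by metis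
  obtain C1 where C1: "0 \<le> C1" "\<And>s s' x x'. s \<le> T - 4 \<Longrightarrow> s' \<le> T - 4 \<Longrightarrow> \<bar>s - s'\<bar> \<le> 1 \<Longrightarrow> \<bar>L s' x' - L s x\<bar> \<le> C1"
    by (rule L_harnack[OF zero_le_one]) (rule that)
  \<comment> \<open>A bound for the slope \<beta> defined below, available before h, m and n are
    chosen; the factor 2 comes from rounding the length n \<tau> \<ge> 1 up to an integer.\<close>
  define \<Lambda> where "\<Lambda> = 2 * C1 + 1"
  have \<Lambda>: "0 < \<Lambda>" using C1(1) by (simp add: \<Lambda>_def)
  define Dm where "Dm = exp \<Lambda> * (nu 0 + A0)"
  have nuA: "0 < nu 0 + A0" using nu_ge[of 0] d(1) d(2)[of 0] A0(2)[of 0] by (auto simp: a_def abs_le_iff)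
  then have Dm: "0 < Dm" by (simp add: Dm_def)
  have D_le: "nu \<beta> - a x \<le> Dm" if "0 < \<beta>" "\<beta> \<le> \<Lambda>" for \<beta> x
  proof -
    have "nu \<beta> + A0 \<le> exp \<bar>\<beta> - 0\<bar> * (nu 0 + A0)" by (rule nu_shift_le) (use A0 in \<open>simp add: a_def\<close>)
    also have "\<dots> \<le> Dm" unfolding Dm_def using that nuA by (intro mult_right_mono) auto
    finally show ?thesis using A0(2)[of x] by (auto simp: abs_le_iff)
  qed
  \<comment> \<open>A lower bound for the gain D / (D - 2 \<epsilon>), valid for all weights D = nu
    \<beta> - a x that occur, since these are at most \<open>Dm\<close>.\<close>
  define g where "g = 1 + 2 * \<epsilon> / Dm"
  have g: "1 < g" using \<epsilon> Dm by (simp add: g_def)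
  \<comment> \<open>Chosen so that (1 - 3 t) g = 1 + \<delta>, while r^3 = (1 - t)^3 \<ge> 1 - 3
    t.\<close>
  define t where "t = (g - 1) / (6 * g)"
  define r where "r = 1 - t"
  have t: "0 < t" "t < 1" using g by (simp_all add: t_def)
  have r: "0 < r" "r < 1" using t by (simp_all add: r_def)
  define \<delta> where "\<delta> = (g - 1) / 2"
  have \<delta>: "0 < \<delta>" using g by (simp add: \<delta>_def)
  have r3g: "1 + \<delta> \<le> r * r * r * g"
  proof -
    have "0 \<le> t * t * (3 - t)" using t by simp
    then have "1 - 3 * t \<le> r * r * r" by (simp add: r_def algebra_simps)
    then have "(1 - 3 * t) * g \<le> r * r * r * g" using g by (intro mult_right_mono) auto
    moreover have tg: "t * g = (g - 1) / 6" using g by (simp add: t_def)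
    have "(1 - 3 * t) * g = g - 3 * (t * g)" by (simp add: algebra_simps)
    then have "(1 - 3 * t) * g = 1 + \<delta>" unfolding tg \<delta>_def by (simp add: field_simps)
    ultimately show ?thesis by simp
  qed
  \<comment> \<open>The factor exp (- K h - \<beta> \<tau>) is lost twice, once in \<open>E\<close>
    and once in \<open>kk\<close>; \<open>M\<close> bounds the total rate, and h makes exp (- M h)
    equal to r.\<close>
  define M where "M = 2 * K + 2 * c * \<Lambda>"
  have M: "0 < M" using K(1) c \<Lambda> by (simp add: M_def add_pos_pos)
  have lnr: "0 < - ln r" using r by simp
  define h where "h = - ln r / M"
  have h: "0 < h" unfolding h_def using lnr M by (rule divide_pos_pos)
  have exp_h: "exp (- (M * h)) = r" using M r(1) by (simp add: h_def)
  \<comment> \<open>Makes the tail exp (- D h m) of the geometric sum at most t for all D \<ge> d /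
    2.\<close>
  obtain m0 :: nat where m0: "- ln t / (d / 2 * h) \<le> m0" using real_arch_simple by blast
  define m where "m = Suc m0"
  have dm: "r \<le> 1 - exp (- (D * h * m))" if "d / 2 \<le> D" for D
  proof -
    have dh: "0 < d / 2 * h" using d h by simp
    have "- ln t \<le> m0 * (d / 2 * h)" using m0 dh by (simp only: pos_divide_le_eq)
    also have "\<dots> \<le> m * (d / 2 * h)" using dh by (intro mult_right_mono) (auto simp: m_def)
    also have "\<dots> \<le> m * (D * h)" using that h by (intro mult_left_mono mult_right_mono) auto
    finally have "- (D * h * m) \<le> ln t" by (simp add: mult_ac)
    then have "exp (- (D * h * m)) \<le> exp (ln t)" by (simp only: exp_le_cancel_iff)
    then show ?thesis using t by (simp add: r_def)
  qed
  define \<tau> where "\<tau> = c * h"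
  have \<tau>: "0 < \<tau>" using c h by (simp add: \<tau>_def)
  define \<kappa> where "\<kappa> = \<lceil>1 / \<tau>\<rceil> + int m + 2"
  have "0 < 1 / \<tau>" using \<tau> by simp
  then have "0 \<le> \<lceil>1 / \<tau>\<rceil>" by linarith
  then have \<kappa>0: "0 \<le> \<kappa>" by (simp add: \<kappa>_def)
  have \<kappa>\<tau>: "0 \<le> of_int \<kappa> * \<tau>" using \<kappa>0 \<tau> by simp
  \<comment> \<open>Leaves room for index shifts up to \<open>\<kappa>\<close> to the right.\<close>
  define b where "b = T - 4 - of_int \<kappa> * \<tau>"
  have bT: "b \<le> T - 4" using \<kappa>\<tau> by (simp add: b_def)
  obtain C where C: "0 \<le> C" "\<And>s s' x x'. s \<le> T - 4 \<Longrightarrow> s' \<le> T - 4 \<Longrightarrow> \<bar>s - s'\<bar> \<le> of_int \<kappa> * \<tau> \<Longrightarrow> \<bar>L s' x' - L s x\<bar> \<le> C"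
    by (rule L_harnack[OF \<kappa>\<tau>]) (rule that)
  \<comment> \<open>As the profile tends to 0 at minus infinity, \<open>N\<close> is smaller than
    this value far to the left, so the slope \<beta> is positive once n is large.\<close>
  have Nb: "0 < N b 0" using bT by (intro N_pos) simp
  have "\<forall>\<^sub>F s in at_bot. \<forall>x\<in>UNIV. dist (\<psi> s x) 0 < N b 0 / 2"
    using uniform_limitD[OF \<psi>_lim, of "N b 0 / 2"] Nb by simp
  then obtain S where S: "\<And>s x. s \<le> S \<Longrightarrow> dist (\<psi> s x) 0 < N b 0 / 2" unfolding eventually_at_bot_linorder by blast
  obtain n1 :: nat where n1: "2 * of_int \<kappa> * C / (- ln r) \<le> n1" using real_arch_simple by blast
  obtain n2 :: nat where n2: "1 / \<tau> \<le> n2" using real_arch_simple by blast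
  obtain n3 :: nat where n3: "(b + 1 - S) / \<tau> \<le> n3" using real_arch_simple by blast
  define n where "n = Suc (n1 + n2 + n3)"
  have n: "0 < n" "real n1 \<le> n" "real n2 \<le> n" "real n3 \<le> n" by (simp_all add: n_def)
  have exp_n: "r \<le> exp (- (2 * of_int \<kappa> * C / n))"
  proof -
    have "2 * of_int \<kappa> * C \<le> n1 * (- ln r)" using n1 lnr by (simp only: pos_divide_le_eq)
    also have "\<dots> \<le> n * (- ln r)" using n(2) lnr by (intro mult_right_mono) auto
    finally have "2 * of_int \<kappa> * C / n \<le> - ln r" using n(1) by (simp add: pos_divide_le_eq mult.commute)
    then have "exp (ln r) \<le> exp (- (2 * of_int \<kappa> * C / n))" by (simp only: exp_le_cancel_iff)
    then show ?thesis using r by simp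
  qed
  have n\<tau>: "1 \<le> n * \<tau>"
  proof -
    have "1 / \<tau> \<le> n" using n2 n(3) by linarith
    then show ?thesis using \<tau> by (simp add: pos_divide_le_eq)
  qed
  have Nlt: "N (b - n * \<tau>) 0 < N b 0"
  proof -
    have "(b + 1 - S) / \<tau> \<le> n" using n3 n(4) by linarith
    then have "b + 1 - S \<le> n * \<tau>" using \<tau> by (simp add: pos_divide_le_eq)
    then have "b - n * \<tau> + 1 \<le> S" by simp
    then have "\<psi> s' y \<le> N b 0 / 2" if "s' \<le> b - n * \<tau> + 1" for s' y
      using S[of s' y] that \<psi>_pos[of s' y] by (simp add: dist_real_def)
    then have "N (b - n * \<tau>) 0 \<le> N b 0 / 2" using bT n\<tau> by (intro N_le) auto
    then show ?thesis using Nb by linarith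
  qed
  \<comment> \<open>The mean logarithmic slope of \<open>N\<close> over n grid steps, measured at
    one point; Harnack's inequality extends it to all x up to an error that does not grow with
    n.\<close>
  define \<beta> where "\<beta> = (L b 0 - L (b - n * \<tau>) 0) / (n * \<tau>)"
  have slope: "L b 0 - L (b - n * \<tau>) 0 = \<beta> * (n * \<tau>)" using n\<tau> by (simp add: \<beta>_def)
  have \<beta>0: "0 < \<beta>"
  proof -
    have "0 < N (b - n * \<tau>) 0" using bT n\<tau> by (intro N_pos) simp
    then show ?thesis unfolding \<beta>_def using Nlt Nb n\<tau> by (intro divide_pos_pos) auto
  qed
  have \<beta>\<Lambda>: "\<beta> \<le> \<Lambda>"
  proof -
    have k: "n * \<tau> \<le> real (nat \<lceil>n * \<tau>\<rceil>)" "real (nat \<lceil>n * \<tau>\<rceil>) \<le> 2 * (n * \<tau>)" using n\<tau> by linarith+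
    have "L b 0 - L (b - n * \<tau>) 0 \<le> nat \<lceil>n * \<tau>\<rceil> * C1"
      by (rule L_growth_bound[OF C1(2,1) bT _ k(1)]) (use n\<tau> in auto)
    also have "\<dots> \<le> 2 * (n * \<tau>) * C1" using k(2) C1(1) by (intro mult_right_mono)
    finally have "\<beta> * (n * \<tau>) \<le> 2 * C1 * (n * \<tau>)" unfolding slope by (simp add: mult_ac)
    then have "\<beta> \<le> 2 * C1" using n\<tau> by (simp add: mult_le_cancel_right)
    then show ?thesis by (simp add: \<Lambda>_def)
  qed
  define A where "A y = (\<Sum>l<n. L (b - real l * \<tau>) y) / n" for y
  define kk where "kk y = (\<Sum>j<m. h * exp (- K * h) * exp ((f_u f y 0 - 1 - \<epsilon>) * h) ^ j * exp (- (\<beta> * \<tau> * (real j + 1))))" for y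
  define E where "E = exp (- K * h - \<beta> * \<tau> - 2 * of_int \<kappa> * C / n)"
  define \<theta> where "\<theta> y = kk y * exp (A y)" for y
  have super: "E * conv (Jt (- \<beta>)) \<theta> x \<le> exp (A x)" for x
    unfolding E_def \<theta>_def[abs_def] kk_def A_def
  proof (rule geometric_mean_supersolution[where m=m and b=b and ?x0.0=0, OF h n(1) \<beta>0 C(1), folded \<tau>_def, folded \<kappa>_def])
    show "b + of_int \<kappa> * \<tau> \<le> T - 4" by (simp add: b_def)
  qed (use C(2) slope in blast)+
  obtain \<xi> where "tk.eigen (- \<beta>) (\<lambda>x. f_u f x 0 - 1) (nu (- \<beta>)) \<xi>" using nu_eigen by blast
  then have \<xi>: "\<xi> \<in> C_per" "\<And>x. 0 < \<xi> x" "\<And>x. conv (Jt (- \<beta>)) \<xi> x = (nu \<beta> - a x) * \<xi> x"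
    by (auto simp: tk.eigen_def nu_uminus a_def)
  obtain M\<xi> where M\<xi>: "\<And>x. \<xi> x \<le> M\<xi>" using C_per_pos_bounds[OF \<xi>(1,2)] by metis
  have \<theta>m: "\<theta> \<in> borel_measurable borel"
  proof -
    have [measurable]: "(\<lambda>y. f_u f y 0) \<in> borel_measurable borel" by (rule C_per_measurable[OF f_u_C_per])
    note [measurable] = N_measurable
    show ?thesis unfolding \<theta>_def[abs_def] kk_def A_def by measurable
  qed
  \<comment> \<open>Crude bounds for \<open>kk\<close> that place \<theta> between the positive
    constants asked for by \<open>conv_compare\<close>.\<close>
  define kmin where "kmin = (\<Sum>j<m. h * exp (- K * h) * exp (- K * h) ^ j * exp (- (\<beta> * \<tau> * (real j + 1))))"
  define kmax where "kmax = (\<Sum>j<m. h * exp (- K * h) * exp (K * h) ^ j * exp (- (\<beta> * \<tau> * (real j + 1))))"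
  have kmin: "0 < kmin" unfolding kmin_def using h by (intro sum_pos) (auto simp: m_def)
  have kkb: "kmin \<le> kk y" "kk y \<le> kmax" for y
  proof -
    have "- K * h \<le> (f_u f y 0 - 1 - \<epsilon>) * h" "(f_u f y 0 - 1 - \<epsilon>) * h \<le> K * h"
      using K(2)[of y] h by (intro mult_right_mono; auto simp: abs_le_iff)+
    then have e: "exp (- K * h) \<le> exp ((f_u f y 0 - 1 - \<epsilon>) * h)" "exp ((f_u f y 0 - 1 - \<epsilon>) * h) \<le> exp (K * h)"
      by (simp_all only: exp_le_cancel_iff)
    show "kmin \<le> kk y" unfolding kmin_def kk_def
      using e(1) h by (intro sum_mono mult_right_mono mult_left_mono power_mono) auto
    show "kk y \<le> kmax" unfolding kmax_def kk_def
      using e(2) h by (intro sum_mono mult_right_mono mult_left_mono power_mono) auto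
  qed
  have Ab: "\<bar>A y - A 0\<bar> \<le> C" for y
  proof -
    have bl: "b - real l * \<tau> \<le> T - 4" for l using bT \<tau> by (smt (verit) mult_nonneg_nonneg of_nat_0_le_iff)
    have "\<bar>(\<Sum>l<n. L (b - real l * \<tau>) y) - (\<Sum>l<n. L (b - real l * \<tau>) 0)\<bar> \<le> (\<Sum>l<n. \<bar>L (b - real l * \<tau>) y - L (b - real l * \<tau>) 0\<bar>)"
      unfolding sum_subtractf[symmetric] by (rule sum_abs)
    also have "\<dots> \<le> (\<Sum>l<n. C)" using \<kappa>\<tau> by (intro sum_mono C(2) bl) simp
    finally have "\<bar>(\<Sum>l<n. L (b - real l * \<tau>) y) - (\<Sum>l<n. L (b - real l * \<tau>) 0)\<bar> / n \<le> C"
      using n(1) by (simp add: pos_divide_le_eq mult.commute)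
    then show ?thesis unfolding A_def diff_divide_distrib[symmetric] abs_divide by simp
  qed
  have E0: "0 < E" by (simp add: E_def)
  have kk0: "0 < kk y" for y using kkb(1)[of y] kmin by linarith
  show False
  proof (rule tk.conv_compare[OF \<theta>m C_per_measurable[OF \<xi>(1)], where m="kmin * exp (A 0 - C)" and M="kmax * exp (A 0 + C)"
        and F="\<lambda>x. 1 / (E * kk x)" and G="\<lambda>x. nu \<beta> - a x" and \<delta>=\<delta> and M'=M\<xi> and l="- \<beta>"])
    show "0 < kmin * exp (A 0 - C)" using kmin by simp
    show "kmin * exp (A 0 - C) \<le> \<theta> x" for x unfolding \<theta>_def
      using kkb(1)[of x] Ab[of x] kmin kk0[of x] by (intro mult_mono) (auto simp: abs_le_iff)
    show "\<theta> x \<le> kmax * exp (A 0 + C)" for x unfolding \<theta>_def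
      using kkb[of x] Ab[of x] kmin by (intro mult_mono) (auto simp: abs_le_iff)
    show "0 < \<xi> x" "\<xi> x \<le> M\<xi>" "(nu \<beta> - a x) * \<xi> x \<le> conv (Jt (- \<beta>)) \<xi> x" for x using \<xi> M\<xi> by simp_all
    show "conv (Jt (- \<beta>)) \<theta> x \<le> 1 / (E * kk x) * \<theta> x" for x
    proof -
      have "conv (Jt (- \<beta>)) \<theta> x \<le> exp (A x) / E" using super[of x] E0 by (simp add: pos_le_divide_eq mult.commute)
      then show ?thesis using kk0[of x] by (simp add: \<theta>_def)
    qed
    show "0 < \<delta>" by (rule \<delta>)
    show "(1 + \<delta>) * (1 / (E * kk x)) \<le> nu \<beta> - a x" for x
    proof -
      define D where "D = nu \<beta> - a x"
      \<comment> \<open>The contrary assumption nu \<beta> \<ge> c \<beta> + 3 \<epsilon> gives - D'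
        \<le> a - \<epsilon> - c \<beta>, the rate of the geometric sum in \<open>kk\<close>. Hence
        \<open>kk\<close> is at least nearly 1 / D', which beats 1 / D by the factor g.\<close>
      define D' where "D' = D - 2 * \<epsilon>"
      have D: "d \<le> D" "D \<le> Dm" using d(2)[of x] nu_ge[of \<beta>] D_le[OF \<beta>0 \<beta>\<Lambda>, of x] by (auto simp: D_def a_def)
      have D': "d / 2 \<le> D'" "0 < D'" using D(1) d by (auto simp: D'_def)
      have exp_le: "exp (- (D' * h)) \<le> exp ((f_u f x 0 - 1 - \<epsilon>) * h - \<beta> * \<tau>)"
      proof -
        have "- D' \<le> f_u f x 0 - 1 - \<epsilon> - c * \<beta>" using ge[OF \<beta>0] by (simp add: D'_def D_def a_def)
        then have "- D' * h \<le> (f_u f x 0 - 1 - \<epsilon> - c * \<beta>) * h" using h by (intro mult_right_mono) auto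
        then show ?thesis by (simp add: \<tau>_def algebra_simps)
      qed
      have "exp (- K * h) * exp (- (\<beta> * \<tau>)) * r / D' = h * exp (- K * h) * exp (- (\<beta> * \<tau>)) * (r / (D' * h))"
        using h by simp
      also have "\<dots> \<le> h * exp (- K * h) * exp (- (\<beta> * \<tau>)) * (\<Sum>j<m. exp (- (D' * h)) ^ j)"
        using h by (intro mult_left_mono geometric_sum_lower D' dm) auto
      also have "\<dots> \<le> h * exp (- K * h) * exp (- (\<beta> * \<tau>)) * (\<Sum>j<m. exp ((f_u f x 0 - 1 - \<epsilon>) * h - \<beta> * \<tau>) ^ j)"
        using h exp_le by (intro mult_left_mono sum_mono power_mono) auto
      also have "\<dots> = kk x"
        unfolding kk_def sum_distrib_left
      proof (intro sum.cong refl)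
        fix j
        have "exp (- (\<beta> * \<tau>)) * exp ((f_u f x 0 - 1 - \<epsilon>) * h - \<beta> * \<tau>) ^ j
            = exp ((f_u f x 0 - 1 - \<epsilon>) * h) ^ j * exp (- (\<beta> * \<tau> * (real j + 1)))"
          unfolding exp_of_nat_mult[symmetric] mult_exp_exp by (simp add: algebra_simps)
        then show "h * exp (- K * h) * exp (- (\<beta> * \<tau>)) * exp ((f_u f x 0 - 1 - \<epsilon>) * h - \<beta> * \<tau>) ^ j
            = h * exp (- K * h) * exp ((f_u f x 0 - 1 - \<epsilon>) * h) ^ j * exp (- (\<beta> * \<tau> * (real j + 1)))"
          by (simp only: mult.assoc)
      qed
      finally have kk_ge: "exp (- K * h) * exp (- (\<beta> * \<tau>)) * r / D' \<le> kk x" .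
      have gD: "g \<le> D / D'"
      proof -
        have "2 * \<epsilon> / Dm \<le> 2 * \<epsilon> / D'" using \<epsilon> D D' by (intro divide_left_mono) (auto simp: D'_def)
        then show ?thesis using D'(2) by (simp add: g_def D'_def field_simps)
      qed
      have er: "r \<le> exp (- K * h - \<beta> * \<tau> + (- K * h - \<beta> * \<tau>))"
      proof -
        have "c * h * \<beta> \<le> c * h * \<Lambda>" using \<beta>\<Lambda> c h by (intro mult_left_mono) auto
        then have "- (M * h) \<le> - K * h - \<beta> * \<tau> + (- K * h - \<beta> * \<tau>)" by (simp add: M_def \<tau>_def algebra_simps)
        then show ?thesis unfolding exp_h[symmetric] by (simp only: exp_le_cancel_iff)
      qed
      have "1 + \<delta> \<le> r * r * r * g" by (rule r3g)
      also have "\<dots> \<le> exp (- K * h - \<beta> * \<tau> + (- K * h - \<beta> * \<tau>)) * exp (- (2 * of_int \<kappa> * C / n)) * r * (D / D')"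
        using er exp_n gD r g by (intro mult_mono) auto
      also have "\<dots> = E * (exp (- K * h) * exp (- (\<beta> * \<tau>)) * r / D') * D"
      proof -
        have e1: "E = exp (- K * h - \<beta> * \<tau>) * exp (- (2 * of_int \<kappa> * C / n))" by (simp add: E_def mult_exp_exp)
        have e2: "exp (- K * h) * exp (- (\<beta> * \<tau>)) = exp (- K * h - \<beta> * \<tau>)" by (simp add: mult_exp_exp)
        have e3: "exp (z + z) * w * r * (D / D') = exp z * w * (exp z * r / D') * D" for z w :: real
          using exp_add[of z z] by simp
        show ?thesis unfolding e1 e2 by (rule e3)
      qed
      also have "\<dots> \<le> E * kk x * D" using kk_ge E0 D d by (intro mult_right_mono mult_left_mono) auto
      finally have "1 + \<delta> \<le> D * (E * kk x)" by (simp only: mult_ac)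
      then show ?thesis using E0 kk0[of x] by (simp add: D_def pos_divide_le_eq)
    qed
  qed
qed

end

subsection \<open>The minimal speed\<close>

lemma (in kpp) front_speed_bound:
  assumes c: "0 < c" and front: "pulsating_front J f e c u" and \<epsilon>: "0 < \<epsilon>"
    and d: "0 < d" "\<And>x. d \<le> \<nu>0 - (f_u f x 0 - 1)" "4 * \<epsilon> \<le> d"
  shows "\<exists>\<beta>>0. nu \<beta> < c * \<beta> + 3 * \<epsilon>"
proof -
  have sol: "entire_solution J f u" using front by (simp add: pulsating_front_def)
  obtain \<psi> where u: "\<And>x t. u x t = \<psi> (x \<bullet> e + c * t) x" and per: "\<And>s. periodic (\<psi> s)"
    and lim0: "uniform_limit UNIV \<psi> (\<lambda>x. 0) at_bot" and lim1: "uniform_limit UNIV \<psi> (stationary_state J f) at_top"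
    using front unfolding pulsating_front_def by blast
  have int: "integrable lborel (\<lambda>y. J (x - y) * u y t)"
    and der: "((\<lambda>\<tau>. u x \<tau>) has_real_derivative conv J (\<lambda>y. u y t) x - u x t + f x (u x t)) (at t)" for x t
    using sol by (auto simp: entire_solution_def)
  \<comment> \<open>As c > 0, each pair (s, x) corresponds to exactly one time, so the profile
    inherits measurability and positivity from u.\<close>
  have \<psi>u: "\<psi> s x = u x ((s - x \<bullet> e) / c)" for s x using c by (simp add: u)
  have um: "(\<lambda>y. u y t) \<in> borel_measurable borel" for t by (rule measurable_of_conv_integrable[OF int])
  have uc: "continuous_on UNIV (u y)" for y
    using der[of y] by (intro continuous_at_imp_continuous_on ballI DERIV_isCont) blast
  have \<psi>m: "(\<lambda>z. \<psi> (fst z) (snd z)) \<in> borel_measurable (borel \<Otimes>\<^sub>M borel)"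
  proof -
    have "(\<lambda>z. (snd z, (fst z - snd z \<bullet> e) / c)) \<in> borel \<Otimes>\<^sub>M borel \<rightarrow>\<^sub>M borel \<Otimes>\<^sub>M borel" by measurable
    from measurable_compose[OF this caratheodory_measurable[OF um uc]] show ?thesis by (simp add: \<psi>u)
  qed
  obtain Q where Q: "0 < Q" "\<And>x u. 0 \<le> u \<Longrightarrow> u \<le> 1 \<Longrightarrow> f_u f x 0 * u - Q * u\<^sup>2 \<le> f x u"
    using f_ge_quadratic by metis
  \<comment> \<open>Below this level the quadratic loss Q v^2 is at most \<epsilon> v.\<close>
  define \<eta> where "\<eta> = min 1 (\<epsilon> / Q)"
  have \<eta>: "0 < \<eta>" "\<eta> \<le> 1" "Q * \<eta> \<le> \<epsilon>"
  proof -
    show "0 < \<eta>" "\<eta> \<le> 1" using \<epsilon> Q by (simp_all add: \<eta>_def)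
    have "\<eta> \<le> \<epsilon> / Q" by (simp add: \<eta>_def)
    then show "Q * \<eta> \<le> \<epsilon>" using Q(1) by (simp add: pos_le_divide_eq mult.commute)
  qed
  obtain A0 where A0: "0 < A0" "\<And>x. \<bar>f_u f x 0\<bar> \<le> A0" using C_per_bounded[OF f_u_C_per] by metis
  have "\<forall>\<^sub>F s in at_bot. \<forall>x\<in>UNIV. dist (\<psi> s x) 0 < \<eta>" using uniform_limitD[OF lim0 \<eta>(1)] by simp
  then obtain T where T: "\<And>s x. s \<le> T \<Longrightarrow> dist (\<psi> s x) 0 < \<eta>" unfolding eventually_at_bot_linorder by blast
  interpret kpp_wave f J e \<phi>0 \<nu>0 c \<epsilon> "A0 + 1 + \<epsilon>" T \<eta> \<psi> "\<lambda>s x. conv J (\<lambda>y. \<psi> (s - (x - y) \<bullet> e) y) x"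
  proof unfold_locales
    show "0 < c" by (rule c)
    show "0 < A0 + 1 + \<epsilon>" using A0 \<epsilon> by simp
    show "\<bar>f_u f x 0 - 1 - \<epsilon>\<bar> \<le> A0 + 1 + \<epsilon>" for x using A0(2)[of x] \<epsilon> by (auto simp: abs_le_iff)
    show "(f_u f x 0 - 1 - \<epsilon>) * v \<le> f x v - v" if v: "0 \<le> v" "v \<le> \<eta>" for v x
    proof -
      have "Q * v * v \<le> Q * \<eta> * v" using v Q(1) by (intro mult_right_mono mult_left_mono) auto
      also have "\<dots> \<le> \<epsilon> * v" using \<eta>(3) v(1) by (intro mult_right_mono)
      finally show ?thesis using Q(2)[of v x] v \<eta>(2) by (simp add: power2_eq_square algebra_simps)
    qed
    show "(\<lambda>z. \<psi> (fst z) (snd z)) \<in> borel_measurable (borel \<Otimes>\<^sub>M borel)" by (rule \<psi>m)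
    show "periodic (\<psi> s)" for s by (rule per)
    show "0 < \<psi> s x" for s x unfolding \<psi>u by (rule entire_solution_pos[OF sol c u lim1])
    show "\<psi> s x \<le> \<eta>" if "s \<le> T" for s x using T[OF that, of x] by (simp add: dist_real_def)
    show "uniform_limit UNIV \<psi> (\<lambda>x. 0) at_bot" by (rule lim0)
    show "((\<lambda>t. \<psi> (s + c * t) x) has_real_derivative
        conv J (\<lambda>y. \<psi> (s + c * t - (x - y) \<bullet> e) y) x - \<psi> (s + c * t) x + f x (\<psi> (s + c * t) x)) (at t)" for s x t
    proof -
      let ?a = "(s - x \<bullet> e) / c"
      have e1: "\<psi> (s + c * t - (x - y) \<bullet> e) y = u y (?a + t)" for y t
        using c unfolding \<psi>u by (intro arg_cong[where f="u y"]) (simp add: inner_diff_left field_simps)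
      have e2: "\<psi> (s + c * t) x = u x (?a + t)" for t using e1[of t x] by simp
      have "((\<lambda>t. ?a + t) has_real_derivative 1) (at t)" by (auto intro!: derivative_eq_intros)
      from DERIV_chain2[OF der this]
      show ?thesis unfolding e1 e2 by simp
    qed
  qed simp
  show ?thesis by (rule wave_speed_bound[OF \<epsilon> d])
qed

lemma periodic_eigenpair_iff:
  "bump K \<Longrightarrow> periodic_eigenpair K f \<mu> \<phi> \<longleftrightarrow> bump.eigen K (\<lambda>x. f_u f x 0 - 1) (- \<mu>) \<phi>"
  unfolding periodic_eigenpair_def bump.eigen_def
  by (intro conj_cong refl all_cong1) (auto simp: algebra_simps)

lemma (in kpp) principal_eigenvalue_eq: "principal_eigenvalue (Jt l) f = - nu l"
  unfolding principal_eigenvalue_def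
proof (rule the_equality)
  obtain \<phi> where "tk.eigen l (\<lambda>x. f_u f x 0 - 1) (nu l) \<phi>" using nu_eigen by blast
  then show "\<exists>\<phi>. periodic_eigenpair (Jt l) f (- nu l) \<phi>"
    by (auto simp: periodic_eigenpair_iff[OF tk.bump_axioms])
  fix \<mu> assume "\<exists>\<phi>. periodic_eigenpair (Jt l) f \<mu> \<phi>"
  then show "\<mu> = - nu l" using nu_eqI by (auto simp: periodic_eigenpair_iff[OF tk.bump_axioms])
qed

theorem mainTheorem3:
  fixes J :: "real ^ 'n \<Rightarrow> real"
    and f :: "real ^ 'n \<Rightarrow> real \<Rightarrow> real"
    and e :: "real ^ 'n"
    and cstar :: real
  assumes "kernel_assms J"
    and "reaction_assms f"
    and "mu0 J f < 0"
    and "\<exists>\<phi>. periodic_eigenpair J f (mu0 J f) \<phi>"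
    and "norm e = 1"
    and "0 < cstar"
    and "minimal_speed J f e cstar"
  shows "cstar = (INF l\<in>{0<..}. - principal_eigenvalue (tilted_kernel J e l) f / l)"
proof -
  interpret reaction f by unfold_locales (rule assms(2))
  interpret tilted J e by unfold_locales (use assms in auto)
  obtain \<phi>0 where "periodic_eigenpair J f (mu0 J f) \<phi>0" using assms(4) by blast
  then have eig: "eigen (\<lambda>x. f_u f x 0 - 1) (- mu0 J f) \<phi>0"
    by (simp add: periodic_eigenpair_iff[OF bump_axioms])
  have aC: "(\<lambda>x. f_u f x 0 - 1) \<in> C_per" by (intro C_per_intros f_u_C_per C_per_const)
  interpret kpp f J e \<phi>0 "- mu0 J f" by unfold_locales (use assms(3) eig aC in auto)
  define \<nu> where "\<nu> = - mu0 J f"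
  have \<nu>0: "0 < \<nu>" using assms(3) by (simp add: \<nu>_def)
  have nu_ge': "\<nu> \<le> nu l" for l unfolding \<nu>_def by (rule nu_ge)
  let ?g = "\<lambda>l. nu l / l"
  have lower: "cstar \<le> ?g l" if l: "0 < l" for l
  proof (rule ccontr)
    assume "\<not> cstar \<le> ?g l"
    then have lt: "?g l < cstar" by simp
    \<comment> \<open>A front of this intermediate speed, positive because nu l > 0, would be slower
      than the minimal one.\<close>
    obtain c where c': "?g l < c" "c < cstar" using dense[OF lt] by blast
    have "0 < ?g l" using nu_ge'[of l] \<nu>0 l by (intro divide_pos_pos) auto
    then have c: "0 < c" "c < cstar" "?g l < c" using c' by auto
    have "nu l < c * l" using c(3) l by (simp add: pos_divide_less_eq)
    then obtain u where "pulsating_front J f e c u" using front_exists[OF c(1) l] by blast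
    then show False using assms(7) c(2) unfolding minimal_speed_def by blast
  qed
  have bdd: "bdd_below (?g ` {0<..})" using lower by (auto simp: bdd_below_def)
  have gapC: "(\<lambda>x. \<nu> - (f_u f x 0 - 1)) \<in> C_per" by (intro C_per_intros aC C_per_const)
  have gap0: "0 < \<nu> - (f_u f x 0 - 1)" for x using eigen_gap_pos[OF eig, of x] by (simp add: \<nu>_def)
  obtain d where d: "0 < d" "\<And>x. d \<le> \<nu> - (f_u f x 0 - 1)" using C_per_pos_bounds[OF gapC gap0] by metis
  obtain u where front: "pulsating_front J f e cstar u" using assms(7) unfolding minimal_speed_def by blast
  have "(INF l\<in>{0<..}. ?g l) \<le> cstar"
  proof (rule field_le_epsilon)
    fix \<delta> :: real assume \<delta>: "0 < \<delta>"
    \<comment> \<open>The first bound is the condition of \<open>front_speed_bound\<close>. The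
      second yields cstar \<beta> \<ge> \<nu> / 2, which keeps \<beta> away from 0; the third then
      gives 3 \<epsilon> / \<beta> \<le> \<delta>.\<close>
    define \<epsilon> where "\<epsilon> = min (d / 4) (min (\<nu> / 6) (\<delta> * \<nu> / (6 * cstar)))"
    have \<epsilon>: "0 < \<epsilon>" "4 * \<epsilon> \<le> d" "6 * \<epsilon> \<le> \<nu>" "6 * cstar * \<epsilon> \<le> \<delta> * \<nu>"
    proof -
      show "0 < \<epsilon>" using d(1) \<nu>0 \<delta> assms(6) by (simp add: \<epsilon>_def)
      have "\<epsilon> \<le> d / 4" "\<epsilon> \<le> \<nu> / 6" "\<epsilon> \<le> \<delta> * \<nu> / (6 * cstar)" by (simp_all add: \<epsilon>_def)
      then show "4 * \<epsilon> \<le> d" "6 * \<epsilon> \<le> \<nu>" "6 * cstar * \<epsilon> \<le> \<delta> * \<nu>"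
        using assms(6) by (simp_all add: pos_le_divide_eq mult_ac)
    qed
    obtain \<beta> where \<beta>: "0 < \<beta>" "nu \<beta> < cstar * \<beta> + 3 * \<epsilon>"
      using front_speed_bound[OF assms(6) front \<epsilon>(1) d(1) d(2)[unfolded \<nu>_def] \<epsilon>(2)] by blast
    have "\<nu> / 2 \<le> cstar * \<beta>" using nu_ge'[of \<beta>] \<beta>(2) \<epsilon>(3) by simp
    then have "\<delta> * (\<nu> / 2) \<le> \<delta> * (cstar * \<beta>)" using \<delta> by (intro mult_left_mono) auto
    then have "cstar * (3 * \<epsilon>) \<le> cstar * (\<delta> * \<beta>)" using \<epsilon>(4) by (simp add: algebra_simps)
    then have "3 * \<epsilon> \<le> \<delta> * \<beta>" using assms(6) by (simp add: mult_le_cancel_left_pos)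
    then have "nu \<beta> \<le> (cstar + \<delta>) * \<beta>" using \<beta>(2) by (simp add: algebra_simps)
    then have "?g \<beta> \<le> cstar + \<delta>" using \<beta>(1) by (simp add: pos_divide_le_eq)
    moreover have "(INF l\<in>{0<..}. ?g l) \<le> ?g \<beta>" using \<beta>(1) by (intro cINF_lower bdd) auto
    ultimately show "(INF l\<in>{0<..}. ?g l) \<le> cstar + \<delta>" by linarith
  qed
  moreover have "cstar \<le> (INF l\<in>{0<..}. ?g l)"
    using lower by (intro cINF_greatest) (auto intro: exI[of _ 1])
  ultimately show ?thesis by (simp add: principal_eigenvalue_eq)
qed

end
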